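(* Let $g\ge 0$ be an integer and let $R$ be a Noetherian ring. Then any submodule of a finitely generated $\mathcal{G}_{\le g}^{\mathrm{op}}$-module over $R$ is itself finitely generated.
   Context: Graphs. A graph is a quintuple $G=(V,A,h,t,\sigma)$ where $V,A$ are finite sets (vertices and arrows), $h,t:A\to V$ are maps (head and tail), and $\sigma$ is a fixed-point-free involution of $A$ with $h=t\circ\sigma$. Its edges are the elements of $E(G)=A/\sigma$. "Connected" has its usual meaning; a tree is a nonempty connected graph without cycles (loops and pairs of parallel edges count as cycles). Minor morphisms. A minor morphism from $G=(V,A,h,t,\sigma)$ to $G'=(V',A',h',t',\sigma')$ is a map $\varphi:V\sqcup A\sqcup\{\star\}\to V'\sqcup A'\sqcup\{\star\}$ such that: $\varphi(\star)=\star$; $\varphi(v)\in V'$ for every $v\in V$; $\varphi(\sigma(a))=\sigma'(\varphi(a))$ for every $a\in A$, where $\sigma'$ acts trivially on $V'\sqcup\{\star\}$; for every $a'\in A'$ there is a unique $a\in A$ with $\varphi(a)=a'$; if $\varphi(a)\in A'$ then $\varphi(h(a))=h'(\varphi(a))$ and $\varphi(t(a))=t'(\varphi(a))$; if $\varphi(a)\in V'$ then $\varphi(h(a))=\varphi(a)=\varphi(t(a))$; for every $v'\in V'$, the set $\varphi^{-1}(v')$ consists of the edges (arrows) and vertices of a tree. Minor morphisms compose as functions. Category. The genus of $G$ is $|E(G)|-|V|+1$. $\mathcal{G}_{\le g}$ is the category whose objects are nonempty connected graphs of genus at most $g$ and whose morphisms are minor morphisms. Modules. A $\mathcal{G}_{\le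 g}^{\mathrm{op}}$-module over a ring $R$ is a functor $M$ from $\mathcal{G}_{\le g}^{\mathrm{op}}$ to $R$-modules; a minor morphism $\varphi:G\to G'$ induces $M(\varphi):M(G')\to M(G)$. Submodules are subfunctors. $M$ is finitely generated if there is a finite list of graphs $G_1,\dots,G_r$ in $\mathcal{G}_{\le g}$ such that each $M(G_i)$ is a finitely generated $R$-module and, for every $G$ in $\mathcal{G}_{\le g}$, $M(G)$ is spanned over $R$ by the images of the $M(G_i)$ under the maps induced by all minor morphisms $G\to G_i$. *)

theory Defs
  imports
    "Graph_Theory.Bidirected_Digraph"
    "Graph_Theory.Digraph_Component"
    "HOL-Combinatorics.Orbits"
    "HOL-Algebra.Module"
    "HOL-Algebra.Ring_Divisibility"
    "HOL-Library.Infinite_Typeclass"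
begin

section \<open>Graphs\<close>

record ('v, 'a) ugraph =
  dg :: "('v, 'a) pre_digraph"
  flip :: "'a \<Rightarrow> 'a"

text \<open>
  The locale \<^locale>\<open>bidirected_digraph\<close> says that \<open>flip\<close> is a fixed-point-free involution of
  the arrows exchanging heads and tails; \<open>flip\<close> is the identity outside the set of arrows.
  Head and tail are extensional, so that equality of graphs is equality of the underlying tuples.
\<close>

definition is_graph :: "('v, 'a) ugraph \<Rightarrow> bool" where
  "is_graph G \<longleftrightarrow> fin_digraph (dg G) \<and> bidirected_digraph (dg G) (flip G) \<and>
     head (dg G) \<in> extensional (arcs (dg G)) \<and> tail (dg G) \<in> extensional (arcs (dg G))"

definition edges :: "('v, 'a) ugraph \<Rightarrow> 'a set set" where
  "edges G = (\<lambda>a. {a, flip G a}) ` arcs (dg G)"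

definition genus :: "('v, 'a) ugraph \<Rightarrow> int" where
  "genus G = int (card (edges G)) - int (card (verts (dg G))) + 1"

text \<open>
  The predicate \<^const>\<open>pre_digraph.cycle\<close> is about directed closed walks, and holds for the walk
  that follows an edge back and forth. A cycle in the undirected sense must not use both
  orientations of an edge. A loop is a cycle of length one, and a pair of parallel edges gives
  cycles of length two. For the same reason the library's predicate \<^const>\<open>tree\<close> is not the one
  needed here.
\<close>

definition ucycle :: "('v, 'a) ugraph \<Rightarrow> 'a list \<Rightarrow> bool" where
  "ucycle G p \<longleftrightarrow> pre_digraph.cycle (dg G) p \<and> (\<forall>a\<in>set p. flip G a \<notin> set p)"

text \<open>The predicate \<^const>\<open>connected\<close> of the library includes nonemptiness.\<close>

definition utree :: "('v, 'a) ugraph \<Rightarrow> bool" where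
  "utree T \<longleftrightarrow> is_graph T \<and> connected (dg T) \<and> (\<nexists>p. ucycle T p)"

definition graphs_genus_le :: "nat \<Rightarrow> ('v, 'a) ugraph set" where
  "graphs_genus_le g = {G. is_graph G \<and> connected (dg G) \<and> genus G \<le> int g}"


section \<open>Minor morphisms\<close>

text \<open>The disjoint union of vertices, arrows and an extra point.\<close>

datatype ('v, 'a) elt = Vert 'v | Arrow 'a | Star

definition elts :: "('v, 'a) ugraph \<Rightarrow> ('v, 'a) elt set" where
  "elts G = Vert ` verts (dg G) \<union> Arrow ` arcs (dg G) \<union> {Star}"

definition fiber :: "('v, 'a) ugraph \<Rightarrow> (('v, 'a) elt \<Rightarrow> ('w, 'b) elt) \<Rightarrow> 'w \<Rightarrow> ('v, 'a) ugraph" where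
  "fiber G \<phi> v' =
     (let V = {v \<in> verts (dg G). \<phi> (Vert v) = Vert v'};
          A = {a \<in> arcs (dg G). \<phi> (Arrow a) = Vert v'}
      in \<lparr>dg = \<lparr>verts = V, arcs = A,
                 tail = restrict (tail (dg G)) A, head = restrict (head (dg G)) A\<rparr>,
          flip = perm_restrict (flip G) A\<rparr>)"

text \<open>
  Minor morphisms are extensional functions on \<^const>\<open>elts\<close>. The map
  \<open>map_elt id (flip G')\<close> is the involution of \<open>G'\<close> extended trivially to vertices and \<^const>\<open>Star\<close>.
\<close>

definition minor_morphism ::
  "('v, 'a) ugraph \<Rightarrow> ('w, 'b) ugraph \<Rightarrow> (('v, 'a) elt \<Rightarrow> ('w, 'b) elt) \<Rightarrow> bool" where
  "minor_morphism G G' \<phi> \<longleftrightarrow>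
     \<phi> \<in> elts G \<rightarrow>\<^sub>E elts G' \<and>
     \<phi> Star = Star \<and>
     (\<forall>v\<in>verts (dg G). \<phi> (Vert v) \<in> Vert ` verts (dg G')) \<and>
     (\<forall>a\<in>arcs (dg G). \<phi> (Arrow (flip G a)) = map_elt id (flip G') (\<phi> (Arrow a))) \<and>
     (\<forall>a'\<in>arcs (dg G'). \<exists>!a. a \<in> arcs (dg G) \<and> \<phi> (Arrow a) = Arrow a') \<and>
     (\<forall>a\<in>arcs (dg G). \<forall>a'. \<phi> (Arrow a) = Arrow a' \<longrightarrow>
        \<phi> (Vert (head (dg G) a)) = Vert (head (dg G') a') \<and>
        \<phi> (Vert (tail (dg G) a)) = Vert (tail (dg G') a')) \<and>
     (\<forall>a\<in>arcs (dg G). \<forall>v'. \<phi> (Arrow a) = Vert v' \<longrightarrow>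
        \<phi> (Vert (head (dg G) a)) = Vert v' \<and> \<phi> (Vert (tail (dg G) a)) = Vert v') \<and>
     (\<forall>v'\<in>verts (dg G'). utree (fiber G \<phi> v'))"

lemma minor_morphism_id:
  assumes "is_graph G"
  shows "minor_morphism G G (\<lambda>e\<in>elts G. e)"
proof -
  interpret fin_digraph "dg G" using assms by (simp add: is_graph_def)
  interpret bidirected_digraph "dg G" "flip G" using assms by (simp add: is_graph_def)
  have [simp]: "Vert v \<in> elts G \<longleftrightarrow> v \<in> verts (dg G)" "Arrow a \<in> elts G \<longleftrightarrow> a \<in> arcs (dg G)"
    "Star \<in> elts G" for v a
    by (auto simp: elts_def)
  have fib: "fiber G (\<lambda>e\<in>elts G. e) v =
      \<lparr>dg = \<lparr>verts = {v}, arcs = {}, tail = \<lambda>_. undefined, head = \<lambda>_. undefined\<rparr>, flip = \<lambda>a. a\<rparr>"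
    (is "_ = ?T v") if v: "v \<in> verts (dg G)" for v
  proof -
    have "{w \<in> verts (dg G). (\<lambda>e\<in>elts G. e) (Vert w) = Vert v} = {v}"
      "{a \<in> arcs (dg G). (\<lambda>e\<in>elts G. e) (Arrow a) = Vert v} = {}"
      using v by auto
    then show ?thesis
      by (simp add: fiber_def Let_def perm_restrict_def fun_eq_iff)
  qed
  have "utree (?T v)" for v :: 'a
  proof -
    have "is_graph (?T v)"
      by (auto simp: is_graph_def fin_digraph_def fin_digraph_axioms_def wf_digraph_def
        bidirected_digraph_def bidirected_digraph_axioms_def)
    moreover have "connected (dg (?T v))"
      by (auto simp: connected_def strongly_connected_def reachable_def mk_symmetric_def
        intro: rtrancl_on_refl)
    moreover have "\<not> ucycle (?T v) p" for p
      by (cases p) (auto simp: ucycle_def pre_digraph.cycle_def pre_digraph.awalk_def)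
    ultimately show ?thesis by (simp add: utree_def)
  qed
  then show ?thesis
    using fib by (auto simp: minor_morphism_def PiE_iff elts_def)
qed


section \<open>Modules over a ring\<close>

text \<open>
  Rings are not assumed commutative and modules are left modules. The library's locale
  \<^locale>\<open>module\<close> consists of the same axioms together with commutativity of the ring.
\<close>

definition left_module :: "('r, 'e) ring_scheme \<Rightarrow> ('r, 'm, 'f) module_scheme \<Rightarrow> bool" where
  "left_module R M \<longleftrightarrow> ring R \<and> abelian_group M \<and> module_axioms R M"

lemma left_module_iff_module: "cring R \<Longrightarrow> left_module R M \<longleftrightarrow> module R M"
  by (auto simp: left_module_def module_def cring.axioms(1))

definition linear_map ::
  "('r, 'e) ring_scheme \<Rightarrow> ('r, 'm, 'f) module_scheme \<Rightarrow> ('r, 'n, 'h) module_scheme \<Rightarrow>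
   ('m \<Rightarrow> 'n) \<Rightarrow> bool" where
  "linear_map R M N f \<longleftrightarrow> f \<in> hom (add_monoid M) (add_monoid N) \<and>
     (\<forall>r\<in>carrier R. \<forall>x\<in>carrier M. f (r \<odot>\<^bsub>M\<^esub> x) = r \<odot>\<^bsub>N\<^esub> f x)"

definition lspan :: "('r, 'e) ring_scheme \<Rightarrow> ('r, 'm, 'f) module_scheme \<Rightarrow> 'm set \<Rightarrow> 'm set" where
  "lspan R M S = (\<lambda>H. submodule H R M) hull S"

definition fg_module :: "('r, 'e) ring_scheme \<Rightarrow> ('r, 'm, 'f) module_scheme \<Rightarrow> bool" where
  "fg_module R M \<longleftrightarrow> (\<exists>S\<subseteq>carrier M. finite S \<and> lspan R M S = carrier M)"

definition regular_module :: "('r, 'e) ring_scheme \<Rightarrow> ('r, 'r) module" where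
  "regular_module R = \<lparr>carrier = carrier R, mult = mult R, one = one R,
     zero = zero R, add = add R, smult = mult R\<rparr>"

text \<open>
  Every left ideal is finitely generated. The library's locale \<^locale>\<open>noetherian_ring\<close> is about
  two-sided ideals; the two notions agree for commutative rings.
\<close>

definition left_noetherian :: "('r, 'e) ring_scheme \<Rightarrow> bool" where
  "left_noetherian R \<longleftrightarrow> ring R \<and>
     (\<forall>I. submodule I R (regular_module R) \<longrightarrow>
        (\<exists>S\<subseteq>carrier R. finite S \<and> I = lspan R (regular_module R) S))"

lemma submodule_regular_iff_ideal:
  assumes "cring R"
  shows "submodule I R (regular_module R) \<longleftrightarrow> ideal I R"
proof -
  interpret cring R by fact
  have sub: "subgroup I (add_monoid (regular_module R)) \<longleftrightarrow> subgroup I (add_monoid R)"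
    by (simp add: regular_module_def subgroup_def m_inv_def)
  show ?thesis
  proof
    assume I: "submodule I R (regular_module R)"
    then have I1: "subgroup I (add_monoid R)"
      using sub submodule.axioms(1) by blast
    have I2: "a \<otimes>\<^bsub>R\<^esub> x \<in> I" if "a \<in> carrier R" "x \<in> I" for a x
      using submodule.smult_closed[OF I that] by (simp add: regular_module_def)
    have "I \<subseteq> carrier R"
      using subgroup.subset[OF I1] by simp
    then have "x \<otimes>\<^bsub>R\<^esub> a \<in> I" if "a \<in> carrier R" "x \<in> I" for a x
      using I2[OF that] m_comm that by (metis subsetD)
    with I1 I2 show "ideal I R"
      by (intro idealI ring_axioms)
  next
    assume I: "ideal I R"
    then have "subgroup I (add_monoid R)"
      by (simp add: additive_subgroup.a_subgroup ideal.axioms(1))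
    then show "submodule I R (regular_module R)"
      using I sub by (auto intro!: submodule.intro submodule_axioms.intro
        simp: regular_module_def ideal.I_l_closed)
  qed
qed

lemma left_noetherian_iff_noetherian_ring:
  assumes "cring R"
  shows "left_noetherian R \<longleftrightarrow> noetherian_ring R"
proof -
  have "lspan R (regular_module R) S = genideal R S" for S
    using submodule_regular_iff_ideal[OF assms]
    by (simp add: lspan_def hull_def genideal_def)
  then show ?thesis
    using submodule_regular_iff_ideal[OF assms] cring.axioms(1)[OF assms]
    by (auto simp: left_noetherian_def noetherian_ring_def noetherian_ring_axioms_def)
qed


section \<open>Contravariant modules on the category of graphs of bounded genus\<close>

text \<open>
  A minor morphism \<open>\<phi>\<close> from \<open>G\<close> to \<open>G'\<close> acts as \<open>mor M G G' \<phi>\<close> from \<open>obj M G'\<close> to \<open>obj M G\<close>.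
  The values of \<open>obj\<close> and \<open>mor\<close> outside the category, and those of \<open>mor\<close> outside the carrier of its
  source, are irrelevant.
\<close>

record ('v, 'a, 'r, 'm) gmodule =
  obj :: "('v, 'a) ugraph \<Rightarrow> ('r, 'm) module"
  mor :: "('v, 'a) ugraph \<Rightarrow> ('v, 'a) ugraph \<Rightarrow> (('v, 'a) elt \<Rightarrow> ('v, 'a) elt) \<Rightarrow> 'm \<Rightarrow> 'm"

definition is_gmodule ::
  "nat \<Rightarrow> ('r, 'e) ring_scheme \<Rightarrow> ('v, 'a, 'r, 'm) gmodule \<Rightarrow> bool" where
  "is_gmodule g R M \<longleftrightarrow>
     (\<forall>G\<in>graphs_genus_le g. left_module R (obj M G)) \<and>
     (\<forall>G\<in>graphs_genus_le g. \<forall>G'\<in>graphs_genus_le g. \<forall>\<phi>. minor_morphism G G' \<phi> \<longrightarrow>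
        linear_map R (obj M G') (obj M G) (mor M G G' \<phi>)) \<and>
     (\<forall>G\<in>graphs_genus_le g. \<forall>x\<in>carrier (obj M G). mor M G G (\<lambda>e\<in>elts G. e) x = x) \<and>
     (\<forall>G\<in>graphs_genus_le g. \<forall>G'\<in>graphs_genus_le g. \<forall>G''\<in>graphs_genus_le g. \<forall>\<phi> \<psi>.
        minor_morphism G G' \<phi> \<longrightarrow> minor_morphism G' G'' \<psi> \<longrightarrow>
        (\<forall>x\<in>carrier (obj M G'').
           mor M G G'' (compose (elts G) \<psi> \<phi>) x = mor M G G' \<phi> (mor M G' G'' \<psi> x)))"

definition is_gsubmodule ::
  "nat \<Rightarrow> ('r, 'e) ring_scheme \<Rightarrow> ('v, 'a, 'r, 'm) gmodule \<Rightarrow>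
   (('v, 'a) ugraph \<Rightarrow> 'm set) \<Rightarrow> bool" where
  "is_gsubmodule g R M N \<longleftrightarrow>
     (\<forall>G\<in>graphs_genus_le g. submodule (N G) R (obj M G)) \<and>
     (\<forall>G\<in>graphs_genus_le g. \<forall>G'\<in>graphs_genus_le g. \<forall>\<phi>. minor_morphism G G' \<phi> \<longrightarrow>
        mor M G G' \<phi> ` N G' \<subseteq> N G)"

definition gsubmodule_of ::
  "('v, 'a, 'r, 'm) gmodule \<Rightarrow> (('v, 'a) ugraph \<Rightarrow> 'm set) \<Rightarrow> ('v, 'a, 'r, 'm) gmodule" where
  "gsubmodule_of M N = \<lparr>obj = (\<lambda>G. (obj M G)\<lparr>carrier := N G\<rparr>), mor = mor M\<rparr>"

definition fg_gmodule ::
  "nat \<Rightarrow> ('r, 'e) ring_scheme \<Rightarrow> ('v, 'a, 'r, 'm) gmodule \<Rightarrow> bool" where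
  "fg_gmodule g R M \<longleftrightarrow>
     (\<exists>Gs. set Gs \<subseteq> graphs_genus_le g \<and> (\<forall>H\<in>set Gs. fg_module R (obj M H)) \<and>
        (\<forall>G\<in>graphs_genus_le g.
           lspan R (obj M G)
             (\<Union>H\<in>set Gs. \<Union>\<phi>\<in>{\<phi>. minor_morphism G H \<phi>}. mor M G H \<phi> ` carrier (obj M H))
           = carrier (obj M G)))"

lemma is_gmodule_gsubmodule_of:
  assumes M: "is_gmodule g R M" and N: "is_gsubmodule g R M N"
  shows "is_gmodule g R (gsubmodule_of M N)"
proof -
  have sub: "N G \<subseteq> carrier (obj M G)" if "G \<in> graphs_genus_le g" for G
    using N that subgroup.subset[OF submodule.axioms(1)] by (fastforce simp: is_gsubmodule_def)
  have 1: "left_module R ((obj M G)\<lparr>carrier := N G\<rparr>)" if G: "G \<in> graphs_genus_le g" for G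
  proof -
    have m: "left_module R (obj M G)" and s: "submodule (N G) R (obj M G)"
      using M N G by (auto simp: is_gmodule_def is_gsubmodule_def)
    interpret abelian_group "obj M G"
      using m by (simp add: left_module_def)
    have sg: "subgroup (N G) (add_monoid (obj M G))"
      using s by (rule submodule.axioms)
    have "comm_group ((add_monoid (obj M G))\<lparr>carrier := N G\<rparr>)"
    proof (rule group.group_comm_groupI)
      show "group ((add_monoid (obj M G))\<lparr>carrier := N G\<rparr>)"
        using add.subgroup_imp_group[OF sg] .
    qed (use sub[OF G] a_comm in \<open>auto simp: subset_iff\<close>)
    then have ab: "abelian_group ((obj M G)\<lparr>carrier := N G\<rparr>)"
      by (intro abelian_group.intro abelian_monoid.intro abelian_group_axioms.intro)
        (simp_all add: comm_group_def)
    have ax: "module_axioms R (obj M G)"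
      using m by (simp add: left_module_def)
    have "module_axioms R ((obj M G)\<lparr>carrier := N G\<rparr>)"
      using ax sub[OF G] submodule.smult_closed[OF s]
      unfolding module_axioms_def by (simp add: subset_iff)
    with ab m show ?thesis
      by (simp add: left_module_def)
  qed
  have 2: "linear_map R ((obj M G')\<lparr>carrier := N G'\<rparr>) ((obj M G)\<lparr>carrier := N G\<rparr>) (mor M G G' \<phi>)"
    if G: "G \<in> graphs_genus_le g" "G' \<in> graphs_genus_le g" "minor_morphism G G' \<phi>" for G G' \<phi>
  proof -
    have "linear_map R (obj M G') (obj M G) (mor M G G' \<phi>)" "mor M G G' \<phi> ` N G' \<subseteq> N G"
      using M N G by (auto simp: is_gmodule_def is_gsubmodule_def)
    then show ?thesis
      using sub[OF G(1)] sub[OF G(2)] by (auto simp: linear_map_def hom_def subset_iff)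
  qed
  from M 1 2 sub show ?thesis
    unfolding is_gmodule_def gsubmodule_of_def by (simp add: subset_iff)
qed

end

theory Submission
  imports Defs "HOL-Library.Ramsey"
begin

text \<open>
The proof is a Groebner basis argument. Let \<open>M\<close> be generated by finitely many elements
\<open>m \<in> M(H)\<close>. Then \<open>M(G)\<close> is spanned by the finitely many elements \<open>M(\<phi>)(m)\<close>, one for every
generator and every minor morphism \<open>\<phi>\<close> from \<open>G\<close> to \<open>H\<close>. Once these pairs \<open>(m, \<phi>)\<close> are linearly
ordered, every submodule of \<open>M(G)\<close> has a left ideal of leading coefficients at each pair, and two
nested submodules with the same ideals are equal (\<open>subset_by_leading\<close>). A minor morphism \<open>f\<close> from
\<open>G'\<close> to \<open>G\<close> sends the pair \<open>(m, \<phi>)\<close> over \<open>G\<close> to the pair \<open>(m, \<phi> \<circ> f)\<close> over \<open>G'\<close>. If this map is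
strictly increasing, then for a submodule \<open>N\<close> of \<open>M\<close> the ideal at \<open>(m, \<phi>)\<close> is contained in the
ideal at \<open>(m, \<phi> \<circ> f)\<close> (\<open>mor_leading\<close>). Suppose that among any infinite sequence of pairs, over
arbitrary graphs, some pair is obtained from an earlier one by such an order-preserving pullback.
Together with the ascending chain condition in \<open>R\<close> this yields finitely many pairs from which every
other pair is obtained by a pullback that does not change the ideal. The values of \<open>N\<close> at their
graphs generate \<open>N\<close>, and they are finitely generated over \<open>R\<close> by the same argument for one graph
(\<open>noetherian_submodule_fg\<close>).

It remains to choose the orders and to prove the statement on sequences
(\<open>almost_full_ordered_pullback\<close>). Every connected graph \<open>G\<close> gets a frame: a spanning tree, drawn as a
rooted plane tree, and a numbering of the surplus edges, of which there are \<open>genus G \<le> g\<close>. A minor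
morphism \<open>\<phi>\<close> from \<open>G\<close> to \<open>H\<close> labels each vertex of the tree by its image, by the image of the arrow
to its parent and by the ends of surplus edges that it carries. These labels come from a finite set,
so Kruskal's theorem, in the form \<open>almost_full_forest_emb\<close> for plane trees, provides a
label-preserving embedding of the tree of some \<open>\<phi>\<close> into the tree of a later \<open>\<phi>'\<close>. An embedding of
trees gives a contraction in the opposite direction, which sends each vertex to its nearest ancestor
in the image (\<open>contraction_exists\<close>). As the labels record the ends of the surplus edges, the
contraction extends to a minor morphism \<open>f\<close> of the graphs (\<open>minor_morphism_cmap\<close>).

For \<open>\<phi>' = \<phi> \<circ> f\<close> the map \<open>\<phi>'\<close> has to contract all the edges that \<open>f\<close> contracts. Here the bound on
the genus enters a second time: the number of tree edges that a minor morphism to \<open>H\<close> does not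
contract is bounded in terms of \<open>g\<close> and \<open>H\<close> (\<open>card_uncontracted\<close>). After passing to a subsequence on
which this number is constant, the embedding, which maps uncontracted edges injectively to
uncontracted edges, hits all of them. Finally, the pairs are compared lexicographically, reading the
surplus edges first and then the tree in preorder. Each fibre of \<open>f\<close> has a first element in this
reading order, and these first elements are in the same order as their images; this is why
composition with \<open>f\<close> is strictly increasing (\<open>lex_less_compose\<close>).
\<close>

section \<open>Almost-full relations and plane forests\<close>

text \<open>
  For a transitive relation this is the notion of a well-quasi-order. Ramsey's theorem replaces
  transitivity where a whole increasing subsequence is needed.
\<close>

definition almost_full_on :: "('a \<Rightarrow> 'a \<Rightarrow> bool) \<Rightarrow> 'a set \<Rightarrow> bool" where
  "almost_full_on P A \<longleftrightarrow>
     (\<forall>s::nat \<Rightarrow> 'a. (\<forall>n. s n \<in> A) \<longrightarrow> (\<exists>i j. i < j \<and> P (s i) (s j)))"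

lemma almost_full_onD:
  assumes "almost_full_on P A" "\<And>n. s n \<in> A"
  shows "\<exists>i j :: nat. i < j \<and> P (s i) (s j)"
  using assms by (simp add: almost_full_on_def)

lemma almost_full_on_subsequence:
  assumes P: "almost_full_on P A" and s: "\<And>n. s n \<in> A"
  shows "\<exists>r :: nat \<Rightarrow> nat. strict_mono r \<and> (\<forall>i j. i < j \<longrightarrow> P (s (r i)) (s (r j)))"
proof -
  \<comment> \<open>Colour pairs of indices by whether they are related. A homogeneous set of the other colour
    would be a bad sequence.\<close>
  define c :: "nat set \<Rightarrow> nat" where "c X = (if P (s (Min X)) (s (Max X)) then 0 else 1)" for X
  obtain Y t where Y: "infinite Y" and t: "\<forall>x\<in>Y. \<forall>y\<in>Y. x \<noteq> y \<longrightarrow> c {x, y} = t"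
  proof -
    have "\<forall>x\<in>UNIV. \<forall>y\<in>UNIV. x \<noteq> y \<longrightarrow> c {x, y} < 2" by (simp add: c_def)
    from Ramsey2[OF infinite_UNIV_nat this] that show thesis by blast
  qed
  define r where "r = enumerate Y"
  have r: "strict_mono r" "r n \<in> Y" for n
    using Y by (simp_all add: r_def enumerate_in_set strict_mono_enumerate)
  have c: "t = (if P (s (r i)) (s (r j)) then 0 else 1)" if "i < j" for i j
  proof -
    have "r i < r j" using r(1) that by (simp add: strict_mono_def)
    then have "c {r i, r j} = t" "Min {r i, r j} = r i" "Max {r i, r j} = r j"
      using r(2) t by (simp_all add: min_def max_def)
    then show ?thesis by (simp add: c_def)
  qed
  obtain i j where "i < j" "P (s (r i)) (s (r j))"
    using almost_full_onD[OF P, of "\<lambda>n. s (r n)"] s by auto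
  then have "t = 0" using c[of i j] by simp
  then have "P (s (r i)) (s (r j))" if "i < j" for i j
    using c[OF that] by (simp split: if_splits)
  with r(1) show ?thesis by (intro exI[of _ r]) simp
qed

lemma pigeonhole_subsequence:
  fixes s :: "nat \<Rightarrow> 'a"
  assumes "finite (range s)"
  shows "\<exists>r :: nat \<Rightarrow> nat. strict_mono r \<and> (\<forall>i j. s (r i) = s (r j))"
proof -
  obtain k where k: "infinite {n. s n = s k}"
    using pigeonhole_infinite[OF infinite_UNIV_nat, of s] assms by auto
  have "strict_mono (enumerate {n. s n = s k})"
    using k by (simp add: strict_mono_enumerate)
  moreover have "s (enumerate {n. s n = s k} i) = s k" for i
    using enumerate_in_set[OF k, of i] by simp
  ultimately show ?thesis by metis
qed

text \<open>
  Otherwise one can keep choosing elements that lie above none of those chosen before, and they form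
  a bad sequence.
\<close>

lemma almost_full_on_finite_basis:
  assumes P: "almost_full_on P A"
  shows "\<exists>F. finite F \<and> F \<subseteq> A \<and> (\<forall>a\<in>A. \<exists>b\<in>F. P b a)"
proof (rule ccontr)
  assume "\<not> ?thesis"
  then have neg: "\<exists>a\<in>A. \<forall>b\<in>F. \<not> P b a" if "finite F" "F \<subseteq> A" for F
    using that by (metis (no_types, lifting))
  have step: "\<exists>a. a \<in> A \<and> (\<forall>b\<in>set bs. \<not> P b a)" if "set bs \<subseteq> A" for bs
    using neg[of "set bs"] that by auto
  define nxt where "nxt bs = (SOME a. a \<in> A \<and> (\<forall>b\<in>set bs. \<not> P b a))" for bs
  define pre where "pre n = ((\<lambda>bs. nxt bs # bs) ^^ n) []" for n :: nat
  have pre: "set (pre n) \<subseteq> A" for n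
    unfolding pre_def
  proof (induction n)
    case (Suc n)
    then show ?case using someI_ex[OF step[OF Suc]] by (simp add: nxt_def)
  qed simp
  have new: "nxt (pre n) \<in> A" "\<forall>b\<in>set (pre n). \<not> P b (nxt (pre n))" for n
    using someI_ex[OF step[OF pre[of n]]] by (auto simp: nxt_def)
  have mem: "nxt (pre i) \<in> set (pre j)" if "i < j" for i j
    using that by (induction j) (auto simp: pre_def less_Suc_eq)
  obtain i j where "i < j" "P (nxt (pre i)) (nxt (pre j))"
    using almost_full_onD[OF P, of "\<lambda>n. nxt (pre n)"] new(1) by blast
  with new(2)[of j] mem show False by blast
qed

text \<open>
  The binary encoding of ordered forests: a node is stored with the forest of its children and the
  forest of its later siblings. It makes both parts of a forest smaller objects of the same type, so
  that Kruskal's theorem has a proof by pairs of parts, without a separate argument on words.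
\<close>

datatype (nodes: 'a) plane_forest =
  Empty
| Branch 'a (children: "'a plane_forest") (siblings: "'a plane_forest")

text \<open>
  In terms of contractions of the larger forest, hung below a vertex \<open>p\<close>: the rule \<open>children\<close> merges
  into \<open>p\<close> the first tree's root and all later trees, and the rule \<open>siblings\<close> merges the whole first
  tree into \<open>p\<close>.
\<close>

inductive forest_emb :: "'a plane_forest \<Rightarrow> 'a plane_forest \<Rightarrow> bool" where
  Empty: "forest_emb Empty t"
| children: "forest_emb t c \<Longrightarrow> forest_emb t (Branch x c s)"
| siblings: "forest_emb t s \<Longrightarrow> forest_emb t (Branch x c s)"
| Branch: "forest_emb c c' \<Longrightarrow> forest_emb s s' \<Longrightarrow> forest_emb (Branch x c s) (Branch x c' s')"

definition bad_sequence :: "('a \<Rightarrow> 'a \<Rightarrow> bool) \<Rightarrow> 'a set \<Rightarrow> (nat \<Rightarrow> 'a) \<Rightarrow> bool" where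
  "bad_sequence P A s \<longleftrightarrow> (\<forall>n. s n \<in> A) \<and> (\<forall>i j. i < j \<longrightarrow> \<not> P (s i) (s j))"

text \<open>
  The minimal bad sequence of Nash-Williams: the \<open>n\<close>-th entry is made as small as possible, given the
  entries before it.
\<close>

lemma minimal_bad_sequence:
  fixes m :: "'a \<Rightarrow> nat"
  assumes bad: "bad_sequence P A s"
  shows "\<exists>b. bad_sequence P A b \<and>
    (\<forall>b' n. bad_sequence P A b' \<and> (\<forall>k<n. b' k = b k) \<longrightarrow> m (b n) \<le> m (b' n))"
proof -
  define opt where "opt n s \<longleftrightarrow> bad_sequence P A s \<and>
    (\<forall>s'. bad_sequence P A s' \<and> (\<forall>k<n. s' k = s k) \<longrightarrow> m (s n) \<le> m (s' n))" for n s
  have ex: "\<exists>s'. opt n s' \<and> (\<forall>k<n. s' k = s k)" if "bad_sequence P A s" for n s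
  proof -
    have "bad_sequence P A s \<and> (\<forall>k<n. s k = s k)" using that by simp
    from ex_has_least_nat[of "\<lambda>s'. bad_sequence P A s' \<and> (\<forall>k<n. s' k = s k)", OF this,
        of "\<lambda>s. m (s n)"]
    obtain s' where s': "bad_sequence P A s'" "\<forall>k<n. s' k = s k"
      "\<forall>y. bad_sequence P A y \<and> (\<forall>k<n. y k = s k) \<longrightarrow> m (s' n) \<le> m (y n)"
      by blast
    then have "opt n s'" by (simp add: opt_def)
    with s'(2) show ?thesis by blast
  qed
  have "\<exists>S. \<forall>n. opt n (S n) \<and> (\<forall>k<Suc n. S (Suc n) k = S n k)"
  proof (rule dependent_nat_choice)
    show "\<exists>x. opt 0 x" using ex[OF bad, of 0] by auto
    show "\<exists>y. opt (Suc n) y \<and> (\<forall>k<Suc n. y k = x k)" if "opt n x" for x n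
      using ex[of x "Suc n"] that by (simp add: opt_def)
  qed
  then obtain S where opt: "\<And>n. opt n (S n)" and step: "\<And>n k. k \<le> n \<Longrightarrow> S (Suc n) k = S n k"
    by (auto simp: less_Suc_eq_le)
  have diag: "S n k = S k k" if "k \<le> n" for k n
    using that by (induction n rule: dec_induct) (auto simp: step)
  have "S n n \<in> A" for n using opt[of n] by (simp add: opt_def bad_sequence_def)
  moreover have "\<not> P (S i i) (S j j)" if "i < j" for i j
    using opt[of j] that diag[of i j] unfolding opt_def bad_sequence_def
    by (metis less_imp_le)
  ultimately have "bad_sequence P A (\<lambda>n. S n n)" by (simp add: bad_sequence_def)
  moreover have "m (S n n) \<le> m (b' n)"
    if "bad_sequence P A b'" "\<forall>k<n. b' k = S k k" for b' n
  proof -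
    have "\<forall>k<n. b' k = S n k" using that(2) by (metis diag less_imp_le)
    with opt[of n] that(1) show ?thesis by (simp add: opt_def)
  qed
  ultimately show ?thesis by blast
qed

text \<open>
  Kruskal's theorem for plane forests. In a minimal bad sequence the forests of children and the
  forests of siblings together are almost full, as a bad sequence of such parts could be spliced into
  the minimal one. One then finds two entries with the same root label, embeddable children and
  embeddable siblings.
\<close>

theorem almost_full_forest_emb:
  assumes L: "finite L"
  shows "almost_full_on forest_emb {t. nodes t \<subseteq> L}"
proof (rule ccontr)
  let ?A = "{t. nodes t \<subseteq> L}"
  assume "\<not> ?thesis"
  then obtain s where "bad_sequence forest_emb ?A s"
    unfolding almost_full_on_def bad_sequence_def by blast
  from minimal_bad_sequence[OF this, where m = size]
  obtain b where bad_b: "bad_sequence forest_emb ?A b"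
    and min: "\<forall>b' n. bad_sequence forest_emb ?A b' \<and> (\<forall>k<n. b' k = b k) \<longrightarrow> size (b n) \<le> size (b' n)"
    by blast
  have b: "b n \<in> ?A" "i < j \<Longrightarrow> \<not> forest_emb (b i) (b j)" for n i j
    using bad_b unfolding bad_sequence_def by blast+
  have "b n \<noteq> Empty" for n
    using b(2)[of n "Suc n"] by (auto intro: forest_emb.Empty)
  then have "\<forall>n. \<exists>x c r. b n = Branch x c r"
    by (metis plane_forest.exhaust)
  then obtain x c r where bn: "\<And>n. b n = Branch (x n) (c n) (r n)"
    by metis
  have parts: "almost_full_on forest_emb (range c \<union> range r)"
    unfolding almost_full_on_def
  proof (intro allI impI, rule ccontr)
    fix z :: "nat \<Rightarrow> 'a plane_forest"
    assume "\<forall>n. z n \<in> range c \<union> range r"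
    then have "\<forall>k. \<exists>n. z k = c n \<or> z k = r n" by blast
    then obtain \<nu> where \<nu>: "\<And>k. z k = c (\<nu> k) \<or> z k = r (\<nu> k)" by metis
    assume "\<not> (\<exists>i j. i < j \<and> forest_emb (z i) (z j))"
    then have bad: "\<And>i j. i < j \<Longrightarrow> \<not> forest_emb (z i) (z j)" by blast
    obtain k0 where k0: "\<And>k. \<nu> k0 \<le> \<nu> k"
      using ex_has_least_nat[of "\<lambda>_. True" 0 \<nu>] by auto
    define n0 where "n0 = \<nu> k0"
    \<comment> \<open>The parts replace the minimal sequence from the first place that they come from. An entry
      before that place which embeds into a part also embeds into the later entry with that part.\<close>
    define b' where "b' n = (if n < n0 then b n else z (n - n0 + k0))" for n
    have up: "forest_emb t (b (\<nu> k))" if "forest_emb t (z k)" for t k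
      using \<nu>[of k] that by (auto simp: bn intro: forest_emb.children forest_emb.siblings)
    have "bad_sequence forest_emb ?A b'"
      unfolding bad_sequence_def
    proof (intro conjI allI impI)
      show "b' k \<in> ?A" for k
        using b(1)[of k] b(1)[of "\<nu> (k - n0 + k0)"] \<nu>[of "k - n0 + k0"] by (auto simp: b'_def bn)
      show "\<not> forest_emb (b' i) (b' j)" if "i < j" for i j
      proof -
        consider "j < n0" | "i < n0" "n0 \<le> j" | "n0 \<le> i" by linarith
        then show ?thesis
        proof cases
          case 1
          with b(2) that show ?thesis by (simp add: b'_def)
        next
          case 2
          then have "i < \<nu> (j - n0 + k0)" using k0 n0_def by (metis less_le_trans)
          then have "\<not> forest_emb (b i) (z (j - n0 + k0))" using b(2) up by blast
          with 2 show ?thesis by (simp add: b'_def)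
        next
          case 3
          with bad[of "i - n0 + k0" "j - n0 + k0"] that show ?thesis by (simp add: b'_def)
        qed
      qed
    qed
    then have "size (b n0) \<le> size (b' n0)"
      using min[rule_format, of b' n0] by (simp add: b'_def)
    moreover have "size (b' n0) < size (b n0)"
      using \<nu>[of k0] by (auto simp: b'_def bn n0_def)
    ultimately show False by simp
  qed
  have "range x \<subseteq> L" using b(1) by (force simp: bn)
  then have "finite (range x)" using L finite_subset by blast
  from pigeonhole_subsequence[OF this]
  obtain r1 :: "nat \<Rightarrow> nat" where r1: "strict_mono r1" "\<forall>i j. x (r1 i) = x (r1 j)"
    by (elim exE conjE) (rule that)
  have "\<And>n. c (r1 n) \<in> range c \<union> range r" by blast
  from almost_full_on_subsequence[OF parts, where s = "\<lambda>n. c (r1 n)", OF this]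
  obtain r2 :: "nat \<Rightarrow> nat" where r2: "strict_mono r2"
    "\<forall>i j. i < j \<longrightarrow> forest_emb (c (r1 (r2 i))) (c (r1 (r2 j)))"
    by (elim exE conjE) (rule that)
  have "\<And>n. r (r1 (r2 n)) \<in> range c \<union> range r" by blast
  from almost_full_onD[OF parts, where s = "\<lambda>n. r (r1 (r2 n))", OF this]
  obtain i j where ij: "i < j" "forest_emb (r (r1 (r2 i))) (r (r1 (r2 j)))"
    by (elim exE conjE) (rule that)
  have "forest_emb (b (r1 (r2 i))) (b (r1 (r2 j)))"
    using ij r2(2) r1(2)[rule_format, of "r2 i" "r2 j"] by (simp add: bn forest_emb.Branch)
  moreover have "r1 (r2 i) < r1 (r2 j)"
    using ij(1) r1(1) r2(1) by (simp add: strict_mono_def)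
  ultimately show False using b(2) by blast
qed


section \<open>Connectedness, trees and composition of minor morphisms\<close>

abbreviation V :: "('v, 'a) ugraph \<Rightarrow> 'v set" where "V G \<equiv> verts (dg G)"
abbreviation A :: "('v, 'a) ugraph \<Rightarrow> 'a set" where "A G \<equiv> arcs (dg G)"
abbreviation src :: "('v, 'a) ugraph \<Rightarrow> 'a \<Rightarrow> 'v" where "src G \<equiv> tail (dg G)"
abbreviation tgt :: "('v, 'a) ugraph \<Rightarrow> 'a \<Rightarrow> 'v" where "tgt G \<equiv> head (dg G)"

locale undirected_graph = fin_digraph "dg G" + bidirected_digraph "dg G" "flip G"
  for G :: "('v, 'a) ugraph" +
  assumes head_extensional: "tgt G \<in> extensional (A G)"
    and tail_extensional: "src G \<in> extensional (A G)"

lemma is_graph_iff: "is_graph G \<longleftrightarrow> undirected_graph G"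
  by (simp add: is_graph_def undirected_graph_def undirected_graph_axioms_def)

lemma elts_simps [simp]:
  "Vert v \<in> elts G \<longleftrightarrow> v \<in> V G" "Arrow a \<in> elts G \<longleftrightarrow> a \<in> A G" "Star \<in> elts G"
  by (auto simp: elts_def)

lemma finite_elts: "is_graph G \<Longrightarrow> finite (elts G)"
  by (simp add: elts_def is_graph_def fin_digraph_def fin_digraph_axioms_def)

text \<open>
  Connectedness is used in the form that a nonempty set of vertices that no arrow leaves contains all
  vertices. In this form it passes easily through fibres and quotients.
\<close>

definition arc_closed :: "('v, 'a) ugraph \<Rightarrow> 'v set \<Rightarrow> bool" where
  "arc_closed G S \<longleftrightarrow> (\<forall>a\<in>A G. src G a \<in> S \<longrightarrow> tgt G a \<in> S)"

lemma (in undirected_graph) symmetric_dg: "symmetric (dg G)"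
  unfolding symmetric_conv
proof
  fix e assume "e \<in> A G"
  then show "\<exists>e'\<in>A G. src G e = tgt G e' \<and> tgt G e = src G e'"
    by (intro bexI[of _ "flip G e"]) simp_all
qed

lemma connected_iff_arc_closed:
  assumes "is_graph G"
  shows "connected (dg G) \<longleftrightarrow>
    V G \<noteq> {} \<and> (\<forall>S\<subseteq>V G. S \<noteq> {} \<and> arc_closed G S \<longrightarrow> S = V G)"
proof -
  interpret undirected_graph G using assms by (simp add: is_graph_iff)
  have conn: "connected (dg G) \<longleftrightarrow> V G \<noteq> {} \<and> (\<forall>u\<in>V G. \<forall>v\<in>V G. u \<rightarrow>\<^sup>*\<^bsub>dg G\<^esub> v)"
    unfolding connected_def strongly_connected_def
    using reachable_mk_symmetric_eq[OF symmetric_dg] by simp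
  have stays: "v \<in> S" if S: "arc_closed G S" "u \<in> S" and r: "u \<rightarrow>\<^sup>*\<^bsub>dg G\<^esub> v" for S u v
    using r
  proof (induction rule: reachable_induct)
    case (step x y)
    then obtain a where "a \<in> A G" "src G a = x" "tgt G a = y"
      by (auto simp: arcs_ends_conv)
    with step S show ?case by (auto simp: arc_closed_def)
  qed (use S in simp)
  have closed: "arc_closed G {v. u \<rightarrow>\<^sup>*\<^bsub>dg G\<^esub> v}" for u
    unfolding arc_closed_def
  proof (intro ballI impI CollectI)
    fix a assume "a \<in> A G" "src G a \<in> {v. u \<rightarrow>\<^sup>*\<^bsub>dg G\<^esub> v}"
    moreover from \<open>a \<in> A G\<close> have "src G a \<rightarrow>\<^bsub>dg G\<^esub> tgt G a" by (auto simp: arcs_ends_conv)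
    ultimately show "u \<rightarrow>\<^sup>*\<^bsub>dg G\<^esub> tgt G a" using reachable_adj_trans by blast
  qed
  have sub: "{v. u \<rightarrow>\<^sup>*\<^bsub>dg G\<^esub> v} \<subseteq> V G" for u using reachable_in_verts(2) by blast
  have "(\<forall>u\<in>V G. \<forall>v\<in>V G. u \<rightarrow>\<^sup>*\<^bsub>dg G\<^esub> v) \<longleftrightarrow>
      (\<forall>S\<subseteq>V G. S \<noteq> {} \<and> arc_closed G S \<longrightarrow> S = V G)" (is "?L \<longleftrightarrow> ?R")
  proof (intro iffI ballI allI impI)
    fix S assume L: ?L and S: "S \<subseteq> V G" "S \<noteq> {} \<and> arc_closed G S"
    then obtain u where "u \<in> S" by blast
    then have "v \<in> S" if "v \<in> V G" for v
      using L S that stays[of S u v] by blast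
    with S(1) show "S = V G" by blast
  next
    fix u v assume R: ?R and uv: "u \<in> V G" "v \<in> V G"
    let ?S = "{v. u \<rightarrow>\<^sup>*\<^bsub>dg G\<^esub> v}"
    have "u \<in> ?S" using uv(1) by simp
    then have "?S \<noteq> {}" by blast
    with closed[of u] sub[of u] R have "?S = V G" by blast
    with uv(2) show "u \<rightarrow>\<^sup>*\<^bsub>dg G\<^esub> v" by blast
  qed
  then show ?thesis unfolding conn by blast
qed

text \<open>
  A closed walk that is not a cycle contains a shorter closed walk; so a shortest nonempty closed
  walk that never uses both orientations of an edge is a cycle.
\<close>

lemma utree_no_closed_trail:
  assumes T: "utree T"
  shows "pre_digraph.awalk (dg T) u p u \<Longrightarrow> \<forall>a\<in>set p. flip T a \<notin> set p \<Longrightarrow> p = []"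
proof (induction p arbitrary: u rule: length_induct)
  case (1 p)
  interpret undirected_graph T using T by (simp add: is_graph_iff utree_def)
  show ?case
  proof (rule ccontr)
    assume ne: "p \<noteq> []"
    have "\<not> cycle p" using T 1(3) by (auto simp: utree_def ucycle_def)
    then have nd: "\<not> distinct (tl (awalk_verts u p))"
      using 1(2) ne by (auto simp: cycle_def)
    obtain e es where p: "p = e # es" using ne by (cases p) auto
    have es: "awalk (head (dg T) e) es u" "\<not> distinct (awalk_verts (head (dg T) e) es)"
      using 1(2) nd by (auto simp: p awalk_Cons_iff)
    from awalk_not_distinct_decomp[OF this]
    obtain q r s w where r: "es = q @ r @ s" "0 < length r" "awalk w r w" by blast
    have "length r < length p" "\<forall>a\<in>set r. flip T a \<notin> set r"
      using r(1) 1(3) by (auto simp: p)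
    with 1(1) r(3) have "r = []" by blast
    with r(2) show False by simp
  qed
qed

lemma fiber_simps [simp]:
  "V (fiber G \<phi> w) = {v \<in> V G. \<phi> (Vert v) = Vert w}"
  "A (fiber G \<phi> w) = {a \<in> A G. \<phi> (Arrow a) = Vert w}"
  "a \<in> A G \<Longrightarrow> \<phi> (Arrow a) = Vert w \<Longrightarrow> src (fiber G \<phi> w) a = src G a"
  "a \<in> A G \<Longrightarrow> \<phi> (Arrow a) = Vert w \<Longrightarrow> tgt (fiber G \<phi> w) a = tgt G a"
  "a \<in> A G \<Longrightarrow> \<phi> (Arrow a) = Vert w \<Longrightarrow> flip (fiber G \<phi> w) a = flip G a"
  by (simp_all add: fiber_def Let_def perm_restrict_def)

lemma is_graph_fiber:
  assumes G: "is_graph G"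
    and flip: "\<And>a. a \<in> A G \<Longrightarrow> \<phi> (Arrow a) = Vert w \<Longrightarrow> \<phi> (Arrow (flip G a)) = Vert w"
    and tgt: "\<And>a. a \<in> A G \<Longrightarrow> \<phi> (Arrow a) = Vert w \<Longrightarrow> \<phi> (Vert (tgt G a)) = Vert w"
  shows "is_graph (fiber G \<phi> w)"
proof -
  interpret undirected_graph G using G by (simp add: is_graph_iff)
  let ?T = "fiber G \<phi> w"
  have src: "\<phi> (Vert (src G a)) = Vert w" if "a \<in> A G" "\<phi> (Arrow a) = Vert w" for a
    using tgt[of "flip G a"] flip[OF that] that(1) by simp
  interpret T: wf_digraph "dg ?T"
    by unfold_locales (auto simp: src tgt)
  have nf: "flip ?T a = a" if "a \<notin> A ?T" for a
    using that by (auto simp: fiber_def Let_def perm_restrict_def)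
  show ?thesis
    unfolding is_graph_def
  proof (intro conjI)
    show "fin_digraph (dg ?T)" by unfold_locales auto
    show "bidirected_digraph (dg ?T) (flip ?T)"
    proof (rule T.bidirected_digraphI)
      fix a assume a: "a \<in> A ?T"
      then show "flip ?T a \<noteq> a" using arev_neq by auto
      from a have fa: "flip G a \<in> A G" "\<phi> (Arrow (flip G a)) = Vert w" using flip by auto
      with a show "flip ?T (flip ?T a) = a" "src ?T (flip ?T a) = tgt ?T a" by simp_all
    qed (rule nf)
  qed (auto simp: fiber_def Let_def)
qed

lemma minor_morphismD:
  assumes "minor_morphism G G' \<phi>"
  shows "\<phi> \<in> elts G \<rightarrow>\<^sub>E elts G'"
    and "\<phi> Star = Star"
    and "\<And>v. v \<in> V G \<Longrightarrow> \<exists>w\<in>V G'. \<phi> (Vert v) = Vert w"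
    and "\<And>a. a \<in> A G \<Longrightarrow> \<phi> (Arrow (flip G a)) = map_elt id (flip G') (\<phi> (Arrow a))"
    and "\<And>a'. a' \<in> A G' \<Longrightarrow> \<exists>!a. a \<in> A G \<and> \<phi> (Arrow a) = Arrow a'"
    and "\<And>a a'. a \<in> A G \<Longrightarrow> \<phi> (Arrow a) = Arrow a' \<Longrightarrow>
        \<phi> (Vert (tgt G a)) = Vert (tgt G' a') \<and> \<phi> (Vert (src G a)) = Vert (src G' a')"
    and "\<And>a w. a \<in> A G \<Longrightarrow> \<phi> (Arrow a) = Vert w \<Longrightarrow>
        \<phi> (Vert (tgt G a)) = Vert w \<and> \<phi> (Vert (src G a)) = Vert w"
    and "\<And>w. w \<in> V G' \<Longrightarrow> utree (fiber G \<phi> w)"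
  using assms unfolding minor_morphism_def by blast+

lemma minor_morphism_arrow_in:
  assumes "minor_morphism G G' \<phi>" "a \<in> A G"
  shows "\<phi> (Arrow a) = Arrow a' \<Longrightarrow> a' \<in> A G'" "\<phi> (Arrow a) = Vert w \<Longrightarrow> w \<in> V G'"
proof -
  have "\<phi> (Arrow a) \<in> elts G'"
    using PiE_mem[OF minor_morphismD(1)[OF assms(1)]] assms(2) by simp
  then show "\<phi> (Arrow a) = Arrow a' \<Longrightarrow> a' \<in> A G'" "\<phi> (Arrow a) = Vert w \<Longrightarrow> w \<in> V G'"
    by simp_all
qed

text \<open>
  Being a tree passes to preimages under a minor morphism: connectedness because the fibres are
  connected and every arrow of the target lifts, and acyclicity because a closed trail upstairs
  either stays in one fibre, or becomes a nonempty closed trail downstairs when its contracted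
  arrows are dropped.
\<close>

lemma minor_morphism_compose:
  assumes G: "is_graph G" "is_graph G'" "is_graph G''"
    and \<phi>: "minor_morphism G G' \<phi>" and \<psi>: "minor_morphism G' G'' \<psi>"
  shows "minor_morphism G G'' (compose (elts G) \<psi> \<phi>)"
proof -
  interpret G: undirected_graph G using G by (simp add: is_graph_iff)
  interpret G': undirected_graph G' using G by (simp add: is_graph_iff)
  let ?\<theta> = "compose (elts G) \<psi> \<phi>"
  note p = minor_morphismD[OF \<phi>] and q = minor_morphismD[OF \<psi>]
  note pin = minor_morphism_arrow_in[OF \<phi>]
  have th [simp]: "?\<theta> (Vert v) = \<psi> (\<phi> (Vert v))" if "v \<in> V G" for v
    using that by (simp add: compose_def)
  have tha [simp]: "?\<theta> (Arrow a) = \<psi> (\<phi> (Arrow a))" if "a \<in> A G" for a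
    using that by (simp add: compose_def)
  have \<psi>_flip: "\<psi> (map_elt id (flip G') e) = map_elt id (flip G'') (\<psi> e)" if "e \<in> elts G'" for e
  proof (cases e)
    case (Vert w)
    with that obtain u where "\<psi> e = Vert u" using q(3) by auto
    with Vert show ?thesis by simp
  next
    case (Arrow a)
    with that q(4) show ?thesis by simp
  qed (simp add: q(2))
  have \<phi>_in: "\<phi> e \<in> elts G'" if "e \<in> elts G" for e using PiE_mem[OF p(1) that] .
  have \<psi>_Arrow: "\<exists>b. e = Arrow b \<and> b \<in> A G'" if "\<psi> e = Arrow a" "e \<in> elts G'" for e a
    using that q(2,3) by (cases e) fastforce+
  have flip: "?\<theta> (Arrow (flip G a)) = map_elt id (flip G'') (?\<theta> (Arrow a))" if "a \<in> A G" for a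
    using that p(4)[OF that] \<psi>_flip[OF \<phi>_in[of "Arrow a"]] by simp
  have contracted: "?\<theta> (Vert (tgt G a)) = Vert w \<and> ?\<theta> (Vert (src G a)) = Vert w"
    if a: "a \<in> A G" "?\<theta> (Arrow a) = Vert w" for a w
  proof (cases "\<phi> (Arrow a)")
    case (Vert u)
    with p(7)[OF a(1) Vert] a show ?thesis by simp
  next
    case (Arrow b)
    with p(6)[OF a(1) Arrow] a q(7)[of b w] pin(1)[OF a(1)] show ?thesis by simp
  next
    case Star
    with a q(2) show ?thesis by simp
  qed
  have tree: "utree (fiber G ?\<theta> w)" (is "utree ?K") if w: "w \<in> V G''" for w
  proof -
    let ?T = "fiber G' \<psi> w"
    note T = q(8)[OF w]
    interpret T: undirected_graph ?T using T by (simp add: utree_def is_graph_iff)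
    have K: "is_graph ?K"
      by (rule is_graph_fiber[OF G(1)]) (simp_all del: th tha add: flip contracted)
    interpret K: undirected_graph ?K using K by (simp add: is_graph_iff)
    have Kv: "v \<in> V ?K \<longleftrightarrow> v \<in> V G \<and> (\<exists>u\<in>V ?T. \<phi> (Vert v) = Vert u)" for v
      using p(3) by fastforce
    have KaV: "a \<in> A ?K" if "a \<in> A G" "\<phi> (Arrow a) = Vert u" "u \<in> V ?T" for a u
      using that by simp
    have KaA: "a \<in> A ?K" if "a \<in> A G" "\<phi> (Arrow a) = Arrow b" "b \<in> A ?T" for a b
      using that by simp
    have Ka: "(\<exists>u\<in>V ?T. \<phi> (Arrow a) = Vert u) \<or> (\<exists>b\<in>A ?T. \<phi> (Arrow a) = Arrow b)"
      if "a \<in> A ?K" for a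
      using that pin[of a] q(2) by (cases "\<phi> (Arrow a)") auto
    have ends: "src ?K a = src G a" "tgt ?K a = tgt G a" "flip ?K a = flip G a" if "a \<in> A ?K" for a
      using that by simp_all
    have vin: "u \<in> V G'" if "u \<in> V ?T" for u using that by simp
    have conn: "connected (dg ?K)"
      unfolding connected_iff_arc_closed[OF K]
    proof (intro conjI allI impI)
      have cT: "V ?T \<noteq> {}" "\<And>S. S \<subseteq> V ?T \<Longrightarrow> S \<noteq> {} \<Longrightarrow> arc_closed ?T S \<Longrightarrow> S = V ?T"
        using T connected_iff_arc_closed[of ?T] unfolding utree_def by blast+
      have cF: "V (fiber G \<phi> u) \<noteq> {}" 
        "\<And>S. S \<subseteq> V (fiber G \<phi> u) \<Longrightarrow> S \<noteq> {} \<Longrightarrow> arc_closed (fiber G \<phi> u) S \<Longrightarrow> S = V (fiber G \<phi> u)"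
        if "u \<in> V G'" for u
        using p(8)[OF that] connected_iff_arc_closed[of "fiber G \<phi> u"] unfolding utree_def by blast+
      obtain u where u: "u \<in> V ?T" using cT(1) by blast
      obtain v where "v \<in> V (fiber G \<phi> u)" using cF(1)[OF vin[OF u]] by blast
      then have "v \<in> V ?K" using u Kv by auto
      then show "V ?K \<noteq> {}" by blast
      fix S assume S: "S \<subseteq> V ?K" "S \<noteq> {} \<and> arc_closed ?K S"
      have whole: "V (fiber G \<phi> u) \<subseteq> S" if u: "u \<in> V ?T" and v: "v \<in> S" "\<phi> (Vert v) = Vert u" for u v
      proof -
        have "arc_closed (fiber G \<phi> u) (S \<inter> V (fiber G \<phi> u))"
          unfolding arc_closed_def
        proof (intro ballI impI)
          fix a assume a: "a \<in> A (fiber G \<phi> u)" "src (fiber G \<phi> u) a \<in> S \<inter> V (fiber G \<phi> u)"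
          then have aK: "a \<in> A ?K" using KaV u by simp
          have "src ?K a \<in> S" using a aK ends[OF aK] by simp
          then have "tgt ?K a \<in> S" using S(2) aK unfolding arc_closed_def by blast
          then have "tgt G a \<in> S" using ends[OF aK] by simp
          with a(1) p(7)[of a u] show "tgt (fiber G \<phi> u) a \<in> S \<inter> V (fiber G \<phi> u)" by simp
        qed
        moreover have "v \<in> S \<inter> V (fiber G \<phi> u)" using v S(1) by auto
        ultimately have "S \<inter> V (fiber G \<phi> u) = V (fiber G \<phi> u)"
          using cF(2)[OF vin[OF u], of "S \<inter> V (fiber G \<phi> u)"] by blast
        then show ?thesis by blast
      qed
      define S' where "S' = {u \<in> V ?T. \<exists>v\<in>S. \<phi> (Vert v) = Vert u}"
      have "S' = V ?T"
      proof (rule cT(2))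
        show "S' \<subseteq> V ?T" by (auto simp: S'_def)
        obtain v where "v \<in> S" using S(2) by blast
        with S(1) Kv[of v] show "S' \<noteq> {}" by (auto simp: S'_def)
        show "arc_closed ?T S'"
          unfolding arc_closed_def
        proof (intro ballI impI)
          fix b assume b: "b \<in> A ?T" "src ?T b \<in> S'"
          then obtain v where v: "v \<in> S" "\<phi> (Vert v) = Vert (src ?T b)" by (auto simp: S'_def)
          obtain a where a: "a \<in> A G" "\<phi> (Arrow a) = Arrow b" using b(1) p(5)[of b] by auto
          have bb: "src ?T b = src G' b" "tgt ?T b = tgt G' b" using b(1) by simp_all
          have "src G a \<in> S"
            using whole[OF _ v] b p(6)[OF a] a bb by (auto simp: S'_def)
          moreover have aK: "a \<in> A ?K" using KaA a b(1) by blast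
          ultimately have "tgt G a \<in> S" using S ends[OF aK] by (auto simp: arc_closed_def)
          with p(6)[OF a] show "tgt ?T b \<in> S'"
            unfolding S'_def using bb(2) T.head_in_verts[OF b(1)] by auto
        qed
      qed
      then have "v \<in> S" if "v \<in> V ?K" for v
        using that Kv[of v] whole by (fastforce simp: S'_def)
      with S(1) show "S = V ?K" by blast
    qed
    have "\<not> ucycle ?K c" for c
    proof
      assume c: "ucycle ?K c"
      then obtain v where walk: "K.awalk v c v" and ne: "c \<noteq> []"
        and nf: "\<forall>a\<in>set c. flip ?K a \<notin> set c"
        by (auto simp: ucycle_def pre_digraph.cycle_def)
      define proj where "proj p = map (\<lambda>a. case \<phi> (Arrow a) of Arrow b \<Rightarrow> b)
         (filter (\<lambda>a. \<exists>b. \<phi> (Arrow a) = Arrow b) p)" for p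
      have down: "T.awalk u (proj p) u'"
        if "K.awalk x p y" "\<phi> (Vert x) = Vert u" "\<phi> (Vert y) = Vert u'" for x p y u u'
        using that
      proof (induction p arbitrary: x u)
        case Nil
        then have "x \<in> V ?K" "x = y" by (auto simp: K.awalk_Nil_iff)
        with Nil Kv[of x] show ?case by (simp add: T.awalk_Nil_iff proj_def)
      next
        case (Cons a p)
        then have a: "a \<in> A ?K" "x = src ?K a" "K.awalk (tgt ?K a) p y"
          by (auto simp: K.awalk_Cons_iff)
        then have aG: "a \<in> A G" by simp
        from Ka[OF a(1)] show ?case
        proof (elim disjE bexE)
          fix w' assume w': "\<phi> (Arrow a) = Vert w'"
          then have "proj (a # p) = proj p" by (simp add: proj_def)
          moreover have "\<phi> (Vert (tgt ?K a)) = Vert u"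
            using p(7)[OF aG w'] Cons.prems(2) a(2) ends[OF a(1)] by simp
          ultimately show ?case using Cons.IH[OF a(3)] Cons.prems(3) by simp
        next
          fix b assume b: "b \<in> A ?T" "\<phi> (Arrow a) = Arrow b"
          then have "proj (a # p) = b # proj p" by (simp add: proj_def)
          moreover have "\<phi> (Vert (tgt ?K a)) = Vert (tgt ?T b)" "u = src ?T b"
            using p(6)[OF aG b(2)] Cons.prems(2) a(2) ends[OF a(1)] b(1) by simp_all
          ultimately show ?case using Cons.IH[OF a(3)] Cons.prems(3) b(1)
            by (simp add: T.awalk_Cons_iff)
        qed
      qed
      have vK: "v \<in> V ?K" using walk by (simp add: K.awalk_def)
      then obtain u where u: "u \<in> V ?T" "\<phi> (Vert v) = Vert u" using Kv by blast
      have "T.awalk u (proj c) u" by (rule down[OF walk u(2) u(2)])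
      moreover have "\<forall>b\<in>set (proj c). flip ?T b \<notin> set (proj c)"
      proof (intro ballI notI)
        fix b assume "b \<in> set (proj c)" "flip ?T b \<in> set (proj c)"
        then obtain a a' where a: "a \<in> set c" "\<phi> (Arrow a) = Arrow b"
          and a': "a' \<in> set c" "\<phi> (Arrow a') = Arrow (flip ?T b)"
          by (auto simp: proj_def split: elt.splits)
        have cK: "set c \<subseteq> A ?K" using walk by (simp add: K.awalk_def)
        with a a' have aK: "a \<in> A ?K" "a' \<in> A ?K" by auto
        then have aG: "a \<in> A G" "a' \<in> A G" by simp_all
        have bT: "b \<in> A ?T" using Ka[OF aK(1)] a(2) by auto
        then have fb: "flip ?T b = flip G' b" by simp
        have "\<phi> (Arrow (flip G a)) = Arrow (flip G' b)" using p(4)[OF aG(1)] a(2) by simp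
        then have "a' = flip G a"
          using p(5)[of "flip G' b"] a'(2) aG bT fb G.arev_in_arcs[OF aG(1)] G'.arev_in_arcs[of b]
          by auto
        with nf a(1) a'(1) ends(3)[OF aK(1)] show False by auto
      qed
      ultimately have "proj c = []" by (rule utree_no_closed_trail[OF T])
      then have vert: "\<nexists>b. \<phi> (Arrow a) = Arrow b" if "a \<in> set c" for a
        using that by (auto simp: proj_def filter_empty_conv)
      let ?F = "fiber G \<phi> u"
      interpret F: undirected_graph ?F
        using p(8)[OF vin[OF u(1)]] by (simp add: utree_def is_graph_iff)
      have "F.awalk x p y"
        if "K.awalk x p y" "\<forall>a\<in>set p. \<nexists>b. \<phi> (Arrow a) = Arrow b" "\<phi> (Vert x) = Vert u" for x p y
        using that
      proof (induction p arbitrary: x)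
        case Nil
        then have "x \<in> V ?K" "x = y" by (auto simp: K.awalk_Nil_iff)
        with Nil show ?case by (simp add: F.awalk_Nil_iff)
      next
        case (Cons a p)
        then have a: "a \<in> A ?K" "x = src ?K a" "K.awalk (tgt ?K a) p y"
          by (auto simp: K.awalk_Cons_iff)
        then have aG: "a \<in> A G" by simp
        obtain w' where w': "\<phi> (Arrow a) = Vert w'" using Ka[OF a(1)] Cons.prems(2) by auto
        then have "w' = u" using p(7)[OF aG w'] Cons.prems(3) a(2) ends[OF a(1)] by simp
        then have aF: "a \<in> A ?F" "src ?F a = src ?K a" "tgt ?F a = tgt ?K a" using aG w' ends[OF a(1)] by simp_all
        moreover have "F.awalk (tgt ?K a) p y"
          using Cons.IH[OF a(3)] Cons.prems(2) p(7)[OF aG w'] \<open>w' = u\<close> ends[OF a(1)] by simp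
        ultimately show ?case using a(2) by (simp add: F.awalk_Cons_iff)
      qed
      then have walkF: "F.awalk v c v" using walk vert u(2) by blast
      moreover have "\<forall>a\<in>set c. flip ?F a \<notin> set c"
      proof
        fix a assume a: "a \<in> set c"
        then have "a \<in> A ?F" "a \<in> A ?K" using walkF walk by (auto simp: F.awalk_def K.awalk_def)
        then have "flip ?F a = flip ?K a" by simp
        with nf a show "flip ?F a \<notin> set c" by simp
      qed
      ultimately have "c = []" by (rule utree_no_closed_trail[OF p(8)[OF vin[OF u(1)]]])
      with ne show False by simp
    qed
    with K conn show ?thesis by (simp add: utree_def)
  qed
  show ?thesis
    unfolding minor_morphism_def
  proof (intro conjI ballI allI impI)
    have "\<psi> (\<phi> e) \<in> elts G''" if "e \<in> elts G" for e
      using PiE_mem[OF q(1) \<phi>_in[OF that]] .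
    then show "?\<theta> \<in> elts G \<rightarrow>\<^sub>E elts G''" by (auto simp: compose_def)
    show "?\<theta> Star = Star" using p(2) q(2) by (simp add: compose_def)
    show "?\<theta> (Vert v) \<in> Vert ` V G''" if "v \<in> V G" for v
      using p(3)[OF that] q(3) that by fastforce
    show "?\<theta> (Arrow (flip G a)) = map_elt id (flip G'') (?\<theta> (Arrow a))" if "a \<in> A G" for a
      by (rule flip[OF that])
    show "\<exists>!a. a \<in> A G \<and> ?\<theta> (Arrow a) = Arrow a''" if a'': "a'' \<in> A G''" for a''
    proof -
      obtain b where b: "b \<in> A G'" "\<psi> (Arrow b) = Arrow a''"
        "\<And>b'. b' \<in> A G' \<Longrightarrow> \<psi> (Arrow b') = Arrow a'' \<Longrightarrow> b' = b"
        using q(5)[OF a''] by blast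
      obtain a where a: "a \<in> A G" "\<phi> (Arrow a) = Arrow b"
        "\<And>a'. a' \<in> A G \<Longrightarrow> \<phi> (Arrow a') = Arrow b \<Longrightarrow> a' = a"
        using p(5)[OF b(1)] by blast
      show ?thesis
      proof (rule ex1I[of _ a])
        show "a \<in> A G \<and> ?\<theta> (Arrow a) = Arrow a''" using a(1,2) b(1,2) by simp
        fix x assume x: "x \<in> A G \<and> ?\<theta> (Arrow x) = Arrow a''"
        then have "\<psi> (\<phi> (Arrow x)) = Arrow a''" "\<phi> (Arrow x) \<in> elts G'"
          using \<phi>_in[of "Arrow x"] tha[of x] by auto
        from \<psi>_Arrow[OF this]
        obtain b' where b': "\<phi> (Arrow x) = Arrow b'" "b' \<in> A G'" by blast
        then have "b' = b" using b(3)[of b'] x tha[of x] by auto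
        with x a(3)[of x] b'(1) show "x = a" by simp
      qed
    qed
    fix a assume a: "a \<in> A G"
    show "?\<theta> (Vert (tgt G a)) = Vert (tgt G'' a'')" "?\<theta> (Vert (src G a)) = Vert (src G'' a'')"
      if e: "?\<theta> (Arrow a) = Arrow a''" for a''
    proof -
      have "\<psi> (\<phi> (Arrow a)) = Arrow a''" "\<phi> (Arrow a) \<in> elts G'"
        using \<phi>_in[of "Arrow a"] a e by simp_all
      from \<psi>_Arrow[OF this]
      obtain b where "\<phi> (Arrow a) = Arrow b" "b \<in> A G'" by blast
      then have b: "\<phi> (Arrow a) = Arrow b" "b \<in> A G'" "\<psi> (Arrow b) = Arrow a''"
        using e a by simp_all
      with p(6)[OF a b(1)] q(6)[OF b(2,3)] a
      show "?\<theta> (Vert (tgt G a)) = Vert (tgt G'' a'')" "?\<theta> (Vert (src G a)) = Vert (src G'' a'')"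
        by simp_all
    qed
    show "?\<theta> (Vert (tgt G a)) = Vert w" "?\<theta> (Vert (src G a)) = Vert w"
      if "?\<theta> (Arrow a) = Vert w" for w
      using contracted[OF a that] by blast+
  qed (rule tree)
qed


section \<open>Contractions from embeddings of plane forests\<close>

text \<open>
  The pairs of a vertex and its parent, for a forest whose roots are attached to an extra vertex \<open>p\<close>.
\<close>

fun parents :: "'v \<Rightarrow> 'v plane_forest \<Rightarrow> ('v \<times> 'v) set" where
  "parents p Empty = {}"
| "parents p (Branch v c s) = insert (v, p) (parents v c \<union> parents p s)"

fun distinct_nodes :: "'v plane_forest \<Rightarrow> bool" where
  "distinct_nodes Empty \<longleftrightarrow> True"
| "distinct_nodes (Branch v c s) \<longleftrightarrow> v \<notin> nodes c \<union> nodes s \<and> nodes c \<inter> nodes s = {} \<and>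
     distinct_nodes c \<and> distinct_nodes s"

text \<open>
  The strict preorder traversal: a node comes before its descendants, which come before its later
  siblings.
\<close>

fun before :: "'v plane_forest \<Rightarrow> ('v \<times> 'v) set" where
  "before Empty = {}"
| "before (Branch v c s) =
     {v} \<times> (nodes c \<union> nodes s) \<union> nodes c \<times> nodes s \<union> before c \<union> before s"

abbreviation rooted :: "'v \<Rightarrow> 'v plane_forest \<Rightarrow> 'v plane_forest" where
  "rooted r t \<equiv> Branch r t Empty"

lemma finite_nodes: "finite (nodes t)"
  by (induction t) auto

lemma parents_nodes: "(v, p) \<in> parents q t \<Longrightarrow> v \<in> nodes t \<and> p \<in> insert q (nodes t)"
  by (induction t arbitrary: q) auto

lemma before_nodes: "(u, v) \<in> before t \<Longrightarrow> u \<in> nodes t \<and> v \<in> nodes t"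
  by (induction t) auto

lemma parents_exists: "v \<in> nodes t \<Longrightarrow> \<exists>p. (v, p) \<in> parents q t"
  by (induction t arbitrary: q) auto

lemma parent_before:
  "distinct_nodes (rooted q t) \<Longrightarrow> (v, p) \<in> parents q t \<Longrightarrow> (p, v) \<in> before (rooted q t)"
proof (induction t arbitrary: q)
  case (Branch x c s)
  from Branch.IH(1)[of x] Branch.IH(2)[of q] Branch.prems show ?case by auto
qed simp

lemma before_irrefl: "distinct_nodes t \<Longrightarrow> (v, v) \<notin> before t"
  by (induction t) (auto dest: before_nodes)

lemma before_trans:
  "distinct_nodes t \<Longrightarrow> (u, v) \<in> before t \<Longrightarrow> (v, w) \<in> before t \<Longrightarrow> (u, w) \<in> before t"
proof (induction t)
  case (Branch x c s)
  then show ?case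
    using before_nodes[of u v c] before_nodes[of u v s] before_nodes[of v w c] before_nodes[of v w s]
    by auto
qed simp

lemma before_total:
  "u \<in> nodes t \<Longrightarrow> v \<in> nodes t \<Longrightarrow> u \<noteq> v \<Longrightarrow> (u, v) \<in> before t \<or> (v, u) \<in> before t"
  by (induction t) auto

definition rank :: "'v plane_forest \<Rightarrow> 'v \<Rightarrow> nat" where
  "rank t v = card {u. (u, v) \<in> before t}"

text \<open>
  The predecessors of \<open>u\<close> are among those of \<open>v\<close>, and \<open>u\<close> itself is a further one.
\<close>

lemma rank_less:
  assumes t: "distinct_nodes t" and uv: "(u, v) \<in> before t"
  shows "rank t u < rank t v"
  unfolding rank_def
proof (rule psubset_card_mono)
  show "finite {w. (w, v) \<in> before t}"
    by (rule finite_subset[OF _ finite_nodes[of t]]) (auto dest: before_nodes)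
  have "{w. (w, u) \<in> before t} \<subseteq> {w. (w, v) \<in> before t}"
    using before_trans[OF t _ uv] by blast
  moreover have "u \<notin> {w. (w, u) \<in> before t}" "u \<in> {w. (w, v) \<in> before t}"
    using before_irrefl[OF t] uv by simp_all
  ultimately show "{w. (w, u) \<in> before t} \<subset> {w. (w, v) \<in> before t}" by blast
qed

lemma rank_less_iff:
  assumes "distinct_nodes t" "u \<in> nodes t" "v \<in> nodes t"
  shows "rank t u < rank t v \<longleftrightarrow> (u, v) \<in> before t"
  using rank_less[OF assms(1)] before_total[OF assms(2,3)] by (metis less_asym less_irrefl)

lemma rank_inj:
  assumes "distinct_nodes t" "u \<in> nodes t" "v \<in> nodes t" "rank t u = rank t v"
  shows "u = v"
  using rank_less[OF assms(1)] before_total[OF assms(2,3)] assms(4) by (metis less_irrefl)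

text \<open>
  A contraction \<open>f\<close> of rooted plane trees together with its section \<open>i\<close>, which picks the vertex of
  each fibre that is closest to the root. The edge from \<open>v'\<close> to its parent is contracted unless \<open>v'\<close>
  is in the image of \<open>i\<close>. The assumptions \<open>before_i\<close> and \<open>top_before\<close> say that \<open>i v\<close> is the first vertex
  of its fibre in preorder, and that these first vertices are in the same order as their images.
\<close>

locale contraction =
  fixes lab :: "'v \<Rightarrow> 'l" and lab' :: "'w \<Rightarrow> 'l"
    and r :: 'v and t :: "'v plane_forest" and r' :: 'w and t' :: "'w plane_forest"
    and f :: "'w \<Rightarrow> 'v" and i :: "'v \<Rightarrow> 'w"
  assumes f_root: "f r' = r"
    and i_root: "i r = r'"
    and f_in: "v' \<in> insert r' (nodes t') \<Longrightarrow> f v' \<in> insert r (nodes t)"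
    and i_in: "v \<in> nodes t \<Longrightarrow> i v \<in> nodes t'"
    and f_i: "v \<in> nodes t \<Longrightarrow> f (i v) = v"
    and lab: "v \<in> nodes t \<Longrightarrow> lab' (i v) = lab v"
    and parent_top: "(v, p) \<in> parents r t \<Longrightarrow> (i v, p') \<in> parents r' t' \<Longrightarrow> f p' = p"
    and parent_contracted: "(v', p') \<in> parents r' t' \<Longrightarrow> v' \<notin> i ` nodes t \<Longrightarrow> f v' = f p'"
    and before_i: "(u, v) \<in> before (rooted r t) \<Longrightarrow> (i u, i v) \<in> before (rooted r' t')"
    and top_before: "v' \<in> insert r' (nodes t') \<Longrightarrow>
       i (f v') = v' \<or> (i (f v'), v') \<in> before (rooted r' t')"

text \<open>
  By induction on the embedding, where in each case the subforests are regarded as hung below the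
  vertex into which their contracted roots merge: the new root \<open>v'\<close> for the children, and the old root
  \<open>r'\<close> for the siblings.
\<close>

lemma contraction_exists:
  assumes "forest_emb (map_plane_forest lab t) (map_plane_forest lab' t')"
    and "distinct_nodes (rooted r t)" "distinct_nodes (rooted r' t')"
  shows "\<exists>f i. contraction lab lab' r t r' t' f i"
  using assms
proof (induction "map_plane_forest lab t" "map_plane_forest lab' t'"
    arbitrary: t t' r r' rule: forest_emb.induct)
  case Empty
  then have t: "t = Empty" by (cases t) auto
  have "contraction lab lab' r t r' t' (\<lambda>_. r) (\<lambda>_. r')"
    by unfold_locales (auto simp: t)
  then show ?case by blast
next
  case (children c x s)
  then obtain v' c' s' where t': "t' = Branch v' c' s'" "c = map_plane_forest lab' c'"
    by (cases t') auto
  have d: "distinct_nodes (rooted r t)" "distinct_nodes (rooted v' c')"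
    using children.prems by (auto simp: t')
  obtain f0 i0 where "contraction lab lab' r t v' c' f0 i0"
    using children.hyps(2)[OF refl t'(2) d] by blast
  then interpret C: contraction lab lab' r t v' c' f0 i0 .
  define f where "f x = (if x \<in> insert v' (nodes c') then f0 x else r)" for x
  define i where "i = i0(r := r')"
  have r: "r \<notin> nodes t" and r': "r' \<noteq> v'" "r' \<notin> nodes c'" "r' \<notin> nodes s'"
    and v': "v' \<notin> nodes c'" "v' \<notin> nodes s'" "nodes c' \<inter> nodes s' = {}"
    using children.prems by (auto simp: t')
  have f [simp]: "f r' = r" "f v' = r" "\<And>x. x \<in> nodes c' \<Longrightarrow> f x = f0 x"
    "\<And>x. x \<in> nodes s' \<Longrightarrow> f x = r"
    using r' v' C.f_root by (auto simp: f_def)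
  have i [simp]: "i r = r'" "\<And>x. x \<in> nodes t \<Longrightarrow> i x = i0 x"
    using r by (auto simp: i_def)
  have i_c: "x \<in> nodes t \<Longrightarrow> i0 x \<in> nodes c'" for x by (rule C.i_in)
  have par: "(x, p) \<in> parents v' c'" if "(x, p) \<in> parents r' t'" "x \<in> nodes c'" for x p
    using that v' by (auto simp: t' dest: parents_nodes)
  have "contraction lab lab' r t r' t' f i"
  proof unfold_locales
    show "f x \<in> insert r (nodes t)" if "x \<in> insert r' (nodes t')" for x
      using that C.f_in[of x] by (auto simp: t')
    show "i x \<in> nodes t'" "f (i x) = x" "lab' (i x) = lab x" if "x \<in> nodes t" for x
      using that C.i_in[of x] C.f_i[of x] C.lab[of x] by (auto simp: t')
    show "f p' = p" if "(v, p) \<in> parents r t" "(i v, p') \<in> parents r' t'" for v p p'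
    proof -
      have v: "v \<in> nodes t" using that(1) parents_nodes by fastforce
      then have q: "(i0 v, p') \<in> parents v' c'" using that(2) par i_c by simp
      then have "f p' = f0 p'" using parents_nodes[OF q] C.f_root by auto
      with C.parent_top[OF that(1) q] show ?thesis by simp
    qed
    show "f x = f p" if "(x, p) \<in> parents r' t'" "x \<notin> i ` nodes t" for x p
    proof -
      from that(1) consider "x = v'" "p = r'" | "(x, p) \<in> parents v' c'" | "(x, p) \<in> parents r' s'"
        by (auto simp: t')
      then show ?thesis
      proof cases
        case 2
        have "x \<notin> i0 ` nodes t" using that(2) by auto
        with C.parent_contracted[OF 2] parents_nodes[OF 2] C.f_root show ?thesis by auto
      next
        case 3
        with parents_nodes[OF 3] show ?thesis by auto
      qed simp
    qed
    show "(i u, i v) \<in> before (rooted r' t')" if uv: "(u, v) \<in> before (rooted r t)" for u v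
    proof (cases "u = r")
      case True
      with uv r i_c before_nodes[of u v t] show ?thesis by (auto simp: t')
    next
      case False
      then have "(u, v) \<in> before t" using uv by auto
      then have "u \<in> nodes t" "v \<in> nodes t" using before_nodes by fast+
      with C.before_i[OF uv] v'(1) i_c show ?thesis by (auto simp: t')
    qed
    show "i (f x) = x \<or> (i (f x), x) \<in> before (rooted r' t')" if "x \<in> insert r' (nodes t')" for x
    proof (cases "x \<in> nodes c' \<and> f0 x \<in> nodes t")
      case True
      with C.top_before[of x] v'(1) i_c[of "f0 x"] show ?thesis by (auto simp: t')
    next
      case False
      then have "f x = r" using C.f_in[of x] that by (auto simp: t')
      with that show ?thesis by (auto simp: t')
    qed
  qed simp_all
  then show ?case by blast
next
  case (siblings s x c)
  then obtain v' c' s' where t': "t' = Branch v' c' s'" "s = map_plane_forest lab' s'"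
    by (cases t') auto
  have d: "distinct_nodes (rooted r t)" "distinct_nodes (rooted r' s')"
    using siblings.prems by (auto simp: t')
  obtain f0 i0 where "contraction lab lab' r t r' s' f0 i0"
    using siblings.hyps(2)[OF refl t'(2) d] by blast
  then interpret C: contraction lab lab' r t r' s' f0 i0 .
  define f where "f x = (if x \<in> nodes s' then f0 x else r)" for x
  have r: "r \<notin> nodes t" and r': "r' \<noteq> v'" "r' \<notin> nodes c'" "r' \<notin> nodes s'"
    and v': "v' \<notin> nodes c'" "v' \<notin> nodes s'" "nodes c' \<inter> nodes s' = {}"
    using siblings.prems by (auto simp: t')
  have f [simp]: "f r' = r" "f v' = r" "\<And>x. x \<in> nodes s' \<Longrightarrow> f x = f0 x"
    "\<And>x. x \<in> nodes c' \<Longrightarrow> f x = r"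
    using r' v' by (auto simp: f_def)
  have i_s: "x \<in> nodes t \<Longrightarrow> i0 x \<in> nodes s'" for x by (rule C.i_in)
  have par: "(x, p) \<in> parents r' s'" if "(x, p) \<in> parents r' t'" "x \<in> nodes s'" for x p
    using that v' by (auto simp: t' dest: parents_nodes)
  have "contraction lab lab' r t r' t' f i0"
  proof unfold_locales
    show "i0 r = r'" by (rule C.i_root)
    show "f x \<in> insert r (nodes t)" if "x \<in> insert r' (nodes t')" for x
      using that C.f_in[of x] by (auto simp: t')
    show "i0 x \<in> nodes t'" "f (i0 x) = x" "lab' (i0 x) = lab x" if "x \<in> nodes t" for x
      using that C.i_in[of x] C.f_i[of x] C.lab[of x] by (auto simp: t')
    show "f p' = p" if "(v, p) \<in> parents r t" "(i0 v, p') \<in> parents r' t'" for v p p'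
    proof -
      have v: "v \<in> nodes t" using that(1) parents_nodes by fastforce
      then have q: "(i0 v, p') \<in> parents r' s'" using that(2) par i_s by simp
      then have "f p' = f0 p'" using parents_nodes[OF q] C.f_root by auto
      with C.parent_top[OF that(1) q] show ?thesis by simp
    qed
    show "f x = f p" if "(x, p) \<in> parents r' t'" "x \<notin> i0 ` nodes t" for x p
    proof -
      from that(1) consider "x = v'" "p = r'" | "(x, p) \<in> parents v' c'" | "(x, p) \<in> parents r' s'"
        by (auto simp: t')
      then show ?thesis
      proof cases
        case 2
        with parents_nodes[OF 2] show ?thesis by auto
      next
        case 3
        with C.parent_contracted[OF 3 that(2)] parents_nodes[OF 3] C.f_root show ?thesis by auto
      qed simp
    qed
    show "(i0 u, i0 v) \<in> before (rooted r' t')" if uv: "(u, v) \<in> before (rooted r t)" for u v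
      using C.before_i[OF uv] by (auto simp: t')
    show "i0 (f x) = x \<or> (i0 (f x), x) \<in> before (rooted r' t')" if "x \<in> insert r' (nodes t')" for x
    proof (cases "x \<in> nodes s'")
      case True
      with C.top_before[of x] show ?thesis by (auto simp: t')
    next
      case False
      then have "f x = r" using that by (auto simp: t')
      with that show ?thesis by (auto simp: t' C.i_root)
    qed
  qed simp
  then show ?case by blast
next
  case (Branch c0 c0' s0 s0' x)
  then obtain v c s where t: "t = Branch v c s" "c0 = map_plane_forest lab c"
    "s0 = map_plane_forest lab s" "x = lab v"
    by (cases t) auto
  from Branch obtain v' c' s' where t': "t' = Branch v' c' s'" "c0' = map_plane_forest lab' c'"
    "s0' = map_plane_forest lab' s'" "x = lab' v'"
    by (cases t') auto
  have d: "distinct_nodes (rooted v c)" "distinct_nodes (rooted v' c')"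
    "distinct_nodes (rooted r s)" "distinct_nodes (rooted r' s')"
    using Branch.prems by (auto simp: t t')
  obtain f1 i1 where "contraction lab lab' v c v' c' f1 i1"
    using Branch.hyps(2)[OF t(2) t'(2) d(1,2)] by blast
  then interpret C: contraction lab lab' v c v' c' f1 i1 .
  obtain f2 i2 where "contraction lab lab' r s r' s' f2 i2"
    using Branch.hyps(4)[OF t(3) t'(3) d(3,4)] by blast
  then interpret S: contraction lab lab' r s r' s' f2 i2 .
  have r: "r \<noteq> v" "r \<notin> nodes c" "r \<notin> nodes s"
    and v: "v \<notin> nodes c" "v \<notin> nodes s" "nodes c \<inter> nodes s = {}"
    using Branch.prems by (auto simp: t)
  have r': "r' \<noteq> v'" "r' \<notin> nodes c'" "r' \<notin> nodes s'"
    and v': "v' \<notin> nodes c'" "v' \<notin> nodes s'" "nodes c' \<inter> nodes s' = {}"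
    using Branch.prems by (auto simp: t')
  define f where "f x = (if x \<in> insert v' (nodes c') then f1 x else f2 x)" for x
  define i where "i x = (if x \<in> insert v (nodes c) then i1 x else i2 x)" for x
  have f [simp]: "f v' = v" "f r' = r" "\<And>x. x \<in> nodes c' \<Longrightarrow> f x = f1 x"
    "\<And>x. x \<in> nodes s' \<Longrightarrow> f x = f2 x"
    using r' v' C.f_root S.f_root by (auto simp: f_def)
  have i [simp]: "i v = v'" "i r = r'" "\<And>x. x \<in> nodes c \<Longrightarrow> i x = i1 x"
    "\<And>x. x \<in> nodes s \<Longrightarrow> i x = i2 x"
    using r v C.i_root S.i_root by (auto simp: i_def)
  have ic [simp]: "\<And>x. x \<in> nodes c \<Longrightarrow> i1 x \<in> nodes c'" "\<And>x. x \<in> nodes s \<Longrightarrow> i2 x \<in> nodes s'"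
    by (rule C.i_in S.i_in, assumption)+
  have parc: "(x, p) \<in> parents v' c'" if "(x, p) \<in> parents r' t'" "x \<in> nodes c'" for x p
    using that v' by (auto simp: t' dest: parents_nodes)
  have pars: "(x, p) \<in> parents r' s'" if "(x, p) \<in> parents r' t'" "x \<in> nodes s'" for x p
    using that v' by (auto simp: t' dest: parents_nodes)
  have fc: "f x = f1 x" if "x \<in> insert v' (nodes c')" for x using that C.f_root by auto
  have fs: "f x = f2 x" if "x \<in> insert r' (nodes s')" for x using that S.f_root by auto
  have "contraction lab lab' r t r' t' f i"
  proof unfold_locales
    show "f x \<in> insert r (nodes t)" if "x \<in> insert r' (nodes t')" for x
      using that C.f_in[of x] S.f_in[of x] by (auto simp: t t')
    show "i x \<in> nodes t'" "f (i x) = x" "lab' (i x) = lab x" if "x \<in> nodes t" for x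
      using that t(4) t'(4) C.f_i[of x] S.f_i[of x] C.lab[of x] S.lab[of x] by (auto simp: t(1) t'(1))
    show "f p' = p" if "(x, p) \<in> parents r t" "(i x, p') \<in> parents r' t'" for x p p'
    proof -
      from that(1) consider "x = v" "p = r" | "(x, p) \<in> parents v c" | "(x, p) \<in> parents r s"
        by (auto simp: t)
      then show ?thesis
      proof cases
        case 1
        then have "p' = r'" using that(2) v' by (auto simp: t' dest: parents_nodes)
        with 1 show ?thesis by simp
      next
        case 2
        then have "x \<in> nodes c" using parents_nodes by fastforce
        then have q: "(i1 x, p') \<in> parents v' c'" using that(2) parc by simp
        with C.parent_top[OF 2 q] fc[of p'] parents_nodes[OF q] show ?thesis by simp
      next
        case 3
        then have "x \<in> nodes s" using parents_nodes by fastforce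
        then have q: "(i2 x, p') \<in> parents r' s'" using that(2) pars by simp
        with S.parent_top[OF 3 q] fs[of p'] parents_nodes[OF q] show ?thesis by simp
      qed
    qed
    show "f x = f p" if "(x, p) \<in> parents r' t'" "x \<notin> i ` nodes t" for x p
    proof -
      have "x \<noteq> v'" using that(2) by (auto simp: t)
      with that(1) consider "(x, p) \<in> parents v' c'" | "(x, p) \<in> parents r' s'"
        by (auto simp: t')
      then show ?thesis
      proof cases
        case 1
        have "x \<notin> i1 ` nodes c" using that(2) by (force simp: t)
        with C.parent_contracted[OF 1] parents_nodes[OF 1] fc show ?thesis by auto
      next
        case 2
        have "x \<notin> i2 ` nodes s" using that(2) by (force simp: t)
        with S.parent_contracted[OF 2] parents_nodes[OF 2] fs show ?thesis by auto
      qed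
    qed
    show "(i a, i b) \<in> before (rooted r' t')" if ab: "(a, b) \<in> before (rooted r t)" for a b
    proof -
      from ab consider "a = r" "b \<in> nodes t" | "a = v" "b \<in> nodes c \<union> nodes s"
        | "a \<in> nodes c" "b \<in> nodes s" | "(a, b) \<in> before c" | "(a, b) \<in> before s"
        by (auto simp: t)
      then show ?thesis
      proof cases
        case 4
        then have "a \<in> nodes c" "b \<in> nodes c" using before_nodes by fast+
        moreover have "(i1 a, i1 b) \<in> before (rooted v' c')" using C.before_i[of a b] 4 by simp
        ultimately show ?thesis by (auto simp: t')
      next
        case 5
        then have "a \<in> nodes s" "b \<in> nodes s" using before_nodes by fast+
        moreover have "(i2 a, i2 b) \<in> before (rooted r' s')" using S.before_i[of a b] 5 by simp
        ultimately show ?thesis by (auto simp: t')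
      qed (auto simp: t t')
    qed
    show "i (f x) = x \<or> (i (f x), x) \<in> before (rooted r' t')" if x: "x \<in> insert r' (nodes t')" for x
    proof -
      from x consider "x = r'" | "x = v'" | "x \<in> nodes c'" | "x \<in> nodes s'" by (auto simp: t')
      then show ?thesis
      proof cases
        case 3
        have "i (f1 x) = i1 (f1 x)" unfolding i_def using C.f_in[of x] 3 by auto
        with C.top_before[of x] 3 show ?thesis by (auto simp: t')
      next
        case 4
        have "i (f2 x) = i2 (f2 x)" unfolding i_def using S.f_in[of x] 4 r v by auto
        with S.top_before[of x] 4 show ?thesis by (auto simp: t')
      qed simp_all
    qed
  qed simp_all
  then show ?case by blast
qed


section \<open>Framed graphs\<close>

text \<open>
  A spanning tree and a choice of one arrow from each edge. The tree has the root \<open>base\<close>, below which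
  the forest \<open>branches\<close> hangs. The arrow named \<open>Inl v\<close> leads from \<open>v\<close> to its parent, and the arrows
  named \<open>Inr k\<close> with \<open>k < surplus\<close> orient the edges outside the tree.
\<close>

record ('v, 'a) frame =
  base :: 'v
  branches :: "'v plane_forest"
  arr :: "'v + nat \<Rightarrow> 'a"
  surplus :: nat

definition names :: "('v, 'a) frame \<Rightarrow> ('v + nat) set" where
  "names F = Inl ` nodes (branches F) \<union> Inr ` {..<surplus F}"

locale framed_graph = undirected_graph G for G :: "('v, 'a) ugraph" +
  fixes F :: "('v, 'a) frame"
  assumes distinct: "distinct_nodes (rooted (base F) (branches F))"
    and verts: "V G = insert (base F) (nodes (branches F))"
    and arcs: "A G = arr F ` names F \<union> flip G ` arr F ` names F"
    and arr_inj: "inj_on (arr F) (names F)"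
    and arr_flip: "d \<in> names F \<Longrightarrow> d' \<in> names F \<Longrightarrow> flip G (arr F d) \<noteq> arr F d'"
    and up: "(v, p) \<in> parents (base F) (branches F) \<Longrightarrow>
      src G (arr F (Inl v)) = v \<and> tgt G (arr F (Inl v)) = p"
begin

lemma arr_in [simp]: "d \<in> names F \<Longrightarrow> arr F d \<in> A G"
  using arcs by blast

lemma base_notin: "base F \<notin> nodes (branches F)"
  using distinct by simp

lemma parent_exists:
  assumes "v \<in> nodes (branches F)"
  shows "(v, tgt G (arr F (Inl v))) \<in> parents (base F) (branches F)"
    and "src G (arr F (Inl v)) = v"
proof -
  obtain p where p: "(v, p) \<in> parents (base F) (branches F)"
    using parents_exists[OF assms] by blast
  with up[OF p] show "(v, tgt G (arr F (Inl v))) \<in> parents (base F) (branches F)"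
    "src G (arr F (Inl v)) = v" by simp_all
qed

lemma arc_cases:
  assumes "a \<in> A G"
  obtains d where "d \<in> names F" "a = arr F d" | d where "d \<in> names F" "a = flip G (arr F d)"
  using assms arcs by blast

text \<open>
  Two names never belong to the two orientations of one edge, so names stand for edges.
\<close>

lemma inj_on_edges: "inj_on (\<lambda>d. {arr F d, flip G (arr F d)}) (names F)"
  using arr_inj arr_flip by (auto simp: inj_on_def doubleton_eq_iff)

lemma card_edges: "card (edges G) = card (nodes (branches F)) + surplus F"
proof -
  have "edges G = (\<lambda>d. {arr F d, flip G (arr F d)}) ` names F" (is "_ = ?e ` _")
  proof
    show "edges G \<subseteq> ?e ` names F"
    proof
      fix e assume "e \<in> edges G"
      then obtain a where a: "a \<in> A G" "e = {a, flip G a}" by (auto simp: edges_def)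
      from a(1) show "e \<in> ?e ` names F"
        by (cases rule: arc_cases) (auto simp: a(2))
    qed
  qed (auto simp: edges_def)
  then have "card (edges G) = card (names F)"
    using inj_on_edges by (simp add: card_image)
  also have "\<dots> = card (nodes (branches F)) + surplus F"
    unfolding names_def
    by (subst card_Un_disjoint) (auto simp: finite_nodes card_image)
  finally show ?thesis .
qed

lemma card_verts: "card (V G) = Suc (card (nodes (branches F)))"
  using verts base_notin finite_nodes[of "branches F"] by simp

lemma genus_eq: "genus G = int (surplus F)"
  by (simp add: genus_def card_edges card_verts)

end

lemma insert_leaf:
  assumes "distinct_nodes (rooted r t)" "w \<in> insert r (nodes t)" "u \<notin> insert r (nodes t)"
  shows "\<exists>t'. distinct_nodes (rooted r t') \<and> nodes t' = insert u (nodes t) \<and>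
    parents r t' = insert (u, w) (parents r t)"
  using assms
proof (induction t arbitrary: r)
  case Empty
  then show ?case by (intro exI[of _ "Branch u Empty Empty"]) auto
next
  case (Branch x c s)
  consider "w = r" | "w \<in> insert x (nodes c)" | "w \<in> nodes s" using Branch.prems(2) by auto
  then show ?case
  proof cases
    case 1
    with Branch.prems show ?thesis
      by (intro exI[of _ "Branch u Empty (Branch x c s)"]) auto
  next
    case 2
    obtain c' where "distinct_nodes (rooted x c')" "nodes c' = insert u (nodes c)"
      "parents x c' = insert (u, w) (parents x c)"
      using Branch.IH(1)[of x] Branch.prems 2 by auto
    with Branch.prems show ?thesis by (intro exI[of _ "Branch x c' s"]) auto
  next
    case 3
    obtain s' where "distinct_nodes (rooted r s')" "nodes s' = insert u (nodes s)"
      "parents r s' = insert (u, w) (parents r s)"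
      using Branch.IH(2)[of r] Branch.prems 3 by auto
    with Branch.prems show ?thesis by (intro exI[of _ "Branch x c s'"]) auto
  qed
qed

text \<open>
  As long as the tree does not contain all vertices, connectedness provides an arrow that leaves it;
  the end of this arrow becomes a new leaf.
\<close>

lemma spanning_forest_exists:
  assumes G: "is_graph G" and conn: "connected (dg G)"
  shows "\<exists>r t up. distinct_nodes (rooted r t) \<and> insert r (nodes t) = V G \<and>
    (\<forall>(v, p)\<in>parents r t. up v \<in> A G \<and> src G (up v) = v \<and> tgt G (up v) = p)"
proof -
  interpret undirected_graph G using G by (simp add: is_graph_iff)
  define Q where "Q r t up \<longleftrightarrow> distinct_nodes (rooted r t) \<and> insert r (nodes t) \<subseteq> V G \<and>
    (\<forall>(v, p)\<in>parents r t. up v \<in> A G \<and> src G (up v) = v \<and> tgt G (up v) = p)" for r t up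
  obtain r where r: "r \<in> V G" using conn connected_iff_arc_closed[OF G] by auto
  have grow: "\<exists>t up. Q r t up \<and> card (nodes t) = n" if "n < card (V G)" for n
    using that
  proof (induction n)
    case 0
    have "Q r Empty (\<lambda>_. undefined)" using r by (simp add: Q_def)
    then show ?case by force
  next
    case (Suc n)
    then obtain t up where t: "Q r t up" "card (nodes t) = n" by auto
    let ?S = "insert r (nodes t)"
    have "?S \<subseteq> V G" using t(1) by (simp add: Q_def)
    moreover have "?S \<noteq> V G"
    proof
      assume "?S = V G"
      then have "card (V G) \<le> Suc n"
        using t(2) by (metis card_insert_le_m1 card_insert_if finite_nodes le_Suc_eq order_refl)
      with Suc.prems show False by simp
    qed
    ultimately have "\<not> arc_closed G ?S"
      using conn connected_iff_arc_closed[OF G] by blast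
    then obtain a where a: "a \<in> A G" "src G a \<in> ?S" "tgt G a \<notin> ?S"
      by (auto simp: arc_closed_def)
    obtain t' where t': "distinct_nodes (rooted r t')" "nodes t' = insert (tgt G a) (nodes t)"
      "parents r t' = insert (tgt G a, src G a) (parents r t)"
      using insert_leaf[of r t "src G a" "tgt G a"] t(1) a by (auto simp: Q_def)
    have new: "v \<noteq> tgt G a" if "(v, p) \<in> parents r t" for v p
      using parents_nodes[OF that] a(3) by auto
    have "Q r t' (up(tgt G a := flip G a))"
      unfolding Q_def
    proof (intro conjI ballI)
      show "insert r (nodes t') \<subseteq> V G" using t(1) t'(2) a(1) by (auto simp: Q_def)
      fix vp assume vp: "vp \<in> parents r t'"
      obtain v p where [simp]: "vp = (v, p)" by (cases vp)
      show "case vp of (v, p) \<Rightarrow> (up(tgt G a := flip G a)) v \<in> A G \<and>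
         src G ((up(tgt G a := flip G a)) v) = v \<and> tgt G ((up(tgt G a := flip G a)) v) = p"
        using vp t(1) t'(3) a(1) new[of v p] unfolding Q_def by fastforce
    qed (rule t'(1))
    moreover have "card (nodes t') = Suc n"
      using t' t(2) a(3) finite_nodes[of t] by simp
    ultimately show ?case by blast
  qed
  have "0 < card (V G)" using r by (auto simp: card_gt_0_iff)
  then obtain t up where t: "Q r t up" "card (nodes t) = card (V G) - 1"
    using grow[of "card (V G) - 1"] by auto
  have "card (insert r (nodes t)) = card (V G)"
    using t \<open>0 < card (V G)\<close> finite_nodes[of t] by (simp add: Q_def)
  then have "insert r (nodes t) = V G"
    using t(1) by (intro card_subset_eq) (simp_all add: Q_def)
  with t(1) show ?thesis unfolding Q_def by blast
qed

text \<open>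
  A choice of one element from each orbit; it is used to orient the edges outside a spanning tree.
\<close>

lemma involution_transversal:
  assumes B: "finite B" and inv: "\<And>a. a \<in> B \<Longrightarrow> i a \<in> B \<and> i a \<noteq> a \<and> i (i a) = a"
  shows "\<exists>x (n::nat). inj_on x {..<n} \<and> B = x ` {..<n} \<union> i ` x ` {..<n} \<and>
    x ` {..<n} \<inter> i ` x ` {..<n} = {}"
proof -
  \<comment> \<open>One choice per orbit \<open>{a, i a}\<close>, so that \<open>a\<close> and \<open>i a\<close> make the same choice.\<close>
  define P where "P e = (SOME a. a \<in> e)" for e :: "'a set"
  have P: "P {a, b} = a \<or> P {a, b} = b" for a b
    using someI[of "\<lambda>x. x \<in> {a, b}" a] by (auto simp: P_def)
  define X where "X = {a \<in> B. P {a, i a} = a}"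
  have fl: "{i a, i (i a)} = {a, i a}" if "a \<in> B" for a using inv[OF that] by auto
  have 1: "B = X \<union> i ` X"
  proof
    show "B \<subseteq> X \<union> i ` X"
    proof
      fix a assume a: "a \<in> B"
      show "a \<in> X \<union> i ` X"
      proof (cases "P {a, i a} = a")
        case False
        then have "i a \<in> X" using P[of a "i a"] fl[OF a] inv[OF a] by (auto simp: X_def)
        moreover have "a = i (i a)" using inv[OF a] by simp
        ultimately show ?thesis by blast
      qed (use a X_def in simp)
    qed
  qed (use inv X_def in auto)
  have 2: "X \<inter> i ` X = {}"
  proof (rule ccontr)
    assume "X \<inter> i ` X \<noteq> {}"
    then obtain a where a: "a \<in> X" "i a \<in> X" by blast
    then have "P {a, i a} = a" "P {a, i a} = i a" "a \<in> B" using fl[of a] by (auto simp: X_def)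
    with inv[of a] show False by simp
  qed
  have "finite X" using B by (simp add: X_def)
  then obtain x and n :: nat where "X = x ` {..<n}" "inj_on x {..<n}"
    using finite_imp_nat_seg_image_inj_on[of X] by (auto simp: lessThan_def)
  with 1 2 show ?thesis by blast
qed

lemma framed_graph_exists:
  assumes G: "is_graph G" and conn: "connected (dg G)"
  shows "\<exists>F. framed_graph G F"
proof -
  interpret undirected_graph G using G by (simp add: is_graph_iff)
  obtain r t up where d: "distinct_nodes (rooted r t)" and vs: "insert r (nodes t) = V G"
    and up: "\<forall>(v, p)\<in>parents r t. up v \<in> A G \<and> src G (up v) = v \<and> tgt G (up v) = p"
    using spanning_forest_exists[OF assms] by blast
  let ?U = "up ` nodes t"
  have par: "\<exists>p. (v, p) \<in> parents r t \<and> up v \<in> A G \<and> src G (up v) = v \<and> tgt G (up v) = p"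
    if v: "v \<in> nodes t" for v
  proof -
    obtain p where p: "(v, p) \<in> parents r t" using parents_exists[OF v] by blast
    with bspec[OF up p] show ?thesis by auto
  qed
  have U: "?U \<subseteq> A G" using par by auto
  have inj: "inj_on up (nodes t)" by (rule inj_on_inverseI[of _ "src G"]) (use par in auto)
  have disj: "flip G (up v) \<noteq> up w" if vw: "v \<in> nodes t" "w \<in> nodes t" for v w
  proof
    assume e: "flip G (up v) = up w"
    obtain p q where p: "(v, p) \<in> parents r t" "tgt G (up v) = p" "src G (up v) = v" "up v \<in> A G"
      and q: "(w, q) \<in> parents r t" "tgt G (up w) = q" "src G (up w) = w"
      using par vw by blast
    have "q = v" "p = w" using p q e tail_arev[OF p(4)] head_arev[OF p(4)] by auto
    then have "(w, v) \<in> before (rooted r t)" "(v, w) \<in> before (rooted r t)"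
      using parent_before[OF d] p(1) q(1) by blast+
    then show False using before_trans[OF d] before_irrefl[OF d] by blast
  qed
  let ?B = "A G - ?U - flip G ` ?U"
  have "\<exists>x (n::nat). inj_on x {..<n} \<and> ?B = x ` {..<n} \<union> flip G ` x ` {..<n} \<and>
    x ` {..<n} \<inter> flip G ` x ` {..<n} = {}"
  proof (rule involution_transversal)
    show "flip G a \<in> ?B \<and> flip G a \<noteq> a \<and> flip G (flip G a) = a" if a: "a \<in> ?B" for a
    proof (intro conjI)
      show "flip G a \<noteq> a" using a arev_neq by simp
      show "flip G a \<in> ?B" using a arev_arev by (metis (no_types, lifting) Diff_iff arev_in_arcs image_iff)
    qed simp
  qed simp
  then obtain x n where x: "inj_on x {..<n::nat}" "?B = x ` {..<n} \<union> flip G ` x ` {..<n}"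
    "x ` {..<n} \<inter> flip G ` x ` {..<n} = {}"
    by (elim exE conjE) (rule that)
  have xB: "x k \<in> ?B" if "k < n" for k using that x(2) by blast
  define F where "F = \<lparr>base = r, branches = t, arr = case_sum up x, surplus = n\<rparr>"
  have F [simp]: "base F = r" "branches F = t" "arr F (Inl v) = up v" "arr F (Inr k) = x k"
    "surplus F = n" for v k
    by (simp_all add: F_def)
  have img: "arr F ` names F = ?U \<union> x ` {..<n}"
    by (force simp: names_def)
  have "framed_graph G F"
  proof unfold_locales
    show "distinct_nodes (rooted (base F) (branches F))" using d by simp
    show "V G = insert (base F) (nodes (branches F))" using vs by simp
    have "flip G ` ?U \<subseteq> A G" using U by auto
    then have "A G = ?U \<union> flip G ` ?U \<union> ?B" using U by blast
    then have "A G = ?U \<union> flip G ` ?U \<union> (x ` {..<n} \<union> flip G ` x ` {..<n})"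
      unfolding x(2) .
    then show "A G = arr F ` names F \<union> flip G ` arr F ` names F"
      unfolding img image_Un by blast
    have "up v \<noteq> x k" if "v \<in> nodes t" "k < n" for v k
    proof -
      have "up v \<in> ?U" using that(1) by simp
      then show ?thesis using xB[OF that(2)] by auto
    qed
    then have ne: "arr F (Inl v) \<noteq> arr F (Inr k)" if "v \<in> nodes t" "k < n" for v k
      using that by simp
    show "inj_on (arr F) (names F)"
    proof (rule inj_onI)
      fix e e' assume e: "e \<in> names F" "e' \<in> names F" "arr F e = arr F e'"
      show "e = e'"
      proof (cases e; cases e')
        show ?thesis if "e = Inl v" "e' = Inl w" for v w
          using e that inj_onD[OF inj, of v w] by (simp add: names_def image_iff)
        show ?thesis if "e = Inr k" "e' = Inr l" for k l
          using e that inj_onD[OF x(1), of k l] by (simp add: names_def image_iff)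
        show ?thesis if "e = Inl v" "e' = Inr k" for v k
          using e that ne[of v k] by (simp add: names_def image_iff)
        show ?thesis if "e = Inr k" "e' = Inl v" for v k
          using e that ne[of v k] by (simp add: names_def image_iff)
      qed
    qed
    show "flip G (arr F e) \<noteq> arr F e'" if "e \<in> names F" "e' \<in> names F" for e e'
    proof -
      have a: "flip G (up v) \<noteq> x k" "flip G (x k) \<noteq> up v" if "v \<in> nodes t" "k < n" for v k
      proof -
        have "up v \<in> ?U" using that(1) by simp
        then have "x k \<noteq> flip G (up v)" using xB[OF that(2)] by auto
        then show "flip G (up v) \<noteq> x k" "flip G (x k) \<noteq> up v"
          by (metis arev_arev)+
      qed
      have "flip G (x k) \<noteq> x l" if "k < n" "l < n" for k l
      proof -
        have "x l \<in> x ` {..<n}" "flip G (x k) \<in> flip G ` x ` {..<n}" using that by simp_all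
        then show ?thesis using x(3) by auto
      qed
      then show ?thesis using that a disj by (auto simp: names_def)
    qed
    show "src G (arr F (Inl v)) = v \<and> tgt G (arr F (Inl v)) = p"
      if "(v, p) \<in> parents (base F) (branches F)" for v p
      using that up by auto
  qed
  then show ?thesis by blast
qed

text \<open>
  The tree edges, named by their lower ends, that \<open>\<phi>\<close> deletes or maps to edges.
\<close>

definition uncontracted ::
  "('v, 'a) frame \<Rightarrow> (('v, 'a) elt \<Rightarrow> ('w, 'b) elt) \<Rightarrow> 'v set" where
  "uncontracted F \<phi> = {v \<in> nodes (branches F). \<nexists>w. \<phi> (Arrow (arr F (Inl v))) = Vert w}"

text \<open>
  The fibre over a vertex \<open>w\<close> of \<open>H\<close> is connected, hence has at least as many edges as it has vertices
  other than a chosen one. So at least \<open>card (V G) - card (V H)\<close> edges are contracted, while \<open>G\<close> has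
  \<open>card (V G) - 1 + surplus F\<close> edges.
\<close>

lemma (in framed_graph) card_uncontracted:
  assumes \<phi>: "minor_morphism G H \<phi>" and H: "is_graph H"
  shows "card (uncontracted F \<phi>) \<le> surplus F + card (V H)"
proof -
  interpret H: undirected_graph H using H by (simp add: is_graph_iff)
  note p = minor_morphismD[OF \<phi>]
  let ?T = "\<lambda>w. fiber G \<phi> w"
  let ?e = "\<lambda>v. {arr F (Inl v), flip G (arr F (Inl v))}"
  have T: "is_graph (?T w)" "connected (dg (?T w))" if "w \<in> V H" for w
    using p(8)[OF that] by (simp_all add: utree_def)
  have eT: "edges (?T w) = (\<lambda>a. {a, flip G a}) ` A (?T w)" for w
    unfolding edges_def by (rule image_cong) auto
  have sub: "edges (?T w) \<subseteq> edges G" for w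
    unfolding eT by (auto simp: edges_def)
  have fin: "finite (edges G)" by (simp add: edges_def)
  have ge: "card (V (?T w)) \<le> Suc (card (edges (?T w)))" if w: "w \<in> V H" for w
  proof -
    obtain F' where "framed_graph (?T w) F'" using framed_graph_exists[OF T[OF w]] by blast
    then interpret F': framed_graph "?T w" F' .
    show ?thesis using F'.card_verts F'.card_edges by simp
  qed
  have "card (V G) = card (\<Union>w\<in>V H. V (?T w))"
    using p(3) by (intro arg_cong[where f = card]) auto
  also have "\<dots> \<le> (\<Sum>w\<in>V H. card (V (?T w)))"
    by (rule card_UN_le) simp
  also have "\<dots> \<le> (\<Sum>w\<in>V H. Suc (card (edges (?T w))))"
    by (rule sum_mono) (rule ge)
  also have "\<dots> = card (V H) + (\<Sum>w\<in>V H. card (edges (?T w)))"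
    by (simp add: sum_Suc)
  also have "(\<Sum>w\<in>V H. card (edges (?T w))) = card (\<Union>w\<in>V H. edges (?T w))"
  proof (rule card_UN_disjoint[symmetric])
    show "\<forall>w\<in>V H. finite (edges (?T w))" using sub fin finite_subset by blast
    show "\<forall>w\<in>V H. \<forall>w'\<in>V H. w \<noteq> w' \<longrightarrow> edges (?T w) \<inter> edges (?T w') = {}"
    proof (intro ballI impI, rule ccontr)
      fix w w' assume "w \<noteq> w'" "edges (?T w) \<inter> edges (?T w') \<noteq> {}"
      then obtain a b where "a \<in> A (?T w)" "b \<in> A (?T w')" "{a, flip G a} = {b, flip G b}"
        unfolding eT by blast
      moreover from this have "\<phi> (Arrow (flip G b)) = Vert w'" using p(4)[of b] by simp
      ultimately show False using \<open>w \<noteq> w'\<close> by (auto simp: doubleton_eq_iff)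
    qed
  qed simp
  finally have contr: "card (V G) \<le> card (V H) + card (\<Union>w\<in>V H. edges (?T w))" .
  have "card (uncontracted F \<phi>) = card (?e ` uncontracted F \<phi>)"
  proof (rule card_image[symmetric])
    have "uncontracted F \<phi> \<subseteq> nodes (branches F)" by (auto simp: uncontracted_def)
    moreover have "inj_on ?e (nodes (branches F))"
      using inj_on_edges by (auto simp: inj_on_def names_def)
    ultimately show "inj_on ?e (uncontracted F \<phi>)" by (rule inj_on_subset[rotated])
  qed
  moreover have "?e ` uncontracted F \<phi> \<inter> (\<Union>w\<in>V H. edges (?T w)) = {}"
  proof (rule ccontr)
    assume "?e ` uncontracted F \<phi> \<inter> (\<Union>w\<in>V H. edges (?T w)) \<noteq> {}"
    then obtain v w where v: "v \<in> uncontracted F \<phi>" and "?e v \<in> edges (?T w)" by blast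
    then obtain a where a: "a \<in> A (?T w)" "?e v = {a, flip G a}" unfolding eT by blast
    then have "\<phi> (Arrow (flip G a)) = Vert w" "\<phi> (Arrow a) = Vert w" using p(4)[of a] by simp_all
    then have "\<phi> (Arrow (arr F (Inl v))) = Vert w"
      using a(2) by (metis doubleton_eq_iff)
    with v show False by (auto simp: uncontracted_def)
  qed
  moreover have fin2: "finite (\<Union>w\<in>V H. edges (?T w))"
    using sub fin by (meson UN_least finite_subset)
  moreover have fin3: "finite (?e ` uncontracted F \<phi>)"
    using finite_nodes[of "branches F"] by (simp add: uncontracted_def)
  ultimately have "card (uncontracted F \<phi>) + card (\<Union>w\<in>V H. edges (?T w)) =
      card (?e ` uncontracted F \<phi> \<union> (\<Union>w\<in>V H. edges (?T w)))"
    by (simp add: card_Un_disjoint)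
  also have "\<dots> \<le> card (edges G)"
  proof (rule card_mono[OF fin])
    have "?e v \<in> edges G" if "v \<in> uncontracted F \<phi>" for v
      using that unfolding edges_def by (intro image_eqI[of _ _ "arr F (Inl v)"])
        (auto simp: uncontracted_def names_def)
    then show "?e ` uncontracted F \<phi> \<union> (\<Union>w\<in>V H. edges (?T w)) \<subseteq> edges G" using sub by blast
  qed
  finally show ?thesis using contr card_edges card_verts by simp
qed


section \<open>Minor morphisms from embeddings of labelled forests\<close>

abbreviation vertex_rank :: "('v, 'a) frame \<Rightarrow> 'v \<Rightarrow> nat" where
  "vertex_rank F \<equiv> rank (rooted (base F) (branches F))"

text \<open>
  The surplus edges that start at \<open>v\<close> and those that end at \<open>v\<close>. As each of them has exactly one start
  and one end, an embedding that preserves slots respects the ends of all surplus edges.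
\<close>

definition slots :: "('v, 'a) ugraph \<Rightarrow> ('v, 'a) frame \<Rightarrow> 'v \<Rightarrow> nat set \<times> nat set" where
  "slots G F v = ({k. k < surplus F \<and> src G (arr F (Inr k)) = v},
                  {k. k < surplus F \<and> tgt G (arr F (Inr k)) = v})"

definition vertex_label where
  "vertex_label G F \<phi> v = (\<phi> (Vert v), slots G F v)"

definition branch_label where
  "branch_label G F \<phi> v = (vertex_label G F \<phi> v, \<phi> (Arrow (arr F (Inl v))))"

text \<open>
  In a closed walk every arrow is followed and preceded by another one.
\<close>

lemma closed_walk_ends:
  fixes T :: "('v, 'a) pre_digraph"
  assumes "pre_digraph.awalk T u p u" "p \<noteq> []"
  shows "tail T ` set p = head T ` set p"
proof -
  interpret pre_digraph T .
  have *: "insert w (tail T ` set q) = insert v (head T ` set q) \<and>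
      (q \<noteq> [] \<longrightarrow> v \<in> tail T ` set q \<and> w \<in> head T ` set q)" if "cas v q w" for v q w
    using that
  proof (induction q arbitrary: v)
    case (Cons e q)
    then have "insert w (tail T ` set q) = insert (head T e) (head T ` set q)"
      "q \<noteq> [] \<longrightarrow> w \<in> head T ` set q" "tail T e = v" "q = [] \<longrightarrow> w = head T e"
      by auto
    then show ?case by auto
  qed simp
  have "cas u p u" using assms(1) by (simp add: awalk_def)
  from *[OF this] assms(2) show ?thesis by (metis insert_absorb)
qed

text \<open>
  Two graphs over \<open>H\<close> and an embedding of their spanning trees that preserves all data: the labels of
  the tree, and the data of the root and of the surplus edges, which the tree does not carry.
\<close>

locale frame_contraction =
  G: framed_graph G F + G': framed_graph G' F' +
  contraction "branch_label G F \<phi>" "branch_label G' F' \<phi>'"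
    "base F" "branches F" "base F'" "branches F'" f i
  for G :: "('v, 'a) ugraph" and F and G' :: "('w, 'b) ugraph" and F'
    and \<phi> :: "('v, 'a) elt \<Rightarrow> ('x, 'c) elt" and \<phi>' f i +
  fixes H :: "('x, 'c) ugraph"
  assumes \<phi>: "minor_morphism G H \<phi>" and \<phi>': "minor_morphism G' H \<phi>'"
    and surplus_eq: "surplus F' = surplus F"
    and surplus_label: "k < surplus F \<Longrightarrow>
      \<phi>' (Arrow (arr F' (Inr k))) = \<phi> (Arrow (arr F (Inr k)))"
    and base_label: "vertex_label G' F' \<phi>' (base F') = vertex_label G F \<phi> (base F)"
    and card_eq: "card (uncontracted F' \<phi>') = card (uncontracted F \<phi>)"
begin

abbreviation "N \<equiv> nodes (branches F)"
abbreviation "N' \<equiv> nodes (branches F')"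

text \<open>
  The edge of \<open>G'\<close> that the contraction maps to a given edge of \<open>G\<close>.
\<close>

definition lift :: "'v + nat \<Rightarrow> 'w + nat" where
  "lift d = map_sum i id d"

lemma lift_simps [simp]: "lift (Inl v) = Inl (i v)" "lift (Inr k) = Inr k"
  by (simp_all add: lift_def)

text \<open>
  Lifted arrows go to the arrows that they lift. All other arrows belong to branches whose two ends
  have the same image under \<open>f\<close>, and they are contracted to it.
\<close>

definition cmap :: "('w, 'b) elt \<Rightarrow> ('v, 'a) elt" where
  "cmap = (\<lambda>e\<in>elts G'. case e of
      Star \<Rightarrow> Star
    | Vert v \<Rightarrow> Vert (f v)
    | Arrow a \<Rightarrow>
        if \<exists>d\<in>names F. a = arr F' (lift d)
        then Arrow (arr F (THE d. d \<in> names F \<and> a = arr F' (lift d)))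
        else if \<exists>d\<in>names F. a = flip G' (arr F' (lift d))
        then Arrow (flip G (arr F (THE d. d \<in> names F \<and> a = flip G' (arr F' (lift d)))))
        else Vert (f (src G' a)))"

lemma i_inj: "inj_on i (insert (base F) N)"
  by (rule inj_on_inverseI[of _ f]) (use f_i i_root f_root in auto)

lemma f_i': "v \<in> V G \<Longrightarrow> f (i v) = v"
  using f_i i_root f_root by (auto simp: G.verts)

lemma i_in': "v \<in> V G \<Longrightarrow> i v \<in> V G'"
  using i_in i_root by (auto simp: G.verts G'.verts)

lemma f_in': "v \<in> V G' \<Longrightarrow> f v \<in> V G"
  using f_in by (auto simp: G.verts G'.verts)

lemma lift_in [simp]: "d \<in> names F \<Longrightarrow> lift d \<in> names F'"
  using i_in by (auto simp: names_def surplus_eq)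

lemma lift_inj: "d \<in> names F \<Longrightarrow> d' \<in> names F \<Longrightarrow> lift d = lift d' \<Longrightarrow> d = d'"
  using i_inj by (auto simp: names_def inj_on_def)

text \<open>
  Makes the definite descriptions in \<open>cmap\<close> well defined.
\<close>

lemma arr_lift_inj:
  assumes "d \<in> names F" "d' \<in> names F" "arr F' (lift d) = arr F' (lift d')"
  shows "d = d'"
  using inj_onD[OF G'.arr_inj assms(3)] assms lift_inj by simp

lemma flip_eq_iff: "flip G' a = flip G' b \<longleftrightarrow> a = b"
  by (metis G'.arev_arev)

lemma cmap_Star [simp]: "cmap Star = Star"
  by (simp add: cmap_def)

lemma cmap_Vert [simp]: "v \<in> V G' \<Longrightarrow> cmap (Vert v) = Vert (f v)"
  by (simp add: cmap_def)

lemma cmap_arr [simp]: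
  assumes d: "d \<in> names F"
  shows "cmap (Arrow (arr F' (lift d))) = Arrow (arr F d)"
proof -
  have "(THE d'. d' \<in> names F \<and> arr F' (lift d) = arr F' (lift d')) = d"
    using d arr_lift_inj by (intro the_equality) auto
  moreover have "\<exists>d'\<in>names F. arr F' (lift d) = arr F' (lift d')" using d by blast
  ultimately show ?thesis using d by (simp add: cmap_def)
qed

lemma cmap_flip_arr [simp]:
  assumes d: "d \<in> names F"
  shows "cmap (Arrow (flip G' (arr F' (lift d)))) = Arrow (flip G (arr F d))"
proof -
  have "(THE d'. d' \<in> names F \<and> flip G' (arr F' (lift d)) = flip G' (arr F' (lift d'))) = d"
    using d arr_lift_inj by (intro the_equality) (auto simp: flip_eq_iff)
  moreover have "\<exists>d'\<in>names F. flip G' (arr F' (lift d)) = flip G' (arr F' (lift d'))"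
    using d by blast
  moreover have "\<not> (\<exists>d'\<in>names F. flip G' (arr F' (lift d)) = arr F' (lift d'))"
    using G'.arr_flip d by simp
  ultimately show ?thesis using d by (simp add: cmap_def)
qed

lemma parent_notin:
  assumes v: "v \<in> N'" "v \<notin> i ` N"
  shows "f (tgt G' (arr F' (Inl v))) = f v"
  using parent_contracted[OF G'.parent_exists(1)[OF v(1)] v(2)] by simp

lemma arc_cases' [consumes 1, case_names arr flip contracted]:
  assumes a: "a \<in> A G'"
  obtains d where "d \<in> names F" "a = arr F' (lift d)"
  | d where "d \<in> names F" "a = flip G' (arr F' (lift d))"
  | v where "v \<in> N'" "v \<notin> i ` N" "a = arr F' (Inl v) \<or> a = flip G' (arr F' (Inl v))"
      "cmap (Arrow a) = Vert (f v)" "f (src G' a) = f v" "f (tgt G' a) = f v"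
proof -
  \<comment> \<open>An edge of \<open>G'\<close> is lifted unless it is a branch below a vertex outside the image of \<open>i\<close>.\<close>
  have lifted: "(\<exists>d\<in>names F. d' = lift d) \<or> (\<exists>v\<in>N'. v \<notin> i ` N \<and> d' = Inl v)"
    if "d' \<in> names F'" for d'
  proof (cases d')
    case (Inl v)
    then have v: "v \<in> N'" using that by (auto simp: names_def)
    show ?thesis
    proof (cases "v \<in> i ` N")
      case True
      then obtain u where "u \<in> N" "v = i u" by blast
      then show ?thesis using Inl by (intro disjI1 bexI[of _ "Inl u"]) (auto simp: names_def)
    qed (use v Inl in blast)
  next
    case (Inr k)
    then show ?thesis using that
      by (intro disjI1 bexI[of _ "Inr k"]) (auto simp: names_def surplus_eq)
  qed
  obtain d' where d': "d' \<in> names F'" "a = arr F' d' \<or> a = flip G' (arr F' d')"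
    using a by (meson G'.arc_cases)
  show thesis
  proof (cases "\<exists>d\<in>names F. d' = lift d")
    case True
    with d'(2) that(1,2) show thesis by blast
  next
    case False
    then obtain v where v: "v \<in> N'" "v \<notin> i ` N" "d' = Inl v"
      using lifted[OF d'(1)] by blast
    have no: "d' \<noteq> lift d" if "d \<in> names F" for d using False that by blast
    have nolift: "a \<noteq> arr F' (lift d)" "a \<noteq> flip G' (arr F' (lift d))" if d: "d \<in> names F" for d
    proof -
      have "arr F' d' \<noteq> arr F' (lift d)"
        using inj_onD[OF G'.arr_inj, of d' "lift d"] no[OF d] d d'(1) by auto
      then show "a \<noteq> arr F' (lift d)" "a \<noteq> flip G' (arr F' (lift d))"
        using d'(2) G'.arr_flip[of d' "lift d"] G'.arr_flip[of "lift d" d'] d d'(1)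
        by (auto simp: flip_eq_iff)
    qed
    have srcv: "src G' (arr F' d') = v" "arr F' d' \<in> A G'"
      using G'.parent_exists(2)[OF v(1)] d'(1) by (simp_all add: v(3))
    have ends: "f (src G' a) = f v" "f (tgt G' a) = f v"
      using d'(2) parent_notin[OF v(1,2)] srcv by (auto simp: v(3))
    then have "cmap (Arrow a) = Vert (f v)"
      using a nolift by (auto simp: cmap_def)
    with ends v d'(2) show thesis by (intro that(3)) auto
  qed
qed

lemma vertex_label_i:
  assumes "v \<in> V G"
  shows "vertex_label G' F' \<phi>' (i v) = vertex_label G F \<phi> v"
proof (cases "v = base F")
  case True
  then show ?thesis using base_label i_root by simp
next
  case False
  with assms have "v \<in> N" by (simp add: G.verts)
  from lab[OF this] show ?thesis by (simp add: branch_label_def)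
qed

text \<open>
  For a branch this holds because \<open>f\<close> is a contraction of trees. A surplus edge keeps its ends because
  \<open>i\<close> preserves slots: the end of the \<open>k\<close>-th surplus edge at \<open>v\<close> sits at \<open>i v\<close> in \<open>G'\<close>.
\<close>

lemma ends_lift:
  assumes d: "d \<in> names F"
  shows "f (src G' (arr F' (lift d))) = src G (arr F d)"
    and "f (tgt G' (arr F' (lift d))) = tgt G (arr F d)"
proof -
  have "f (src G' (arr F' (lift d))) = src G (arr F d) \<and>
    f (tgt G' (arr F' (lift d))) = tgt G (arr F d)"
  proof (cases d)
    case (Inl v)
    then have v: "v \<in> N" using d by (auto simp: names_def)
    have iv: "i v \<in> N'" by (rule i_in[OF v])
    have "f (tgt G' (arr F' (Inl (i v)))) = tgt G (arr F (Inl v))"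
      by (rule parent_top[OF G.parent_exists(1)[OF v] G'.parent_exists(1)[OF iv]])
    with G.parent_exists(2)[OF v] G'.parent_exists(2)[OF iv] f_i[OF v] Inl show ?thesis by simp
  next
    case (Inr k)
    then have k: "k < surplus F" using d by (auto simp: names_def)
    define u w where "u = src G (arr F d)" and "w = tgt G (arr F d)"
    have u: "u \<in> V G" "w \<in> V G" using d by (simp_all add: u_def w_def)
    have "k \<in> fst (slots G F u)" "k \<in> snd (slots G F w)"
      using k by (simp_all add: slots_def u_def w_def Inr)
    moreover have "slots G' F' (i u) = slots G F u" "slots G' F' (i w) = slots G F w"
      using vertex_label_i u by (simp_all add: vertex_label_def)
    ultimately have "k \<in> fst (slots G' F' (i u))" "k \<in> snd (slots G' F' (i w))" by simp_all
    then have "src G' (arr F' (Inr k)) = i u" "tgt G' (arr F' (Inr k)) = i w"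
      by (simp_all add: slots_def)
    with f_i' u Inr show ?thesis by (simp add: u_def w_def)
  qed
  then show "f (src G' (arr F' (lift d))) = src G (arr F d)"
    "f (tgt G' (arr F' (lift d))) = tgt G (arr F d)" by blast+
qed

lemma cmap_flip:
  assumes a: "a \<in> A G'"
  shows "cmap (Arrow (flip G' a)) = map_elt id (flip G) (cmap (Arrow a))"
  using a
proof (cases rule: arc_cases')
  case (arr d)
  then show ?thesis by simp
next
  case (flip d)
  then show ?thesis by simp
next
  case (contracted v)
  have "flip G' a \<in> A G'" using a by simp
  then have "cmap (Arrow (flip G' a)) = Vert (f v)"
  proof (cases rule: arc_cases')
    case (arr d)
    then have "a = flip G' (arr F' (lift d))" by (metis G'.arev_arev)
    with contracted(4) arr(1) show ?thesis by simp
  next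
    case (flip d)
    then have "a = arr F' (lift d)" by (simp add: flip_eq_iff)
    with contracted(4) flip(1) show ?thesis by simp
  next
    case (contracted w)
    then show ?thesis using \<open>f (tgt G' a) = f v\<close> a by simp
  qed
  with contracted show ?thesis by simp
qed

lemma cmap_elts: "cmap \<in> elts G' \<rightarrow>\<^sub>E elts G"
proof (rule PiE_I)
  fix e assume e: "e \<in> elts G'"
  show "cmap e \<in> elts G"
  proof (cases e)
    case (Arrow a)
    then have a: "a \<in> A G'" using e by simp
    then show ?thesis
    proof (cases rule: arc_cases')
      case (contracted v)
      then show ?thesis using f_in'[of v] Arrow by (simp add: G'.verts)
    qed (simp_all add: Arrow)
  qed (use e f_in' in auto)
qed (simp add: cmap_def)

lemma contracted_arc:
  assumes v: "v \<in> N'" "v \<notin> i ` N"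
  shows "cmap (Arrow (arr F' (Inl v))) = Vert (f v)"
    and "cmap (Arrow (flip G' (arr F' (Inl v)))) = Vert (f v)"
proof -
  have n: "Inl v \<in> names F'" using v by (simp add: names_def)
  then have a: "arr F' (Inl v) \<in> A G'" by simp
  then show 1: "cmap (Arrow (arr F' (Inl v))) = Vert (f v)"
  proof (cases rule: arc_cases')
    case (arr d)
    then have "Inl v = lift d" using inj_onD[OF G'.arr_inj arr(2)] n by simp
    with v(2) arr(1) show ?thesis by (cases d) (auto simp: names_def)
  next
    case (flip d)
    with G'.arr_flip[of "lift d" "Inl v"] n show ?thesis by simp
  next
    case (contracted w)
    with G'.parent_exists(2)[OF v(1)] show ?thesis by simp
  qed
  from cmap_flip[OF a] show "cmap (Arrow (flip G' (arr F' (Inl v)))) = Vert (f v)"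
    by (simp add: 1)
qed

lemma rank_parent:
  assumes v: "v \<in> N'"
  shows "vertex_rank F' (tgt G' (arr F' (Inl v))) <
    vertex_rank F' v"
  using rank_less[OF G'.distinct parent_before[OF G'.distinct G'.parent_exists(1)[OF v]]] .

lemma fiber_cmap_is_graph: "is_graph (fiber G' cmap w)"
proof (rule is_graph_fiber)
  show "is_graph G'" by (simp add: is_graph_iff G'.undirected_graph_axioms)
  fix a assume a: "a \<in> A G'" "cmap (Arrow a) = Vert w"
  with cmap_flip[OF a(1)] show "cmap (Arrow (flip G' a)) = Vert w" by simp
  from a(1) show "cmap (Vert (tgt G' a)) = Vert w"
  proof (cases rule: arc_cases')
    case (contracted v)
    with a show ?thesis by simp
  qed (use a in simp_all)
qed

text \<open>
  Following parents, each vertex of the fibre over \<open>w\<close> reaches the top vertex \<open>i w\<close>.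
\<close>

lemma fiber_cmap_connected:
  assumes w: "w \<in> V G"
  shows "connected (dg (fiber G' cmap w))"
  unfolding connected_iff_arc_closed[OF fiber_cmap_is_graph]
proof (intro conjI allI impI)
  let ?T = "fiber G' cmap w"
  have VT: "v \<in> V ?T \<longleftrightarrow> v \<in> V G' \<and> f v = w" for v by auto
  have iw: "i w \<in> V ?T" using w f_i' i_in' VT by blast
  then show "V ?T \<noteq> {}" by blast
  fix S assume S: "S \<subseteq> V ?T" "S \<noteq> {} \<and> arc_closed ?T S"
  have reach: "v \<in> S \<longleftrightarrow> i w \<in> S" if "v \<in> V ?T" for v
    using that
  proof (induction "vertex_rank F' v" arbitrary: v rule: less_induct)
    case less
    show ?case
    proof (cases "v = i w")
      case False
      have v: "v \<in> V G'" "f v = w" using less.prems VT by auto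
      have "v \<noteq> base F'" using False v(2) f_root i_root by auto
      then have vN: "v \<in> N'" using v(1) by (simp add: G'.verts)
      have vi: "v \<notin> i ` N" using False v(2) f_i by auto
      let ?a = "arr F' (Inl v)"
      have a: "?a \<in> A G'" "src G' ?a = v" using vN G'.parent_exists(2) by (simp_all add: names_def)
      have aT: "?a \<in> A ?T" "flip G' ?a \<in> A ?T"
        using contracted_arc[OF vN vi] a(1) v(2) by simp_all
      have e: "src ?T ?a = v" "tgt ?T ?a = tgt G' ?a" "src ?T (flip G' ?a) = tgt G' ?a"
        "tgt ?T (flip G' ?a) = v"
        using aT a by simp_all
      have "v \<in> S \<longleftrightarrow> tgt G' ?a \<in> S"
        using S(2) aT e unfolding arc_closed_def by metis
      moreover have "tgt G' ?a \<in> V ?T"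
        using a(1) parent_notin[OF vN vi] v(2) VT by simp
      ultimately show ?thesis using less.hyps[OF rank_parent[OF vN]] by simp
    qed simp
  qed
  obtain v where "v \<in> S" using S(2) by blast
  with reach[of v] S(1) have "i w \<in> S" by blast
  with reach S(1) show "S = V ?T" by blast
qed

text \<open>
  The fibres only contain arrows of the spanning tree.
\<close>

lemma fiber_cmap_acyclic: "\<not> ucycle (fiber G' cmap w) p"
proof
  let ?T = "fiber G' cmap w" and ?rk = "vertex_rank F'"
  interpret T: undirected_graph ?T using fiber_cmap_is_graph by (simp add: is_graph_iff)
  assume "ucycle ?T p"
  then obtain u where p: "T.awalk u p u" "p \<noteq> []" and nf: "\<forall>a\<in>set p. flip ?T a \<notin> set p"
    by (auto simp: ucycle_def pre_digraph.cycle_def)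
  have ends: "src ?T ` set p = tgt ?T ` set p" by (rule closed_walk_ends[OF p])
  have pT: "a \<in> A ?T" if "a \<in> set p" for a using p(1) that by (auto simp: T.awalk_def)
  have tree_arc: "\<exists>v\<in>N'. (a = arr F' (Inl v) \<and> src ?T a = v \<and> ?rk (tgt ?T a) < ?rk v) \<or>
      (a = flip G' (arr F' (Inl v)) \<and> tgt ?T a = v \<and> ?rk (src ?T a) < ?rk v)"
    if a: "a \<in> set p" for a
  proof -
    have aT: "a \<in> A G'" "cmap (Arrow a) = Vert w" using pT[OF a] by simp_all
    from aT(1) show ?thesis
    proof (cases rule: arc_cases')
      case (contracted v)
      have n: "arr F' (Inl v) \<in> A G'" using contracted(1) by (simp add: names_def)
      show ?thesis
        using contracted(1,3) aT n G'.parent_exists(2)[OF contracted(1)] rank_parent[OF contracted(1)]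
        by (intro bexI[of _ v]) auto
    qed (use aT in simp_all)
  qed
  \<comment> \<open>The vertex of the cycle that is last in the preorder can only be entered from its parent
    and left towards its parent.\<close>
  define M where "M = Max (?rk ` tgt ?T ` set p)"
  have le: "?rk x \<le> M" if "x \<in> tgt ?T ` set p" for x
    unfolding M_def using that by (intro Max_ge) auto
  have "M \<in> ?rk ` tgt ?T ` set p"
    unfolding M_def using p(2) by (intro Max_in) auto
  then obtain a where a: "a \<in> set p" "?rk (tgt ?T a) = M" by auto
  have "src ?T a \<in> tgt ?T ` set p" using ends a(1) by blast
  then have "?rk (src ?T a) \<le> ?rk (tgt ?T a)" using le a(2) by simp
  with tree_arc[OF a(1)] obtain v where v: "v \<in> N'" "a = flip G' (arr F' (Inl v))" "tgt ?T a = v"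
    by auto
  obtain b where b: "b \<in> set p" "src ?T b = v" using ends a(1) v(3) by (metis imageE imageI)
  have "tgt ?T b \<in> tgt ?T ` set p" using b(1) by blast
  then have "?rk (tgt ?T b) \<le> ?rk v" using le a(2) v(3) by simp
  with tree_arc[OF b(1)] b(2) have "b = arr F' (Inl v)" by auto
  then have "flip ?T b = a" using v(2) pT[OF b(1)] by simp
  with nf a(1) b(1) show False by blast
qed

lemma minor_morphism_cmap: "minor_morphism G' G cmap"
  unfolding minor_morphism_def
proof (intro conjI ballI allI impI)
  show "cmap \<in> elts G' \<rightarrow>\<^sub>E elts G" by (rule cmap_elts)
  show "cmap Star = Star" by simp
  show "cmap (Vert v) \<in> Vert ` V G" if "v \<in> V G'" for v using that f_in' by simp
  show "cmap (Arrow (flip G' a)) = map_elt id (flip G) (cmap (Arrow a))" if "a \<in> A G'" for a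
    by (rule cmap_flip[OF that])
  show "\<exists>!b. b \<in> A G' \<and> cmap (Arrow b) = Arrow a" if a: "a \<in> A G" for a
  proof -
    from a obtain d where d: "d \<in> names F" "a = arr F d \<or> a = flip G (arr F d)"
      by (meson G.arc_cases)
    have uniq: "b = (if a = arr F d then arr F' (lift d) else flip G' (arr F' (lift d)))"
      if b: "b \<in> A G'" "cmap (Arrow b) = Arrow a" for b
      using b(1)
    proof (cases rule: arc_cases')
      case (arr d')
      then have "a = arr F d'" using b(2) by simp
      with d arr(1) have "d' = d" "a = arr F d"
        using G.arr_flip[of d d'] inj_onD[OF G.arr_inj, of d d'] by auto
      with arr show ?thesis by simp
    next
      case (flip d')
      then have "a = flip G (arr F d')" using b(2) by simp
      with d flip(1) have "a \<noteq> arr F d" "arr F d' = arr F d"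
        using G.arr_flip[of d' d] by (auto, metis G.arev_arev)
      then have "d' = d" using inj_onD[OF G.arr_inj] d(1) flip(1) by blast
      with flip \<open>a \<noteq> arr F d\<close> show ?thesis by simp
    next
      case (contracted v)
      with b(2) show ?thesis by simp
    qed
    let ?b = "if a = arr F d then arr F' (lift d) else flip G' (arr F' (lift d))"
    have "?b \<in> A G' \<and> cmap (Arrow ?b) = Arrow a" using d by auto
    with uniq show ?thesis by blast
  qed
  fix a assume a: "a \<in> A G'"
  then have aV: "src G' a \<in> V G'" "tgt G' a \<in> V G'" by simp_all
  show "cmap (Vert (tgt G' a)) = Vert (tgt G b)" "cmap (Vert (src G' a)) = Vert (src G b)"
    if b: "cmap (Arrow a) = Arrow b" for b
  proof -
    from a have "f (tgt G' a) = tgt G b \<and> f (src G' a) = src G b"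
    proof (cases rule: arc_cases')
      case (arr d)
      with b ends_lift[OF arr(1)] show ?thesis by simp
    next
      case (flip d)
      with b ends_lift[OF flip(1)] show ?thesis by auto
    next
      case (contracted v)
      with b show ?thesis by simp
    qed
    with aV show "cmap (Vert (tgt G' a)) = Vert (tgt G b)" "cmap (Vert (src G' a)) = Vert (src G b)"
      by simp_all
  qed
  show "cmap (Vert (tgt G' a)) = Vert w" "cmap (Vert (src G' a)) = Vert w"
    if b: "cmap (Arrow a) = Vert w" for w
  proof -
    from a have "f (tgt G' a) = w \<and> f (src G' a) = w"
      by (cases rule: arc_cases') (use b in simp_all)
    with aV show "cmap (Vert (tgt G' a)) = Vert w" "cmap (Vert (src G' a)) = Vert w" by simp_all
  qed
next
  fix w assume "w \<in> V G"
  then show "utree (fiber G' cmap w)"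
    using fiber_cmap_is_graph fiber_cmap_connected fiber_cmap_acyclic by (simp add: utree_def)
qed

text \<open>
  The embedding maps the uncontracted branches of \<open>G\<close> injectively to uncontracted branches of \<open>G'\<close>, and
  there are equally many of them. Hence \<open>\<phi>'\<close> contracts every branch that \<open>cmap\<close> contracts.
\<close>

lemma uncontracted_image: "uncontracted F' \<phi>' = i ` uncontracted F \<phi>"
proof (rule card_subset_eq[symmetric])
  show "finite (uncontracted F' \<phi>')"
    using finite_nodes[of "branches F'"] by (simp add: uncontracted_def)
  show "i ` uncontracted F \<phi> \<subseteq> uncontracted F' \<phi>'"
    using i_in lab by (auto simp: uncontracted_def branch_label_def)
  have "inj_on i (uncontracted F \<phi>)"
    by (rule inj_on_subset[OF i_inj]) (auto simp: uncontracted_def)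
  then show "card (i ` uncontracted F \<phi>) = card (uncontracted F' \<phi>')"
    using card_eq by (simp add: card_image)
qed

lemma factor_arc:
  assumes d: "d \<in> names F"
  shows "\<phi>' (Arrow (arr F' (lift d))) = \<phi> (Arrow (arr F d))"
proof -
  consider v where "v \<in> N" "d = Inl v" | k where "k < surplus F" "d = Inr k"
    using d unfolding names_def by blast
  then show ?thesis
  proof cases
    case 1
    from lab[OF 1(1)] 1(2) show ?thesis by (simp only: branch_label_def prod.inject lift_simps)
  next
    case 2
    from surplus_label[OF 2(1)] 2(2) show ?thesis by (simp only: lift_simps)
  qed
qed

lemma contracted_arc_\<phi>':
  assumes v: "v \<in> N'" "v \<notin> i ` N"
  shows "\<phi>' (Arrow (arr F' (Inl v))) = \<phi>' (Vert v)"
    and "\<phi>' (Vert (tgt G' (arr F' (Inl v)))) = \<phi>' (Vert v)"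
proof -
  have "v \<notin> uncontracted F' \<phi>'"
    using v(2) uncontracted_image by (auto simp: uncontracted_def)
  then obtain w where w: "\<phi>' (Arrow (arr F' (Inl v))) = Vert w"
    using v(1) by (auto simp: uncontracted_def)
  have "arr F' (Inl v) \<in> A G'" using v(1) by (simp add: names_def)
  from minor_morphismD(7)[OF \<phi>' this w] G'.parent_exists(2)[OF v(1)] w
  show "\<phi>' (Arrow (arr F' (Inl v))) = \<phi>' (Vert v)"
    "\<phi>' (Vert (tgt G' (arr F' (Inl v)))) = \<phi>' (Vert v)" by simp_all
qed

text \<open>
  For vertices in the image of \<open>i\<close> this is equality of labels. Any other vertex is joined to its
  parent by a branch that both maps contract, and one climbs towards the root.
\<close>

lemma factor_vertex: "v \<in> V G' \<Longrightarrow> \<phi>' (Vert v) = \<phi> (Vert (f v))"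
proof (induction "vertex_rank F' v" arbitrary: v rule: less_induct)
  case less
  show ?case
  proof (cases "v \<in> i ` V G")
    case True
    then obtain u where u: "u \<in> V G" "v = i u" by blast
    from vertex_label_i[OF u(1)] f_i'[OF u(1)] u(2) show ?thesis by (simp add: vertex_label_def)
  next
    case False
    then have v: "v \<in> N'" "v \<notin> i ` N"
      using less.prems i_root by (auto simp: G.verts G'.verts)
    have "tgt G' (arr F' (Inl v)) \<in> V G'" using v(1) by (simp add: names_def)
    from less.hyps[OF rank_parent[OF v(1)] this] show ?thesis
      using contracted_arc_\<phi>'(2)[OF v] parent_notin[OF v] by simp
  qed
qed

lemma factor: "\<phi>' = compose (elts G') \<phi> cmap"
proof (rule extensionalityI[of _ "elts G'"])
  note p = minor_morphismD[OF \<phi>] and p' = minor_morphismD[OF \<phi>']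
  show "\<phi>' \<in> extensional (elts G')" using p'(1) by (simp add: PiE_def)
  show "compose (elts G') \<phi> cmap \<in> extensional (elts G')" by (rule compose_extensional)
  fix e assume e: "e \<in> elts G'"
  have "\<phi>' e = \<phi> (cmap e)"
  proof (cases e)
    case (Vert v)
    then show ?thesis using e factor_vertex by simp
  next
    case Star
    then show ?thesis using p(2) p'(2) by simp
  next
    case (Arrow a)
    then have "a \<in> A G'" using e by simp
    then show ?thesis
    proof (cases rule: arc_cases')
      case (arr d)
      with factor_arc Arrow show ?thesis by simp
    next
      case (flip d)
      with factor_arc[OF flip(1)] Arrow p(4)[of "arr F d"] p'(4)[of "arr F' (lift d)"]
      show ?thesis by simp
    next
      case (contracted v)
      have v: "v \<in> V G'" using contracted(1) by (simp add: G'.verts)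
      have n: "arr F' (Inl v) \<in> A G'" using contracted(1) by (simp add: names_def)
      obtain w where w: "\<phi>' (Vert v) = Vert w" using p'(3)[OF v] by blast
      have "\<phi>' (Arrow a) = \<phi>' (Vert v)"
        using contracted(3) contracted_arc_\<phi>'(1)[OF contracted(1,2)] p'(4)[OF n] w by auto
      with Arrow contracted(4) factor_vertex[OF v] show ?thesis by simp
    qed
  qed
  with e show "\<phi>' e = compose (elts G') \<phi> cmap e" by (simp add: compose_def)
qed

end


section \<open>Orders on minor morphisms that are preserved by pullback\<close>

text \<open>
  The vertices and one arrow per edge: by compatibility with the involutions, the values at these
  elements determine a minor morphism.
\<close>

definition keys :: "('v, 'a) frame \<Rightarrow> ('v + 'v + nat) set" where
  "keys F = Inl ` insert (base F) (nodes (branches F)) \<union> Inr ` names F"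

fun key_elt :: "('v, 'a) frame \<Rightarrow> 'v + 'v + nat \<Rightarrow> ('v, 'a) elt" where
  "key_elt F (Inl v) = Vert v"
| "key_elt F (Inr d) = Arrow (arr F d)"

text \<open>
  The reading order. Surplus edges come first. Each vertex is read just before the branch to its
  parent: when a pullback contracts the branch, the top vertex of that fibre has been read before it.
\<close>

fun key_pos :: "('v, 'a) frame \<Rightarrow> 'v + 'v + nat \<Rightarrow> nat" where
  "key_pos F (Inl v) = surplus F + 2 * vertex_rank F v"
| "key_pos F (Inr (Inl v)) = surplus F + 2 * vertex_rank F v + 1"
| "key_pos F (Inr (Inr k)) = k"

definition lex_less :: "('e \<Rightarrow> nat) \<Rightarrow> ('v, 'a) frame \<Rightarrow>
    (('v, 'a) elt \<Rightarrow> 'e) \<Rightarrow> (('v, 'a) elt \<Rightarrow> 'e) \<Rightarrow> bool" where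
  "lex_less c F \<phi> \<psi> \<longleftrightarrow> (\<exists>\<kappa>\<in>keys F. c (\<phi> (key_elt F \<kappa>)) < c (\<psi> (key_elt F \<kappa>)) \<and>
     (\<forall>\<kappa>'\<in>keys F. key_pos F \<kappa>' < key_pos F \<kappa> \<longrightarrow> \<phi> (key_elt F \<kappa>') = \<psi> (key_elt F \<kappa>')))"

context framed_graph
begin

lemma key_elt_in: "\<kappa> \<in> keys F \<Longrightarrow> key_elt F \<kappa> \<in> elts G"
  by (cases \<kappa>) (auto simp: keys_def verts)

lemma key_pos_inj: "inj_on (key_pos F) (keys F)"
proof (rule inj_onI)
  let ?r = "vertex_rank F"
  have r: "v = w" if "?r v = ?r w" "v \<in> V G" "w \<in> V G" for v w
    using rank_inj[OF distinct _ _ that(1)] that(2,3) by (simp add: verts)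
  have cases: "(\<exists>v\<in>V G. \<kappa> = Inl v \<and> key_pos F \<kappa> = surplus F + 2 * ?r v) \<or>
      (\<exists>v\<in>V G. \<kappa> = Inr (Inl v) \<and> key_pos F \<kappa> = surplus F + 2 * ?r v + 1) \<or>
      (\<exists>k<surplus F. \<kappa> = Inr (Inr k) \<and> key_pos F \<kappa> = k)" if "\<kappa> \<in> keys F" for \<kappa>
    using that by (auto simp: keys_def names_def verts)
  fix \<kappa> \<mu> assume k: "\<kappa> \<in> keys F" "\<mu> \<in> keys F" "key_pos F \<kappa> = key_pos F \<mu>"
  from cases[OF k(1)] cases[OF k(2)] k(3) show "\<kappa> = \<mu>"
    by (elim disjE bexE exE conjE) (auto dest: r, presburger+)
qed

lemma minor_morphisms_eqI:
  assumes "minor_morphism G H \<phi>" "minor_morphism G H \<psi>"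
    and eq: "\<And>\<kappa>. \<kappa> \<in> keys F \<Longrightarrow> \<phi> (key_elt F \<kappa>) = \<psi> (key_elt F \<kappa>)"
  shows "\<phi> = \<psi>"
proof (rule extensionalityI[of _ "elts G"])
  note p = minor_morphismD[OF assms(1)] and q = minor_morphismD[OF assms(2)]
  show "\<phi> \<in> extensional (elts G)" "\<psi> \<in> extensional (elts G)"
    using p(1) q(1) by (simp_all add: PiE_def)
  have arr: "\<phi> (Arrow (arr F d)) = \<psi> (Arrow (arr F d))" if "d \<in> names F" for d
    using eq[of "Inr d"] that by (simp add: keys_def)
  fix e assume e: "e \<in> elts G"
  show "\<phi> e = \<psi> e"
  proof (cases e)
    case (Vert v)
    then show ?thesis using e eq[of "Inl v"] by (simp add: keys_def verts image_iff)
  next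
    case (Arrow a)
    then have "a \<in> A G" using e by simp
    then show ?thesis
      by (cases rule: arc_cases) (use arr p(4) q(4) Arrow in simp_all)
  next
    case Star
    then show ?thesis using p(2) q(2) by simp
  qed
qed

lemma lex_less_total:
  assumes c: "inj_on c (elts H)" and \<phi>: "minor_morphism G H \<phi>" and \<psi>: "minor_morphism G H \<psi>"
    and ne: "\<phi> \<noteq> \<psi>"
  shows "lex_less c F \<phi> \<psi> \<or> lex_less c F \<psi> \<phi>"
proof -
  \<comment> \<open>The keys at which the two maps differ; the first one decides.\<close>
  define D where "D = {\<kappa> \<in> keys F. \<phi> (key_elt F \<kappa>) \<noteq> \<psi> (key_elt F \<kappa>)}"
  have "D \<noteq> {}" using minor_morphisms_eqI[OF \<phi> \<psi>] ne by (auto simp: D_def)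
  then obtain \<kappa> where \<kappa>: "\<kappa> \<in> D" "\<And>\<mu>. \<mu> \<in> D \<Longrightarrow> key_pos F \<kappa> \<le> key_pos F \<mu>"
    using ex_has_least_nat[of "\<lambda>x. x \<in> D" _ "key_pos F"] by blast
  have agree: "\<phi> (key_elt F \<mu>) = \<psi> (key_elt F \<mu>)" if "\<mu> \<in> keys F" "key_pos F \<mu> < key_pos F \<kappa>" for \<mu>
    using \<kappa>(2)[of \<mu>] that by (auto simp: D_def)
  have k: "\<kappa> \<in> keys F" "\<phi> (key_elt F \<kappa>) \<noteq> \<psi> (key_elt F \<kappa>)" using \<kappa>(1) by (auto simp: D_def)
  have "\<phi> (key_elt F \<kappa>) \<in> elts H" "\<psi> (key_elt F \<kappa>) \<in> elts H"
    using PiE_mem[OF minor_morphismD(1)[OF \<phi>]] PiE_mem[OF minor_morphismD(1)[OF \<psi>]]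
      key_elt_in[OF k(1)] by blast+
  then have "c (\<phi> (key_elt F \<kappa>)) \<noteq> c (\<psi> (key_elt F \<kappa>))"
    using inj_onD[OF c] k(2) by blast
  with k(1) agree show ?thesis unfolding lex_less_def by (metis linorder_neqE_nat)
qed

lemma lex_less_trans:
  assumes 1: "lex_less c F \<phi> \<psi>" and 2: "lex_less c F \<psi> \<chi>"
  shows "lex_less c F \<phi> \<chi>"
proof -
  obtain \<kappa> where k: "\<kappa> \<in> keys F" "c (\<phi> (key_elt F \<kappa>)) < c (\<psi> (key_elt F \<kappa>))"
    "\<And>\<kappa>'. \<kappa>' \<in> keys F \<Longrightarrow> key_pos F \<kappa>' < key_pos F \<kappa> \<Longrightarrow> \<phi> (key_elt F \<kappa>') = \<psi> (key_elt F \<kappa>')"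
    using 1 unfolding lex_less_def by blast
  obtain \<mu> where m: "\<mu> \<in> keys F" "c (\<psi> (key_elt F \<mu>)) < c (\<chi> (key_elt F \<mu>))"
    "\<And>\<kappa>'. \<kappa>' \<in> keys F \<Longrightarrow> key_pos F \<kappa>' < key_pos F \<mu> \<Longrightarrow> \<psi> (key_elt F \<kappa>') = \<chi> (key_elt F \<kappa>')"
    using 2 unfolding lex_less_def by blast
  consider "key_pos F \<kappa> < key_pos F \<mu>" | "key_pos F \<mu> < key_pos F \<kappa>" | "\<kappa> = \<mu>"
    using inj_onD[OF key_pos_inj _ k(1) m(1)] by linarith
  then show ?thesis
  proof cases
    case 1
    then have "\<forall>\<kappa>'\<in>keys F. key_pos F \<kappa>' < key_pos F \<kappa> \<longrightarrow> \<phi> (key_elt F \<kappa>') = \<chi> (key_elt F \<kappa>')"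
      using k(3) m(3) by simp
    moreover have "c (\<phi> (key_elt F \<kappa>)) < c (\<chi> (key_elt F \<kappa>))" using k(1,2) m(3) 1 by simp
    ultimately show ?thesis unfolding lex_less_def using k(1) by blast
  next
    case 2
    then have "\<forall>\<kappa>'\<in>keys F. key_pos F \<kappa>' < key_pos F \<mu> \<longrightarrow> \<phi> (key_elt F \<kappa>') = \<chi> (key_elt F \<kappa>')"
      using k(3) m(3) by simp
    moreover have "c (\<phi> (key_elt F \<mu>)) < c (\<chi> (key_elt F \<mu>))" using m(1,2) k(3) 2 by simp
    ultimately show ?thesis unfolding lex_less_def using m(1) by blast
  next
    case 3
    then have "\<forall>\<kappa>'\<in>keys F. key_pos F \<kappa>' < key_pos F \<kappa> \<longrightarrow> \<phi> (key_elt F \<kappa>') = \<chi> (key_elt F \<kappa>')"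
      using k(3) m(3) by simp
    moreover have "c (\<phi> (key_elt F \<kappa>)) < c (\<chi> (key_elt F \<kappa>))" using k(2) m(2) 3 by simp
    ultimately show ?thesis unfolding lex_less_def using k(1) by blast
  qed
qed

lemma lex_less_irrefl: "\<not> lex_less c F \<phi> \<phi>"
  by (simp add: lex_less_def)

end

context frame_contraction
begin

definition lift_key :: "'v + 'v + nat \<Rightarrow> 'w + 'w + nat" where
  "lift_key \<kappa> = map_sum i lift \<kappa>"

lemma lift_key_simps [simp]: "lift_key (Inl v) = Inl (i v)" "lift_key (Inr d) = Inr (lift d)"
  by (simp_all add: lift_key_def)

lemma lift_key_in: "\<kappa> \<in> keys F \<Longrightarrow> lift_key \<kappa> \<in> keys F'"
  using i_in i_root by (auto simp: keys_def)

lemma cmap_lift_key: "\<kappa> \<in> keys F \<Longrightarrow> cmap (key_elt F' (lift_key \<kappa>)) = key_elt F \<kappa>"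
  using i_in' f_i' by (cases \<kappa>) (auto simp: keys_def G.verts)

lemma rank_i_less:
  assumes "u \<in> V G" "v \<in> V G"
    and "vertex_rank F u < vertex_rank F v"
  shows "vertex_rank F' (i u) < vertex_rank F' (i v)"
proof -
  have "(u, v) \<in> before (rooted (base F) (branches F))"
    using rank_less_iff[OF G.distinct] assms by (simp add: G.verts)
  from rank_less[OF G'.distinct before_i[OF this]] show ?thesis .
qed

lemma rank_top_le:
  assumes "v \<in> V G'"
  shows "vertex_rank F' (i (f v)) \<le> vertex_rank F' v"
  using top_before[of v] rank_less[OF G'.distinct, of "i (f v)" v] assms by (auto simp: G'.verts)

lemma key_pos_lift_mono:
  assumes "\<kappa> \<in> keys F" "\<mu> \<in> keys F" "key_pos F \<kappa> < key_pos F \<mu>"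
  shows "key_pos F' (lift_key \<kappa>) < key_pos F' (lift_key \<mu>)"
proof -
  let ?r = "vertex_rank F" and ?r' = "vertex_rank F'"
  have cases: "(\<exists>v\<in>V G. \<kappa> = Inl v \<and> key_pos F \<kappa> = surplus F + 2 * ?r v \<and>
        key_pos F' (lift_key \<kappa>) = surplus F + 2 * ?r' (i v)) \<or>
      (\<exists>v\<in>V G. \<kappa> = Inr (Inl v) \<and> key_pos F \<kappa> = surplus F + 2 * ?r v + 1 \<and>
        key_pos F' (lift_key \<kappa>) = surplus F + 2 * ?r' (i v) + 1) \<or>
      (key_pos F \<kappa> < surplus F \<and> key_pos F' (lift_key \<kappa>) = key_pos F \<kappa>)" if "\<kappa> \<in> keys F" for \<kappa>
    using that by (auto simp: keys_def names_def G.verts surplus_eq)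
  have less: "?r' (i u) < ?r' (i v)" if "u \<in> V G" "v \<in> V G" "?r u < ?r v" for u v
    using rank_i_less that by blast
  have le: "?r' (i u) \<le> ?r' (i v)" if "u \<in> V G" "v \<in> V G" "?r u \<le> ?r v" for u v
    using rank_i_less[of u v] rank_inj[OF G.distinct, of u v] that
    by (cases "?r u = ?r v") (auto simp: G.verts)
  from cases[OF assms(1)] cases[OF assms(2)] show ?thesis
  proof (elim disjE bexE conjE)
    fix u v assume "u \<in> V G" "v \<in> V G"
      "key_pos F \<kappa> = surplus F + 2 * ?r u" "key_pos F' (lift_key \<kappa>) = surplus F + 2 * ?r' (i u)"
      "key_pos F \<mu> = surplus F + 2 * ?r v" "key_pos F' (lift_key \<mu>) = surplus F + 2 * ?r' (i v)"
    with less[of u v] assms(3) show ?thesis by linarith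
  next
    fix u v assume "u \<in> V G" "v \<in> V G"
      "key_pos F \<kappa> = surplus F + 2 * ?r u" "key_pos F' (lift_key \<kappa>) = surplus F + 2 * ?r' (i u)"
      "key_pos F \<mu> = surplus F + 2 * ?r v + 1" "key_pos F' (lift_key \<mu>) = surplus F + 2 * ?r' (i v) + 1"
    with le[of u v] assms(3) show ?thesis by linarith
  next
    fix u v assume "u \<in> V G" "v \<in> V G"
      "key_pos F \<kappa> = surplus F + 2 * ?r u + 1" "key_pos F' (lift_key \<kappa>) = surplus F + 2 * ?r' (i u) + 1"
      "key_pos F \<mu> = surplus F + 2 * ?r v" "key_pos F' (lift_key \<mu>) = surplus F + 2 * ?r' (i v)"
    with less[of u v] assms(3) show ?thesis by linarith
  next
    fix u v assume "u \<in> V G" "v \<in> V G"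
      "key_pos F \<kappa> = surplus F + 2 * ?r u + 1" "key_pos F' (lift_key \<kappa>) = surplus F + 2 * ?r' (i u) + 1"
      "key_pos F \<mu> = surplus F + 2 * ?r v + 1" "key_pos F' (lift_key \<mu>) = surplus F + 2 * ?r' (i v) + 1"
    with less[of u v] assms(3) show ?thesis by linarith
  qed (use assms(3) in linarith)+
qed

text \<open>
  Every key is mapped like a lifted key that is not read later: the first element of its fibre. For
  a contracted branch this is the top vertex of the fibre.
\<close>

lemma key_representative:
  assumes "\<kappa> \<in> keys F'"
  shows "\<exists>\<mu>\<in>keys F. cmap (key_elt F' \<kappa>) = key_elt F \<mu> \<and> key_pos F' (lift_key \<mu>) \<le> key_pos F' \<kappa>"
proof -
  from assms consider v where "v \<in> V G'" "\<kappa> = Inl v" | v where "v \<in> N'" "\<kappa> = Inr (Inl v)"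
    | k where "k < surplus F" "\<kappa> = Inr (Inr k)"
    by (auto simp: keys_def names_def G'.verts surplus_eq)
  then show ?thesis
  proof cases
    case 1
    then show ?thesis using rank_top_le[OF 1(1)] f_in'[OF 1(1)]
      by (intro bexI[of _ "Inl (f v)"]) (auto simp: keys_def G.verts)
  next
    case 2
    have v: "v \<in> V G'" using 2(1) by (simp add: G'.verts)
    show ?thesis
    proof (cases "v \<in> i ` N")
      case True
      then obtain u where u: "u \<in> N" "v = i u" by blast
      then have k: "Inr (Inl u) \<in> keys F" by (auto simp: keys_def names_def)
      with cmap_lift_key[OF k] 2(2) u(2) show ?thesis by (intro bexI[of _ "Inr (Inl u)"]) simp_all
    next
      case False
      have "cmap (Arrow (arr F' (Inl v))) = Vert (f v)" by (rule contracted_arc(1)[OF 2(1) False])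
      then show ?thesis using rank_top_le[OF v] f_in'[OF v] 2(2)
        by (intro bexI[of _ "Inl (f v)"]) (auto simp: keys_def G.verts)
    qed
  next
    case 3
    then have k: "\<kappa> = lift_key (Inr (Inr k))" "Inr (Inr k) \<in> keys F"
      by (auto simp: keys_def names_def)
    with cmap_lift_key[OF k(2)] show ?thesis by (intro bexI[OF _ k(2)]) simp
  qed
qed

text \<open>
  Let \<open>\<kappa>\<close> be the first key at which the two maps differ. Their composites differ at \<open>lift_key \<kappa>\<close>, and
  they agree at any key that is read earlier, because its representative in \<open>G\<close> is read before \<open>\<kappa>\<close>.
\<close>

lemma lex_less_compose:
  assumes "lex_less c F \<psi>1 \<psi>2"
  shows "lex_less c F' (compose (elts G') \<psi>1 cmap) (compose (elts G') \<psi>2 cmap)"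
proof -
  obtain \<kappa> where k: "\<kappa> \<in> keys F" "c (\<psi>1 (key_elt F \<kappa>)) < c (\<psi>2 (key_elt F \<kappa>))"
    "\<And>\<kappa>'. \<kappa>' \<in> keys F \<Longrightarrow> key_pos F \<kappa>' < key_pos F \<kappa> \<Longrightarrow> \<psi>1 (key_elt F \<kappa>') = \<psi>2 (key_elt F \<kappa>')"
    using assms unfolding lex_less_def by blast
  have comp: "compose (elts G') \<psi> cmap (key_elt F' \<mu>) = \<psi> (cmap (key_elt F' \<mu>))"
    if "\<mu> \<in> keys F'" for \<mu> and \<psi> :: "('v, 'a) elt \<Rightarrow> 'd"
    using G'.key_elt_in[OF that] by (simp add: compose_def)
  show ?thesis
    unfolding lex_less_def
  proof (intro bexI[of _ "lift_key \<kappa>"] conjI ballI impI)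
    show lk: "lift_key \<kappa> \<in> keys F'" by (rule lift_key_in[OF k(1)])
    show "c (compose (elts G') \<psi>1 cmap (key_elt F' (lift_key \<kappa>))) <
        c (compose (elts G') \<psi>2 cmap (key_elt F' (lift_key \<kappa>)))"
      using k(2) by (simp add: comp[OF lk] cmap_lift_key[OF k(1)])
    fix \<mu>' assume m': "\<mu>' \<in> keys F'" "key_pos F' \<mu>' < key_pos F' (lift_key \<kappa>)"
    obtain \<mu> where m: "\<mu> \<in> keys F" "cmap (key_elt F' \<mu>') = key_elt F \<mu>"
      "key_pos F' (lift_key \<mu>) \<le> key_pos F' \<mu>'"
      using key_representative[OF m'(1)] by blast
    have "key_pos F \<mu> < key_pos F \<kappa>"
    proof (rule ccontr)
      assume "\<not> ?thesis"
      then consider "key_pos F \<kappa> < key_pos F \<mu>" | "\<kappa> = \<mu>"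
        using inj_onD[OF G.key_pos_inj _ k(1) m(1)] by linarith
      then show False
        using key_pos_lift_mono[OF k(1) m(1)] m(3) m'(2) by cases auto
    qed
    from k(3)[OF m(1) this]
    show "compose (elts G') \<psi>1 cmap (key_elt F' \<mu>') = compose (elts G') \<psi>2 cmap (key_elt F' \<mu>')"
      by (simp add: comp[OF m'(1)] m(2))
  qed
qed

end

definition graph_frame :: "('v, 'a) ugraph \<Rightarrow> ('v, 'a) frame" where
  "graph_frame G = (SOME F. framed_graph G F)"

lemma framed_graph_frame:
  assumes "G \<in> graphs_genus_le g"
  shows "framed_graph G (graph_frame G)"
  unfolding graph_frame_def
  by (rule someI_ex) (use assms framed_graph_exists in \<open>auto simp: graphs_genus_le_def\<close>)

lemma surplus_le_genus:
  assumes "G \<in> graphs_genus_le g"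
  shows "surplus (graph_frame G) \<le> g"
  using framed_graph.genus_eq[OF framed_graph_frame[OF assms]] assms
  by (simp add: graphs_genus_le_def)

definition ordered_pullback :: "(('w, 'b) elt \<Rightarrow> nat) \<Rightarrow> ('v, 'a) ugraph \<Rightarrow> ('u, 'c) ugraph \<Rightarrow>
    (('u, 'c) elt \<Rightarrow> ('v, 'a) elt) \<Rightarrow> bool" where
  "ordered_pullback c G G' f \<longleftrightarrow> minor_morphism G' G f \<and>
     (\<forall>\<phi> \<psi>. lex_less c (graph_frame G) \<phi> \<psi> \<longrightarrow>
        lex_less c (graph_frame G') (compose (elts G') \<phi> f) (compose (elts G') \<psi> f))"

text \<open>
  All data of a minor morphism other than the labelled tree are of finitely many kinds and can be
  assumed constant along the sequence. Kruskal's theorem then gives an embedding of labelled trees.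
\<close>

lemma almost_full_ordered_pullback:
  fixes Hf :: "'j \<Rightarrow> ('w, 'b) ugraph" and c :: "('w, 'b) elt \<Rightarrow> nat" and g :: nat
  assumes J: "finite J" and Hf: "\<And>j. j \<in> J \<Longrightarrow> is_graph (Hf j)"
  shows "almost_full_on
    (\<lambda>(G, j, \<phi>) (G', j', \<phi>'). j = j' \<and>
       (\<exists>f. ordered_pullback c G G' f \<and> \<phi>' = compose (elts G') \<phi> f))
    {(G :: ('v, 'a) ugraph, j, \<phi>). G \<in> graphs_genus_le g \<and> j \<in> J \<and> minor_morphism G (Hf j) \<phi>}"
  unfolding almost_full_on_def
proof (intro allI impI)
  fix s :: "nat \<Rightarrow> ('v, 'a) ugraph \<times> 'j \<times> (('v, 'a) elt \<Rightarrow> ('w, 'b) elt)"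
  assume s: "\<forall>n. s n \<in> {(G, j, \<phi>). G \<in> graphs_genus_le g \<and> j \<in> J \<and> minor_morphism G (Hf j) \<phi>}"
  define G where "G n = fst (s n)" for n
  define j where "j n = fst (snd (s n))" for n
  define \<phi> where "\<phi> n = snd (snd (s n))" for n
  define F where "F n = graph_frame (G n)" for n
  have G: "G n \<in> graphs_genus_le g" and j: "j n \<in> J" and \<phi>: "minor_morphism (G n) (Hf (j n)) (\<phi> n)" for n
    using s[rule_format, of n] by (auto simp: G_def j_def \<phi>_def)
  have sn: "s n = (G n, j n, \<phi> n)" for n by (simp add: G_def j_def \<phi>_def)
  have F: "framed_graph (G n) (F n)" for n
    unfolding F_def by (rule framed_graph_frame[OF G])
  have sur: "surplus (F n) \<le> g" for n unfolding F_def by (rule surplus_le_genus[OF G])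
  define E where "E = (\<Union>j\<in>J. elts (Hf j))"
  have finE: "finite E" using J Hf finite_elts unfolding E_def by blast
  have \<phi>E: "\<phi> n e \<in> E" if "e \<in> elts (G n)" for n e
    using PiE_mem[OF minor_morphismD(1)[OF \<phi>] that] j[of n] by (auto simp: E_def)
  \<comment> \<open>A common bound for the numbers of uncontracted branches.\<close>
  define B where "B = g + (\<Sum>j\<in>J. card (V (Hf j)))"
  define W where "W = E \<times> (Pow {..<g} \<times> Pow {..<g})"
  have finW: "finite W" using finE by (simp add: W_def)
  have slots_in: "slots (G n) (F n) v \<in> Pow {..<g} \<times> Pow {..<g}" for n v
    using sur[of n] by (auto simp: slots_def)
  have W: "vertex_label (G n) (F n) (\<phi> n) v \<in> W" if "v \<in> V (G n)" for n v
    using \<phi>E[of "Vert v" n] that slots_in[of n v] by (simp add: vertex_label_def W_def)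
  define data where "data n = (j n, map (\<lambda>k. \<phi> n (Arrow (arr (F n) (Inr k)))) [0..<surplus (F n)],
    vertex_label (G n) (F n) (\<phi> n) (base (F n)), card (uncontracted (F n) (\<phi> n)))" for n
  have "range data \<subseteq> J \<times> {xs. set xs \<subseteq> E \<and> length xs \<le> g} \<times> W \<times> {..B}"
  proof
    fix x assume "x \<in> range data"
    then obtain n where n: "x = data n" by blast
    interpret framed_graph "G n" "F n" by (rule F)
    have "base (F n) \<in> V (G n)" by (simp add: verts)
    moreover have "card (uncontracted (F n) (\<phi> n)) \<le> B"
    proof -
      have "card (uncontracted (F n) (\<phi> n)) \<le> surplus (F n) + card (V (Hf (j n)))"
        by (rule card_uncontracted[OF \<phi> Hf[OF j]])
      moreover have "card (V (Hf (j n))) \<le> (\<Sum>j\<in>J. card (V (Hf j)))"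
        by (rule member_le_sum[OF j]) (use J in auto)
      ultimately show ?thesis using sur[of n] by (simp add: B_def)
    qed
    moreover have "\<phi> n (Arrow (arr (F n) (Inr k))) \<in> E" if "k < surplus (F n)" for k
      by (rule \<phi>E) (use that in \<open>simp add: names_def\<close>)
    ultimately show "x \<in> J \<times> {xs. set xs \<subseteq> E \<and> length xs \<le> g} \<times> W \<times> {..B}"
      using j[of n] W[of "base (F n)" n] sur[of n] by (auto simp: n data_def)
  qed
  moreover have "finite (J \<times> {xs. set xs \<subseteq> E \<and> length xs \<le> g} \<times> W \<times> {..B})"
    using J finW finite_lists_length_le[OF finE, of g] by (intro finite_cartesian_product) auto
  ultimately have "finite (range data)" using finite_subset by blast
  from pigeonhole_subsequence[OF this]
  obtain r :: "nat \<Rightarrow> nat" where r: "strict_mono r" "\<forall>m n. data (r m) = data (r n)"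
    by (elim exE conjE) (rule that)
  define tr where "tr n = map_plane_forest (branch_label (G n) (F n) (\<phi> n)) (branches (F n))" for n
  have tr: "tr n \<in> {t. nodes t \<subseteq> W \<times> E}" for n
  proof -
    interpret framed_graph "G n" "F n" by (rule F)
    have "branch_label (G n) (F n) (\<phi> n) v \<in> W \<times> E" if "v \<in> nodes (branches (F n))" for v
      using W[of v n] \<phi>E[of "Arrow (arr (F n) (Inl v))" n] that
      by (simp add: branch_label_def verts names_def)
    then have "branch_label (G n) (F n) (\<phi> n) ` nodes (branches (F n)) \<subseteq> W \<times> E"
      by (rule image_subsetI)
    then show ?thesis by (simp add: tr_def plane_forest.set_map)
  qed
  have "finite (W \<times> E)" using finW finE by simp
  from almost_full_onD[OF almost_full_forest_emb[OF this], where s = "\<lambda>n. tr (r n)", OF tr]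
  obtain m n where mn: "m < n" "forest_emb (tr (r m)) (tr (r n))"
    by (elim exE conjE) (rule that)
  let ?m = "r m" and ?n = "r n"
  interpret m: framed_graph "G ?m" "F ?m" by (rule F)
  interpret n: framed_graph "G ?n" "F ?n" by (rule F)
  from contraction_exists[OF mn(2)[unfolded tr_def] m.distinct n.distinct]
  obtain f i where con: "contraction (branch_label (G ?m) (F ?m) (\<phi> ?m))
     (branch_label (G ?n) (F ?n) (\<phi> ?n)) (base (F ?m)) (branches (F ?m)) (base (F ?n)) (branches (F ?n)) f i"
    by (elim exE) (rule that)
  have d: "data ?n = data ?m" using r(2) by blast
  then have jj: "j ?n = j ?m" by (simp add: data_def)
  have maps: "map (\<lambda>k. \<phi> ?n (Arrow (arr (F ?n) (Inr k)))) [0..<surplus (F ?n)] =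
      map (\<lambda>k. \<phi> ?m (Arrow (arr (F ?m) (Inr k)))) [0..<surplus (F ?m)]"
    using d by (simp add: data_def)
  from arg_cong[OF maps, of length] have su: "surplus (F ?n) = surplus (F ?m)"
    by simp
  have "frame_contraction (G ?m) (F ?m) (G ?n) (F ?n) (\<phi> ?m) (\<phi> ?n) f i (Hf (j ?m))"
  proof (intro frame_contraction.intro frame_contraction_axioms.intro)
    show "minor_morphism (G ?m) (Hf (j ?m)) (\<phi> ?m)" by (rule \<phi>)
    show "minor_morphism (G ?n) (Hf (j ?m)) (\<phi> ?n)" using \<phi>[of ?n] jj by simp
    show "surplus (F ?n) = surplus (F ?m)" by (rule su)
    show "\<phi> ?n (Arrow (arr (F ?n) (Inr k))) = \<phi> ?m (Arrow (arr (F ?m) (Inr k)))"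
      if "k < surplus (F ?m)" for k
      using maps that by (simp add: su)
    show "vertex_label (G ?n) (F ?n) (\<phi> ?n) (base (F ?n)) =
        vertex_label (G ?m) (F ?m) (\<phi> ?m) (base (F ?m))"
      "card (uncontracted (F ?n) (\<phi> ?n)) = card (uncontracted (F ?m) (\<phi> ?m))"
      using d by (simp_all add: data_def)
  qed (rule F con)+
  then interpret C: frame_contraction "G ?m" "F ?m" "G ?n" "F ?n" "\<phi> ?m" "\<phi> ?n" f i "Hf (j ?m)" .
  have "ordered_pullback c (G ?m) (G ?n) C.cmap"
    unfolding ordered_pullback_def F_def[symmetric]
    by (intro conjI allI impI C.minor_morphism_cmap C.lex_less_compose)
  moreover have "\<phi> ?n = compose (elts (G ?n)) (\<phi> ?m) C.cmap" by (rule C.factor)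
  moreover have "?m < ?n" using r(1) mn(1) by (simp add: strict_mono_def)
  ultimately show "\<exists>m n. m < n \<and> (case s m of (G, j, \<phi>) \<Rightarrow> \<lambda>(G', j', \<phi>'). j = j' \<and>
       (\<exists>f. ordered_pullback c G G' f \<and> \<phi>' = compose (elts G') \<phi> f)) (s n)"
    using jj by (intro exI[of _ ?m] exI[of _ ?n]) (auto simp: sn)
qed


section \<open>Submodules of left modules\<close>

text \<open>
  The library's locale of modules assumes a commutative ring; these are the same axioms over any ring.
\<close>

locale lmodule =
  fixes R :: "('r, 'e) ring_scheme" and M :: "('r, 'm, 'f) module_scheme" (structure)
  assumes left_module: "left_module R M"
begin

sublocale R: ring R using left_module by (simp add: left_module_def)
sublocale M: abelian_group M using left_module by (simp add: left_module_def)

lemma smult_closed [simp, intro]: "a \<in> carrier R \<Longrightarrow> x \<in> carrier M \<Longrightarrow> a \<odot> x \<in> carrier M"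
  and smult_l_distr: "a \<in> carrier R \<Longrightarrow> b \<in> carrier R \<Longrightarrow> x \<in> carrier M \<Longrightarrow>
     (a \<oplus>\<^bsub>R\<^esub> b) \<odot> x = a \<odot> x \<oplus> b \<odot> x"
  and smult_r_distr: "a \<in> carrier R \<Longrightarrow> x \<in> carrier M \<Longrightarrow> y \<in> carrier M \<Longrightarrow>
     a \<odot> (x \<oplus> y) = a \<odot> x \<oplus> a \<odot> y"
  and smult_assoc: "a \<in> carrier R \<Longrightarrow> b \<in> carrier R \<Longrightarrow> x \<in> carrier M \<Longrightarrow>
     (a \<otimes>\<^bsub>R\<^esub> b) \<odot> x = a \<odot> (b \<odot> x)"
  and smult_one [simp]: "x \<in> carrier M \<Longrightarrow> \<one>\<^bsub>R\<^esub> \<odot> x = x"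
  using left_module by (simp_all add: left_module_def module_axioms_def)

lemma smult_zero: "x \<in> carrier M \<Longrightarrow> \<zero>\<^bsub>R\<^esub> \<odot> x = \<zero>"
  using smult_l_distr[of "\<zero>\<^bsub>R\<^esub>" "\<zero>\<^bsub>R\<^esub>" x] M.add.r_cancel_one'[of "\<zero>\<^bsub>R\<^esub> \<odot> x" "\<zero>\<^bsub>R\<^esub> \<odot> x"]
  by simp

lemma smult_minus_one:
  assumes x: "x \<in> carrier M"
  shows "(\<ominus>\<^bsub>R\<^esub> \<one>\<^bsub>R\<^esub>) \<odot> x = \<ominus> x"
proof -
  have "(\<ominus>\<^bsub>R\<^esub> \<one>\<^bsub>R\<^esub>) \<odot> x \<oplus> x = \<zero>"
    using smult_l_distr[of "\<ominus>\<^bsub>R\<^esub> \<one>\<^bsub>R\<^esub>" "\<one>\<^bsub>R\<^esub>" x] x by (simp add: R.l_neg smult_zero)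
  then show ?thesis using x by (metis M.minus_equality R.a_inv_closed R.one_closed smult_closed)
qed

lemma submodule_closed:
  assumes "submodule P R M"
  shows "P \<subseteq> carrier M" "\<zero> \<in> P" "x \<in> P \<Longrightarrow> y \<in> P \<Longrightarrow> x \<oplus> y \<in> P"
    "a \<in> carrier R \<Longrightarrow> x \<in> P \<Longrightarrow> a \<odot> x \<in> P" "x \<in> P \<Longrightarrow> y \<in> P \<Longrightarrow> x \<ominus> y \<in> P"
proof -
  have s: "subgroup P (add_monoid M)" using assms by (rule submodule.axioms)
  show sub: "P \<subseteq> carrier M" using subgroup.subset[OF s] by simp
  show "\<zero> \<in> P" using subgroup.one_closed[OF s] by simp
  show add: "x \<oplus> y \<in> P" if "x \<in> P" "y \<in> P" for x y
    using subgroup.m_closed[OF s that] by simp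
  show smult: "a \<odot> x \<in> P" if "a \<in> carrier R" "x \<in> P" for a x
    using submodule.smult_closed[OF assms that] .
  show "x \<ominus> y \<in> P" if "x \<in> P" "y \<in> P" for x y
    using add[OF that(1) smult[of "\<ominus>\<^bsub>R\<^esub> \<one>\<^bsub>R\<^esub>" y]] that(2) sub
    by (simp add: smult_minus_one subsetD a_minus_def)
qed

lemma submoduleI:
  assumes "P \<subseteq> carrier M" "\<zero> \<in> P" "\<And>x y. x \<in> P \<Longrightarrow> y \<in> P \<Longrightarrow> x \<oplus> y \<in> P"
    and smult: "\<And>a x. a \<in> carrier R \<Longrightarrow> x \<in> P \<Longrightarrow> a \<odot> x \<in> P"
  shows "submodule P R M"
proof (intro submodule.intro submodule_axioms.intro)
  show "subgroup P (add_monoid M)"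
  proof (rule M.add.subgroupI)
    show "\<ominus> x \<in> P" if "x \<in> P" for x
      using smult[OF _ that, of "\<ominus>\<^bsub>R\<^esub> \<one>\<^bsub>R\<^esub>"] smult_minus_one[of x] assms(1) that by auto
  qed (use assms in auto)
qed (rule smult)

lemma submodule_carrier: "submodule (carrier M) R M"
  by (rule submoduleI) auto

lemma submodule_lspan:
  assumes "S \<subseteq> carrier M"
  shows "submodule (lspan R M S) R M"
proof (rule submoduleI)
  have eq: "x \<in> lspan R M S \<longleftrightarrow> (\<forall>P. submodule P R M \<and> S \<subseteq> P \<longrightarrow> x \<in> P)" for x
    by (auto simp: lspan_def hull_def)
  show "lspan R M S \<subseteq> carrier M" using eq submodule_carrier assms by blast
  show "\<zero> \<in> lspan R M S" using eq submodule_closed(2) by blast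
  show "x \<oplus> y \<in> lspan R M S" if "x \<in> lspan R M S" "y \<in> lspan R M S" for x y
    using that eq submodule_closed(3) by blast
  show "a \<odot> x \<in> lspan R M S" if "a \<in> carrier R" "x \<in> lspan R M S" for a x
    using that eq submodule_closed(4) by blast
qed

lemma lspan_minimal: "S \<subseteq> P \<Longrightarrow> submodule P R M \<Longrightarrow> lspan R M S \<subseteq> P"
  unfolding lspan_def by (rule hull_minimal)

end

lemma subset_lspan: "S \<subseteq> lspan R M S"
  unfolding lspan_def by (rule hull_subset)

lemma lspan_mono: "S \<subseteq> T \<Longrightarrow> lspan R M S \<subseteq> lspan R M T"
  unfolding lspan_def by (rule hull_mono)

lemma image_lspan:
  assumes M: "left_module R M" and M': "left_module R M'" and f: "linear_map R M M' f"
    and S: "S \<subseteq> carrier M"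
  shows "f ` lspan R M S \<subseteq> lspan R M' (f ` S)"
proof -
  interpret M: lmodule R M by (rule lmodule.intro[OF M])
  interpret M': lmodule R M' by (rule lmodule.intro[OF M'])
  have fin: "f x \<in> carrier M'" if "x \<in> carrier M" for x
    using f that by (auto simp: linear_map_def hom_def)
  have add: "f (x \<oplus>\<^bsub>M\<^esub> y) = f x \<oplus>\<^bsub>M'\<^esub> f y" if "x \<in> carrier M" "y \<in> carrier M" for x y
    using f that by (auto simp: linear_map_def hom_def)
  have smult: "f (a \<odot>\<^bsub>M\<^esub> x) = a \<odot>\<^bsub>M'\<^esub> f x" if "a \<in> carrier R" "x \<in> carrier M" for a x
    using f that by (auto simp: linear_map_def)
  have zero: "f \<zero>\<^bsub>M\<^esub> = \<zero>\<^bsub>M'\<^esub>"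
    using smult[of "\<zero>\<^bsub>R\<^esub>" "\<zero>\<^bsub>M\<^esub>"] M.smult_zero M'.smult_zero fin by simp
  have S': "submodule (lspan R M' (f ` S)) R M'"
    by (rule M'.submodule_lspan) (use S fin in auto)
  note c = M'.submodule_closed[OF S']
  have "submodule {x \<in> carrier M. f x \<in> lspan R M' (f ` S)} R M"
    by (rule M.submoduleI) (auto simp: zero add smult c)
  moreover have "S \<subseteq> {x \<in> carrier M. f x \<in> lspan R M' (f ` S)}"
    using S subset_lspan[of "f ` S" R M'] by auto
  ultimately show ?thesis using M.lspan_minimal by blast
qed

lemma lmodule_regular:
  assumes "ring R"
  shows "lmodule R (regular_module R)"
proof -
  interpret ring R by fact
  have "abelian_group (regular_module R)"
  proof (rule abelian_groupI)
    fix x assume "x \<in> carrier (regular_module R)"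
    then show "\<exists>y\<in>carrier (regular_module R). y \<oplus>\<^bsub>regular_module R\<^esub> x = \<zero>\<^bsub>regular_module R\<^esub>"
      by (intro bexI[of _ "\<ominus>\<^bsub>R\<^esub> x"]) (simp_all add: regular_module_def l_neg)
  qed (simp_all add: regular_module_def a_ac)
  then show ?thesis
    by (auto simp: lmodule_def left_module_def module_axioms_def regular_module_def ring_axioms
      l_distr r_distr m_assoc)
qed

text \<open>
  Finitely many generators of the union already lie in one member of the chain.
\<close>

lemma left_noetherian_chain:
  fixes I :: "nat \<Rightarrow> 'r set"
  assumes R: "left_noetherian R"
    and I: "\<And>n. submodule (I n) R (regular_module R)" and mono: "\<And>n. I n \<subseteq> I (Suc n)"
  shows "\<exists>n. I (Suc n) = I n"
proof -
  interpret L: lmodule R "regular_module R"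
    using R by (intro lmodule_regular) (simp add: left_noetherian_def)
  note c = L.submodule_closed[OF I]
  have le: "I m \<subseteq> I n" if "m \<le> n" for m n
    using lift_Suc_mono_le[of I, OF mono that] .
  have "submodule (\<Union>n. I n) R (regular_module R)"
  proof (rule L.submoduleI)
    fix x y assume "x \<in> (\<Union>n. I n)" "y \<in> (\<Union>n. I n)"
    then obtain m n where "x \<in> I m" "y \<in> I n" by blast
    then have "x \<in> I (max m n)" "y \<in> I (max m n)" using le[of m "max m n"] le[of n "max m n"] by auto
    then show "x \<oplus>\<^bsub>regular_module R\<^esub> y \<in> (\<Union>n. I n)" using c(3) by blast
  next
    show "(\<Union>n. I n) \<subseteq> carrier (regular_module R)" using c(1) by (rule UN_least)
    show "\<zero>\<^bsub>regular_module R\<^esub> \<in> (\<Union>n. I n)" using c(2)[of 0] by (rule UN_I[OF UNIV_I])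
    show "a \<odot>\<^bsub>regular_module R\<^esub> x \<in> (\<Union>n. I n)"
      if a: "a \<in> carrier R" and x: "x \<in> (\<Union>n. I n)" for a x
    proof -
      obtain n where "x \<in> I n" using x by (rule UN_E)
      from c(4)[OF a this] show ?thesis by (rule UN_I[OF UNIV_I])
    qed
  qed
  moreover have "\<forall>K. submodule K R (regular_module R) \<longrightarrow>
      (\<exists>S\<subseteq>carrier R. finite S \<and> K = lspan R (regular_module R) S)"
    using R by (simp add: left_noetherian_def)
  ultimately have "\<exists>S\<subseteq>carrier R. finite S \<and> (\<Union>n. I n) = lspan R (regular_module R) S"
    by (elim allE impE)
  then obtain S where S: "finite S" "(\<Union>n. I n) = lspan R (regular_module R) S"
    by blast
  have SI: "S \<subseteq> (\<Union>n. I n)" unfolding S(2) by (rule subset_lspan)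
  have "\<exists>n. S \<subseteq> I n"
    using S(1) SI
  proof (induction S rule: finite_induct)
    case (insert x T)
    then obtain m n where "T \<subseteq> I m" "x \<in> I n" by auto
    then have "insert x T \<subseteq> I (max m n)" using le[of m "max m n"] le[of n "max m n"] by auto
    then show ?case by blast
  qed simp
  then obtain n where n: "S \<subseteq> I n" by blast
  then have "(\<Union>n. I n) \<subseteq> I n" using L.lspan_minimal[OF _ I] S(2) by simp
  then have "I (Suc n) \<subseteq> I n" by blast
  with mono[of n] show ?thesis by blast
qed

text \<open>
  The coefficients of \<open>x\<close> in those elements of \<open>P\<close> that are multiples of \<open>x\<close> up to an element of \<open>U\<close>. In
  the applications \<open>x\<close> is one of the generators, and \<open>U\<close> is spanned by the smaller ones. Since only
  the submodule \<open>U\<close> enters, relations between the generators do no harm.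
\<close>

definition leading ::
  "('r, 'e) ring_scheme \<Rightarrow> ('r, 'm, 'f) module_scheme \<Rightarrow> 'm set \<Rightarrow> 'm \<Rightarrow> 'm set \<Rightarrow> 'r set" where
  "leading R M P x U = {a \<in> carrier R. \<exists>u\<in>U. a \<odot>\<^bsub>M\<^esub> x \<oplus>\<^bsub>M\<^esub> u \<in> P}"

context lmodule
begin

lemma submodule_leading:
  assumes P: "submodule P R M" and U: "submodule U R M" and x: "x \<in> carrier M"
  shows "submodule (leading R M P x U) R (regular_module R)"
proof -
  interpret L: lmodule R "regular_module R" by (rule lmodule_regular) unfold_locales
  note p = submodule_closed[OF P] and u = submodule_closed[OF U]
  have Uc: "v \<in> carrier M" if "v \<in> U" for v using that u(1) by blast
  have reg: "carrier (regular_module R) = carrier R" "add (regular_module R) = add R"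
    "zero (regular_module R) = zero R" "smult (regular_module R) = mult R"
    by (simp_all add: regular_module_def)
  show ?thesis
  proof (rule L.submoduleI, unfold reg)
    show "leading R M P x U \<subseteq> carrier R" by (auto simp: leading_def)
    show "\<zero>\<^bsub>R\<^esub> \<in> leading R M P x U"
      using u(2) p(2) x by (auto simp: leading_def smult_zero intro!: bexI[of _ "\<zero>"])
    fix a assume "a \<in> leading R M P x U"
    then obtain v where a: "a \<in> carrier R" "v \<in> U" "a \<odot> x \<oplus> v \<in> P" by (auto simp: leading_def)
    show "a \<oplus>\<^bsub>R\<^esub> b \<in> leading R M P x U" if "b \<in> leading R M P x U" for b
    proof -
      obtain w where b: "b \<in> carrier R" "w \<in> U" "b \<odot> x \<oplus> w \<in> P"
        using \<open>b \<in> _\<close> by (auto simp: leading_def)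
      have "(a \<oplus>\<^bsub>R\<^esub> b) \<odot> x \<oplus> (v \<oplus> w) = (a \<odot> x \<oplus> v) \<oplus> (b \<odot> x \<oplus> w)"
        using a b x Uc by (simp add: smult_l_distr M.a_ac)
      with a b p(3)[OF a(3) b(3)] u(3)[OF a(2) b(2)] show ?thesis
        by (auto simp: leading_def intro!: bexI[of _ "v \<oplus> w"])
    qed
    show "b \<otimes>\<^bsub>R\<^esub> a \<in> leading R M P x U" if b: "b \<in> carrier R" for b
    proof -
      have "(b \<otimes>\<^bsub>R\<^esub> a) \<odot> x \<oplus> b \<odot> v = b \<odot> (a \<odot> x \<oplus> v)"
        using a b x Uc by (simp add: smult_assoc smult_r_distr)
      with a b p(4)[OF b a(3)] u(4)[OF b a(2)] show ?thesis
        by (auto simp: leading_def intro!: bexI[of _ "b \<odot> v"])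
    qed
  qed
qed

text \<open>
  Reduction by leading terms: if \<open>x \<in> N\<close> has the leading coefficient \<open>a\<close> at \<open>e b\<close>, then some element of
  \<open>P\<close> has the same leading coefficient there, and the difference lies in \<open>N\<close> and in the span of the
  generators before \<open>b\<close>.
\<close>

lemma subset_by_leading:
  fixes rk :: "'b \<Rightarrow> nat" and e :: "'b \<Rightarrow> 'm"
  assumes P: "submodule P R M" and N: "submodule N R M" and PN: "P \<subseteq> N"
    and B: "finite B" and rk: "inj_on rk B" and e: "e ` B \<subseteq> carrier M"
    and span: "N \<subseteq> lspan R M (e ` B)"
    and lead: "\<And>b. b \<in> B \<Longrightarrow>
      leading R M N (e b) (lspan R M (e ` {b'\<in>B. rk b' < rk b})) \<subseteq>
      leading R M P (e b) (lspan R M (e ` {b'\<in>B. rk b' < rk b}))"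
  shows "N \<subseteq> P"
proof -
  define U where "U n = lspan R M (e ` {b\<in>B. rk b < n})" for n
  have U: "submodule (U n) R M" for n
    unfolding U_def by (rule submodule_lspan) (use e in auto)
  note p = submodule_closed[OF P] and nn = submodule_closed[OF N]
  have step: "N \<inter> U n \<subseteq> P" for n
  proof (induction n)
    case 0
    have "submodule {\<zero>} R M" 
    proof (rule submoduleI)
      show "a \<odot> x \<in> {\<zero>}" if "a \<in> carrier R" "x \<in> {\<zero>}" for a x
        using smult_assoc[of a "\<zero>\<^bsub>R\<^esub>" "\<zero>"] that by (simp add: smult_zero)
    qed auto
    from lspan_minimal[OF _ this, of "{}"] have "U 0 \<subseteq> {\<zero>}" by (simp add: U_def)
    with p(2) show ?case by blast
  next
    case (Suc n)
    show ?case
    proof (cases "\<exists>b\<in>B. rk b = n")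
      case False
      then have "{b\<in>B. rk b < Suc n} = {b\<in>B. rk b < n}" using less_Suc_eq by auto
      with Suc show ?thesis by (simp add: U_def)
    next
      case True
      then obtain b where b: "b \<in> B" "rk b = n" by blast
      have eb: "e b \<in> carrier M" using e b(1) by blast
      have set: "{b'\<in>B. rk b' < Suc n} = insert b {b'\<in>B. rk b' < n}"
        using b inj_onD[OF rk] by (auto simp: less_Suc_eq)
      note u = submodule_closed[OF U[of n]]
      have Uc: "v \<in> carrier M" if "v \<in> U n" for v using that u(1) by blast
      have "submodule {a \<odot> e b \<oplus> v |a v. a \<in> carrier R \<and> v \<in> U n} R M" (is "submodule ?K R M")
      proof (rule submoduleI)
        show "?K \<subseteq> carrier M" using eb Uc by auto
        show "\<zero> \<in> ?K" using u(2) eb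
          by (intro CollectI exI[of _ "\<zero>\<^bsub>R\<^esub>"] exI[of _ "\<zero>"]) (simp add: smult_zero)
        fix x assume "x \<in> ?K"
        then obtain a v where x: "x = a \<odot> e b \<oplus> v" "a \<in> carrier R" "v \<in> U n" by blast
        show "x \<oplus> y \<in> ?K" if "y \<in> ?K" for y
        proof -
          obtain a' v' where y: "y = a' \<odot> e b \<oplus> v'" "a' \<in> carrier R" "v' \<in> U n"
            using \<open>y \<in> ?K\<close> by blast
          have "x \<oplus> y = (a \<oplus>\<^bsub>R\<^esub> a') \<odot> e b \<oplus> (v \<oplus> v')"
            using x y eb Uc by (simp add: smult_l_distr M.a_ac)
          moreover have "a \<oplus>\<^bsub>R\<^esub> a' \<in> carrier R" "v \<oplus> v' \<in> U n" using x y u(3) by simp_all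
          ultimately show ?thesis by blast
        qed
        show "a' \<odot> x \<in> ?K" if a': "a' \<in> carrier R" for a'
        proof -
          have "a' \<odot> x = (a' \<otimes>\<^bsub>R\<^esub> a) \<odot> e b \<oplus> a' \<odot> v"
            using x a' eb Uc by (simp add: smult_assoc smult_r_distr)
          moreover have "a' \<otimes>\<^bsub>R\<^esub> a \<in> carrier R" "a' \<odot> v \<in> U n" using x a' u(4) by simp_all
          ultimately show ?thesis by blast
        qed
      qed
      then have "e ` {b'\<in>B. rk b' < Suc n} \<subseteq> ?K \<Longrightarrow> U (Suc n) \<subseteq> ?K"
        unfolding U_def[of "Suc n"] by (rule lspan_minimal[rotated])
      moreover have "e ` {b'\<in>B. rk b' < Suc n} \<subseteq> ?K"
      proof
        fix y assume "y \<in> e ` {b'\<in>B. rk b' < Suc n}"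
        then consider "y = e b" | "y \<in> e ` {b'\<in>B. rk b' < n}" unfolding set by blast
        then show "y \<in> ?K"
        proof cases
          case 1
          then show ?thesis using u(2) eb
            by (intro CollectI exI[of _ "\<one>\<^bsub>R\<^esub>"] exI[of _ "\<zero>"]) simp
        next
          case 2
          then have "y \<in> U n" unfolding U_def by (rule subsetD[OF subset_lspan])
          then show ?thesis using eb Uc
            by (intro CollectI exI[of _ "\<zero>\<^bsub>R\<^esub>"] exI[of _ y]) (simp add: smult_zero)
        qed
      qed
      ultimately have K: "U (Suc n) \<subseteq> ?K" .
      show ?thesis
      proof
        fix x assume x: "x \<in> N \<inter> U (Suc n)"
        then obtain a v where av: "x = a \<odot> e b \<oplus> v" "a \<in> carrier R" "v \<in> U n" using K by blast
        then have "a \<in> leading R M N (e b) (U n)" using x by (auto simp: leading_def)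
        then have "a \<in> leading R M P (e b) (U n)" using lead[OF b(1)] b(2) by (auto simp: U_def)
        then obtain w where w: "w \<in> U n" "a \<odot> e b \<oplus> w \<in> P" by (auto simp: leading_def)
        let ?y = "a \<odot> e b \<oplus> w"
        have c: "a \<odot> e b \<in> carrier M" "v \<in> carrier M" "w \<in> carrier M" using av w eb Uc by auto
        have "x \<ominus> ?y = v \<ominus> w"
          unfolding av(1) a_minus_def using c by (simp add: M.minus_add M.a_ac M.r_neg M.r_neg1)
        moreover have "v \<ominus> w \<in> U n" using u(5) av(3) w(1) by blast
        moreover have "x \<ominus> ?y \<in> N" using nn(5) x w(2) PN by blast
        ultimately have "x \<ominus> ?y \<in> P" using Suc by auto
        then have "(x \<ominus> ?y) \<oplus> ?y \<in> P" using p(3) w(2) by blast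
        moreover have "x \<in> carrier M" using x nn(1) by blast
        ultimately show "x \<in> P" using c by (simp add: a_minus_def M.a_assoc M.l_neg)
      qed
    qed
  qed
  obtain n where n: "\<forall>b\<in>B. rk b < n"
    using finite_nat_set_iff_bounded[of "rk ` B"] B by auto
  then have "{b\<in>B. rk b < n} = B" by blast
  then have "N \<subseteq> U n" using span by (simp add: U_def)
  with step[of n] show ?thesis by blast
qed

text \<open>
  The ideals of leading coefficients of \<open>N\<close> are finitely generated; elements of \<open>N\<close> that realize their
  generators span a submodule with the same ideals.
\<close>

lemma noetherian_submodule_fg:
  assumes R: "left_noetherian R" and N: "submodule N R M"
    and B: "finite B" and e: "B \<subseteq> carrier M" and span: "N \<subseteq> lspan R M B"
  shows "\<exists>S. finite S \<and> S \<subseteq> N \<and> lspan R M S = N"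
proof -
  obtain rk :: "'m \<Rightarrow> nat" where rk: "inj_on rk B"
    using finite_imp_inj_to_nat_seg[OF B] by blast
  let ?U = "\<lambda>b. lspan R M {b'\<in>B. rk b' < rk b}"
  have U: "submodule (?U b) R M" for b by (rule submodule_lspan) (use e in auto)
  have gens: "\<exists>T. finite T \<and> T \<subseteq> N \<and> leading R M N b (?U b) \<subseteq>
      lspan R (regular_module R) {a \<in> carrier R. \<exists>u\<in>?U b. a \<odot> b \<oplus> u \<in> T}" if b: "b \<in> B" for b
  proof -
    have "submodule (leading R M N b (?U b)) R (regular_module R)"
      by (rule submodule_leading[OF N U]) (use b e in auto)
    then have "\<exists>S\<subseteq>carrier R. finite S \<and> leading R M N b (?U b) = lspan R (regular_module R) S"
      using R by (simp add: left_noetherian_def)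
    then obtain S where S: "S \<subseteq> carrier R" "finite S"
      "leading R M N b (?U b) = lspan R (regular_module R) S"
      by blast
    have "\<forall>a\<in>S. \<exists>u\<in>?U b. a \<odot> b \<oplus> u \<in> N"
      using subset_lspan[of S R "regular_module R"] S(3) unfolding leading_def by blast
    then obtain h where h: "\<forall>a\<in>S. h a \<in> ?U b \<and> a \<odot> b \<oplus> h a \<in> N" by metis
    let ?T = "(\<lambda>a. a \<odot> b \<oplus> h a) ` S"
    have "S \<subseteq> {a \<in> carrier R. \<exists>u\<in>?U b. a \<odot> b \<oplus> u \<in> ?T}" using S(1) h by blast
    then have "leading R M N b (?U b) \<subseteq>
        lspan R (regular_module R) {a \<in> carrier R. \<exists>u\<in>?U b. a \<odot> b \<oplus> u \<in> ?T}"
      unfolding S(3) by (rule lspan_mono)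
    moreover have "finite ?T" "?T \<subseteq> N" using S(2) h by auto
    ultimately show ?thesis by blast
  qed
  then have "\<exists>T. \<forall>b\<in>B. finite (T b) \<and> T b \<subseteq> N \<and> leading R M N b (?U b) \<subseteq>
      lspan R (regular_module R) {a \<in> carrier R. \<exists>u\<in>?U b. a \<odot> b \<oplus> u \<in> T b}"
    by (intro bchoice ballI)
  then obtain T where T: "\<forall>b\<in>B. finite (T b) \<and> T b \<subseteq> N \<and> leading R M N b (?U b) \<subseteq>
      lspan R (regular_module R) {a \<in> carrier R. \<exists>u\<in>?U b. a \<odot> b \<oplus> u \<in> T b}"
    by (elim exE) (rule that)
  let ?S = "\<Union>b\<in>B. T b"
  have S: "finite ?S" "?S \<subseteq> N" using T B by blast+
  have P: "submodule (lspan R M ?S) R M"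
    by (rule submodule_lspan) (use S(2) submodule_closed(1)[OF N] in blast)
  have PN: "lspan R M ?S \<subseteq> N" by (rule lspan_minimal[OF S(2) N])
  interpret L: lmodule R "regular_module R" by (rule lmodule_regular) unfold_locales
  have "N \<subseteq> lspan R M ?S"
  proof (rule subset_by_leading[OF P N PN B rk, where e = "\<lambda>b. b"])
    fix b assume b: "b \<in> B"
    have "submodule (leading R M (lspan R M ?S) b (?U b)) R (regular_module R)"
      by (rule submodule_leading[OF P U]) (use b e in auto)
    moreover have "{a \<in> carrier R. \<exists>u\<in>?U b. a \<odot> b \<oplus> u \<in> T b} \<subseteq>
        leading R M (lspan R M ?S) b (?U b)"
      unfolding leading_def using subset_lspan[of ?S R M] b by blast
    ultimately have "leading R M N b (?U b) \<subseteq> leading R M (lspan R M ?S) b (?U b)"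
      using bspec[OF T b] L.lspan_minimal by (meson order_trans)
    then show "leading R M N b (lspan R M ((\<lambda>b. b) ` {b'\<in>B. rk b' < rk b})) \<subseteq>
      leading R M (lspan R M ?S) b (lspan R M ((\<lambda>b. b) ` {b'\<in>B. rk b' < rk b}))"
      by simp
  qed (use e span in auto)
  with S PN show ?thesis by blast
qed

text \<open>
  Spans do not depend on the ambient module in which they are formed.
\<close>

lemma lspan_restrict_carrier:
  assumes N: "submodule N R M" and S: "S \<subseteq> N"
  shows "lspan R (M\<lparr>carrier := N\<rparr>) S = lspan R M S"
proof -
  have sub: "submodule P R (M\<lparr>carrier := N\<rparr>) \<longleftrightarrow> submodule P R M \<and> P \<subseteq> N" for P
  proof -
    have sN: "subgroup N (add_monoid M)" using N by (rule submodule.axioms)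
    have eq: "add_monoid (M\<lparr>carrier := N\<rparr>) = (add_monoid M)\<lparr>carrier := N\<rparr>" by simp
    have "subgroup P ((add_monoid M)\<lparr>carrier := N\<rparr>) \<longleftrightarrow> subgroup P (add_monoid M) \<and> P \<subseteq> N"
      using M.add.subgroup_incl[of P N] M.add.incl_subgroup[OF sN, of P] sN
        subgroup.subset[of P "(add_monoid M)\<lparr>carrier := N\<rparr>"] by auto
    then show ?thesis
      by (simp add: submodule_def submodule_axioms_def)
        (auto simp: eq)
  qed
  have "submodule (lspan R M S) R M"
    by (rule submodule_lspan) (use S submodule_closed(1)[OF N] in blast)
  moreover have "lspan R M S \<subseteq> N" by (rule lspan_minimal[OF S N])
  ultimately have "submodule (lspan R M S) R (M\<lparr>carrier := N\<rparr>)" using sub by blast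
  then have "lspan R (M\<lparr>carrier := N\<rparr>) S \<subseteq> lspan R M S"
    unfolding lspan_def[of R "M\<lparr>carrier := N\<rparr>"] using subset_lspan[of S R M] by (intro hull_minimal)
  moreover have "lspan R M S \<subseteq> lspan R (M\<lparr>carrier := N\<rparr>) S"
    unfolding lspan_def hull_def using sub by blast
  ultimately show ?thesis by blast
qed

end


section \<open>Finite generation of submodules\<close>

type_synonym ('v, 'a, 'm) generator = "(('v, 'a) ugraph \<times> 'm) \<times> (('v, 'a) elt \<Rightarrow> ('v, 'a) elt)"

text \<open>
  The set \<open>J\<close> contains the generators of \<open>M\<close>, each with the graph at which it lives. The numberings \<open>c\<close>
  and \<open>cj\<close> are arbitrary; they serve to order the values of minor morphisms and the generators.
\<close>

locale graph_module =
  fixes g :: nat and R :: "('r, 'e) ring_scheme" and M :: "('v, 'a, 'r, 'm) gmodule"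
    and J :: "(('v, 'a) ugraph \<times> 'm) set"
    and c :: "('v, 'a) elt \<Rightarrow> nat" and cj :: "('v, 'a) ugraph \<times> 'm \<Rightarrow> nat"
  assumes gmodule: "is_gmodule g R M"
    and finite_J: "finite J"
    and J_graph: "j \<in> J \<Longrightarrow> fst j \<in> graphs_genus_le g"
    and J_elt: "j \<in> J \<Longrightarrow> snd j \<in> carrier (obj M (fst j))"
    and c: "j \<in> J \<Longrightarrow> inj_on c (elts (fst j))"
    and cj: "inj_on cj J"
    and spans: "G \<in> graphs_genus_le g \<Longrightarrow>
      carrier (obj M G) \<subseteq>
        lspan R (obj M G) {mor M G (fst j) \<phi> (snd j) |j \<phi>. j \<in> J \<and> minor_morphism G (fst j) \<phi>}"
begin

abbreviation "\<G> \<equiv> graphs_genus_le g :: ('v, 'a) ugraph set"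

definition gens :: "('v, 'a) ugraph \<Rightarrow> ('v, 'a, 'm) generator set" where
  "gens G = {(j, \<phi>). j \<in> J \<and> minor_morphism G (fst j) \<phi>}"

definition value_at :: "('v, 'a) ugraph \<Rightarrow> ('v, 'a, 'm) generator \<Rightarrow> 'm" where
  "value_at G b = mor M G (fst (fst b)) (snd b) (snd (fst b))"

definition less_at :: "('v, 'a) ugraph \<Rightarrow> ('v, 'a, 'm) generator \<Rightarrow> ('v, 'a, 'm) generator \<Rightarrow> bool" where
  "less_at G b b' \<longleftrightarrow> cj (fst b) < cj (fst b') \<or>
     fst b = fst b' \<and> lex_less c (graph_frame G) (snd b) (snd b')"

definition rank_at :: "('v, 'a) ugraph \<Rightarrow> ('v, 'a, 'm) generator \<Rightarrow> nat" where
  "rank_at G b = card {b'\<in>gens G. less_at G b' b}"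

definition smaller :: "('v, 'a) ugraph \<Rightarrow> ('v, 'a, 'm) generator \<Rightarrow> 'm set" where
  "smaller G b = lspan R (obj M G) (value_at G ` {b'\<in>gens G. less_at G b' b})"

definition pull :: "('v, 'a) ugraph \<Rightarrow> (('v, 'a) elt \<Rightarrow> ('v, 'a) elt) \<Rightarrow>
    ('v, 'a, 'm) generator \<Rightarrow> ('v, 'a, 'm) generator" where
  "pull G' f b = (fst b, compose (elts G') (snd b) f)"

lemma G_graph: "G \<in> \<G> \<Longrightarrow> is_graph G"
  by (simp add: graphs_genus_le_def)

lemma lmodule_obj: "G \<in> \<G> \<Longrightarrow> lmodule R (obj M G)"
  using gmodule by (simp add: is_gmodule_def lmodule_def)

lemma mor_linear: "G \<in> \<G> \<Longrightarrow> G' \<in> \<G> \<Longrightarrow> minor_morphism G G' \<phi> \<Longrightarrow>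
    linear_map R (obj M G') (obj M G) (mor M G G' \<phi>)"
  using gmodule by (simp add: is_gmodule_def)

lemma mor_in: "G \<in> \<G> \<Longrightarrow> G' \<in> \<G> \<Longrightarrow> minor_morphism G G' \<phi> \<Longrightarrow> x \<in> carrier (obj M G') \<Longrightarrow>
    mor M G G' \<phi> x \<in> carrier (obj M G)"
  using mor_linear[of G G' \<phi>] by (auto simp: linear_map_def hom_def)

lemma mor_compose: "G \<in> \<G> \<Longrightarrow> G' \<in> \<G> \<Longrightarrow> G'' \<in> \<G> \<Longrightarrow> minor_morphism G G' \<phi> \<Longrightarrow>
    minor_morphism G' G'' \<psi> \<Longrightarrow> x \<in> carrier (obj M G'') \<Longrightarrow>
    mor M G G'' (compose (elts G) \<psi> \<phi>) x = mor M G G' \<phi> (mor M G' G'' \<psi> x)"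
  using gmodule by (simp add: is_gmodule_def)

lemma gensD:
  assumes "b \<in> gens G"
  shows "fst b \<in> J" "minor_morphism G (fst (fst b)) (snd b)"
  using assms by (auto simp: gens_def)

lemma value_in: "G \<in> \<G> \<Longrightarrow> b \<in> gens G \<Longrightarrow> value_at G b \<in> carrier (obj M G)"
  unfolding value_at_def by (intro mor_in J_graph J_elt gensD)

lemma finite_gens:
  assumes G: "G \<in> \<G>"
  shows "finite (gens G)"
proof -
  have "gens G \<subseteq> (SIGMA j:J. elts G \<rightarrow>\<^sub>E elts (fst j))"
    using minor_morphismD(1) by (fastforce simp: gens_def)
  moreover have "finite (SIGMA j:J. elts G \<rightarrow>\<^sub>E elts (fst j))"
    using finite_J G_graph[OF G] G_graph[OF J_graph]
    by (intro finite_SigmaI finite_PiE finite_elts) simp_all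
  ultimately show ?thesis by (rule finite_subset)
qed

lemma lspan_gens:
  assumes G: "G \<in> \<G>"
  shows "carrier (obj M G) \<subseteq> lspan R (obj M G) (value_at G ` gens G)"
proof -
  have "{mor M G (fst j) \<phi> (snd j) |j \<phi>. j \<in> J \<and> minor_morphism G (fst j) \<phi>} \<subseteq> value_at G ` gens G"
    by (force simp: value_at_def gens_def)
  from lspan_mono[OF this] spans[OF G] show ?thesis by blast
qed

lemma submodule_smaller: "G \<in> \<G> \<Longrightarrow> submodule (smaller G b) R (obj M G)"
  unfolding smaller_def by (rule lmodule.submodule_lspan[OF lmodule_obj]) (auto intro: value_in)

lemma less_at_order:
  assumes G: "G \<in> \<G>"
  shows "\<not> less_at G b b"
    and "less_at G b b' \<Longrightarrow> less_at G b' b'' \<Longrightarrow> less_at G b b''"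
    and "b \<in> gens G \<Longrightarrow> b' \<in> gens G \<Longrightarrow> b \<noteq> b' \<Longrightarrow> less_at G b b' \<or> less_at G b' b"
proof -
  interpret framed_graph G "graph_frame G" by (rule framed_graph_frame[OF G])
  show "\<not> less_at G b b" using lex_less_irrefl by (auto simp: less_at_def)
  show "less_at G b b''" if "less_at G b b'" "less_at G b' b''"
    using that lex_less_trans[of c "snd b" "snd b'" "snd b''"] by (auto simp: less_at_def)
  show "less_at G b b' \<or> less_at G b' b" if b: "b \<in> gens G" "b' \<in> gens G" "b \<noteq> b'"
  proof (cases "fst b = fst b'")
    case True
    then have "snd b \<noteq> snd b'" using b(3) by (auto simp: prod_eq_iff)
    moreover have "minor_morphism G (fst (fst b)) (snd b)" "minor_morphism G (fst (fst b)) (snd b')"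
      using gensD(2)[OF b(1)] gensD(2)[OF b(2)] True by simp_all
    ultimately show ?thesis
      using lex_less_total[OF c[OF gensD(1)[OF b(1)]]] True by (auto simp: less_at_def)
  next
    case False
    then have "cj (fst b) \<noteq> cj (fst b')"
      using inj_onD[OF cj _ gensD(1)[OF b(1)] gensD(1)[OF b(2)]] by blast
    then show ?thesis by (auto simp: less_at_def)
  qed
qed

lemma rank_at_less:
  assumes G: "G \<in> \<G>" and b: "b \<in> gens G" and less: "less_at G b b'"
  shows "rank_at G b < rank_at G b'"
  unfolding rank_at_def
proof (rule psubset_card_mono)
  show "finite {x\<in>gens G. less_at G x b'}" using finite_gens[OF G] by simp
  have "{x\<in>gens G. less_at G x b} \<subseteq> {x\<in>gens G. less_at G x b'}"
    using less_at_order(2)[OF G _ less] by blast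
  moreover have "b \<in> {x\<in>gens G. less_at G x b'}" "b \<notin> {x\<in>gens G. less_at G x b}"
    using b less less_at_order(1)[OF G] by simp_all
  ultimately show "{x\<in>gens G. less_at G x b} \<subset> {x\<in>gens G. less_at G x b'}" by blast
qed

lemma rank_at_iff:
  assumes G: "G \<in> \<G>" and b: "b \<in> gens G" "b' \<in> gens G"
  shows "rank_at G b < rank_at G b' \<longleftrightarrow> less_at G b b'"
proof
  assume r: "rank_at G b < rank_at G b'"
  then have "b \<noteq> b'" by auto
  with less_at_order(3)[OF G b] rank_at_less[OF G b(2), of b] r show "less_at G b b'" by fastforce
qed (rule rank_at_less[OF G b(1)])

lemma rank_at_inj: "G \<in> \<G> \<Longrightarrow> inj_on (rank_at G) (gens G)"
proof (rule inj_onI, rule ccontr)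
  fix b b' assume "G \<in> \<G>" "b \<in> gens G" "b' \<in> gens G" "rank_at G b = rank_at G b'" "b \<noteq> b'"
  with less_at_order(3)[of G b b'] rank_at_less[of G b b'] rank_at_less[of G b' b] show False by auto
qed

lemma smaller_rank: "G \<in> \<G> \<Longrightarrow> b \<in> gens G \<Longrightarrow>
    smaller G b = lspan R (obj M G) (value_at G ` {b'\<in>gens G. rank_at G b' < rank_at G b})"
proof -
  assume G: "G \<in> \<G>" "b \<in> gens G"
  then have "{b'\<in>gens G. rank_at G b' < rank_at G b} = {b'\<in>gens G. less_at G b' b}"
    using rank_at_iff by blast
  then show ?thesis by (simp add: smaller_def)
qed

context
  fixes G G' f
  assumes G: "G \<in> \<G>" "G' \<in> \<G>" and f: "ordered_pullback c G G' f"
begin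

lemma pull_minor: "minor_morphism G' G f"
  using f by (simp add: ordered_pullback_def)

lemma pull_in: "b \<in> gens G \<Longrightarrow> pull G' f b \<in> gens G'"
  using minor_morphism_compose[OF G_graph[OF G(2)] G_graph[OF G(1)] G_graph[OF J_graph] pull_minor]
  by (auto simp: gens_def pull_def)

lemma value_pull: "b \<in> gens G \<Longrightarrow> value_at G' (pull G' f b) = mor M G' G f (value_at G b)"
  unfolding value_at_def pull_def
  using mor_compose[OF G(2,1) J_graph pull_minor _ J_elt] gensD by simp

lemma pull_less: "less_at G b b' \<Longrightarrow> less_at G' (pull G' f b) (pull G' f b')"
  using f by (auto simp: less_at_def pull_def ordered_pullback_def)

text \<open>
  The span of the smaller generators is mapped into the corresponding span, because pullback along
  \<open>f\<close> is strictly increasing.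
\<close>

lemma mor_smaller:
  assumes b: "b \<in> gens G" and u: "u \<in> smaller G b"
  shows "mor M G' G f u \<in> smaller G' (pull G' f b)"
proof -
  have "mor M G' G f ` smaller G b \<subseteq>
      lspan R (obj M G') (mor M G' G f ` value_at G ` {b'\<in>gens G. less_at G b' b})"
    unfolding smaller_def
    by (rule image_lspan[OF _ _ mor_linear[OF G(2,1) pull_minor]])
      (use lmodule_obj G in \<open>auto simp: lmodule_def value_in\<close>)
  also have "\<dots> \<subseteq> smaller G' (pull G' f b)"
    unfolding smaller_def
  proof (rule lspan_mono, rule subsetI)
    fix y assume "y \<in> mor M G' G f ` value_at G ` {b'\<in>gens G. less_at G b' b}"
    then obtain b' where b': "b' \<in> gens G" "less_at G b' b" "y = mor M G' G f (value_at G b')" by blast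
    then show "y \<in> value_at G' ` {b'\<in>gens G'. less_at G' b' (pull G' f b)}"
      using value_pull[OF b'(1)] pull_in[OF b'(1)] pull_less[OF b'(2)] by (intro image_eqI) simp_all
  qed
  finally show ?thesis using u by blast
qed

lemma mor_leading:
  assumes b: "b \<in> gens G" and N: "N \<subseteq> carrier (obj M G)"
    and P: "mor M G' G f ` N \<subseteq> P"
  shows "leading R (obj M G) N (value_at G b) (smaller G b) \<subseteq>
    leading R (obj M G') P (value_at G' (pull G' f b)) (smaller G' (pull G' f b))"
proof
  fix a assume "a \<in> leading R (obj M G) N (value_at G b) (smaller G b)"
  then obtain u where a: "a \<in> carrier R" "u \<in> smaller G b"
    "a \<odot>\<^bsub>obj M G\<^esub> value_at G b \<oplus>\<^bsub>obj M G\<^esub> u \<in> N" by (auto simp: leading_def)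
  interpret L: lmodule R "obj M G" by (rule lmodule_obj[OF G(1)])
  let ?m = "mor M G' G f"
  have lin: "linear_map R (obj M G) (obj M G') ?m" by (rule mor_linear[OF G(2,1) pull_minor])
  have u: "u \<in> carrier (obj M G)"
    using L.submodule_closed(1)[OF submodule_smaller[OF G(1)]] a(2) by blast
  have v: "value_at G b \<in> carrier (obj M G)" by (rule value_in[OF G(1) b])
  have "?m (a \<odot>\<^bsub>obj M G\<^esub> value_at G b \<oplus>\<^bsub>obj M G\<^esub> u) =
      a \<odot>\<^bsub>obj M G'\<^esub> value_at G' (pull G' f b) \<oplus>\<^bsub>obj M G'\<^esub> ?m u"
    using lin a(1) u v value_pull[OF b] by (simp add: linear_map_def hom_def)
  then have "a \<odot>\<^bsub>obj M G'\<^esub> value_at G' (pull G' f b) \<oplus>\<^bsub>obj M G'\<^esub> ?m u \<in> P"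
    using P a(3) by (metis imageI subsetD)
  with a(1) mor_smaller[OF b a(2)]
  show "a \<in> leading R (obj M G') P (value_at G' (pull G' f b)) (smaller G' (pull G' f b))"
    by (auto simp: leading_def)
qed

end

definition lead :: "(('v, 'a) ugraph \<Rightarrow> 'm set) \<Rightarrow> ('v, 'a) ugraph \<Rightarrow> ('v, 'a, 'm) generator \<Rightarrow> 'r set" where
  "lead N G b = leading R (obj M G) (N G) (value_at G b) (smaller G b)"

text \<open>
  The second pair is an order-preserving pullback of the first one with the same leading
  coefficients of \<open>N\<close>.
\<close>

definition same_lead where
  "same_lead N x y \<longleftrightarrow> (\<exists>f. ordered_pullback c (fst x) (fst y) f \<and> snd y = pull (fst y) f (snd x) \<and>
     lead N (fst x) (snd x) = lead N (fst y) (snd y))"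

text \<open>
  Along a subsequence in which each pair is a pullback of the previous one, the ideals of leading
  coefficients increase, so two consecutive ones agree.
\<close>

lemma almost_full_same_lead:
  assumes R: "left_noetherian R" and N: "is_gsubmodule g R M N"
  shows "almost_full_on (same_lead N) (SIGMA G:\<G>. gens G)"
  unfolding almost_full_on_def
proof (intro allI impI)
  fix s :: "nat \<Rightarrow> ('v, 'a) ugraph \<times> ('v, 'a, 'm) generator"
  assume s: "\<forall>n. s n \<in> (SIGMA G:\<G>. gens G)"
  define G where "G n = fst (s n)" for n
  define b where "b n = snd (s n)" for n
  have G: "G n \<in> \<G>" and b: "b n \<in> gens (G n)" for n
    using s[rule_format, of n] by (auto simp: G_def b_def)
  have Nsub: "submodule (N H) R (obj M H)" if "H \<in> \<G>" for H
    using N that by (simp add: is_gsubmodule_def)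
  let ?P = "\<lambda>(G :: ('v, 'a) ugraph, j, \<phi>) (G' :: ('v, 'a) ugraph, j', \<phi>'). j = j' \<and>
       (\<exists>f. ordered_pullback c G G' f \<and> \<phi>' = compose (elts G') \<phi> f)"
  have "almost_full_on ?P {(G, j, \<phi>). G \<in> \<G> \<and> j \<in> J \<and> minor_morphism G (fst j) \<phi>}"
    by (rule almost_full_ordered_pullback[OF finite_J G_graph[OF J_graph]])
  moreover have "s n \<in> {(G, j, \<phi>). G \<in> \<G> \<and> j \<in> J \<and> minor_morphism G (fst j) \<phi>}" for n
    using s[rule_format, of n] by (auto simp: gens_def)
  ultimately have "\<exists>r :: nat \<Rightarrow> nat. strict_mono r \<and> (\<forall>i j. i < j \<longrightarrow> ?P (s (r i)) (s (r j)))"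
    by (rule almost_full_on_subsequence)
  then obtain r :: "nat \<Rightarrow> nat" where r: "strict_mono r" "\<forall>i j. i < j \<longrightarrow> ?P (s (r i)) (s (r j))"
    by (elim exE conjE) (rule that)
  have pull: "\<exists>f. ordered_pullback c (G (r n)) (G (r (Suc n))) f \<and> b (r (Suc n)) = pull (G (r (Suc n))) f (b (r n))" for n
    using r(2)[rule_format, of n "Suc n"] by (auto simp: G_def b_def pull_def split: prod.splits)
  have "\<exists>n. lead N (G (r (Suc n))) (b (r (Suc n))) = lead N (G (r n)) (b (r n))"
  proof (rule left_noetherian_chain[OF R, of "\<lambda>n. lead N (G (r n)) (b (r n))"])
    show "submodule (lead N (G (r n)) (b (r n))) R (regular_module R)" for n
      unfolding lead_def
      by (intro lmodule.submodule_leading lmodule_obj Nsub submodule_smaller value_in G b)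
    show "lead N (G (r n)) (b (r n)) \<subseteq> lead N (G (r (Suc n))) (b (r (Suc n)))" for n
    proof -
      obtain f where f: "ordered_pullback c (G (r n)) (G (r (Suc n))) f"
        "b (r (Suc n)) = pull (G (r (Suc n))) f (b (r n))" using pull by blast
      have "mor M (G (r (Suc n))) (G (r n)) f ` N (G (r n)) \<subseteq> N (G (r (Suc n)))"
        using N G f(1) unfolding is_gsubmodule_def ordered_pullback_def by blast
      from mor_leading[OF G G f(1) b lmodule.submodule_closed(1)[OF lmodule_obj[OF G] Nsub[OF G]] this]
      show ?thesis unfolding lead_def f(2) .
    qed
  qed
  then obtain n where n: "lead N (G (r (Suc n))) (b (r (Suc n))) = lead N (G (r n)) (b (r n))" by blast
  have "same_lead N (s (r n)) (s (r (Suc n)))"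
    using pull[of n] n by (auto simp: same_lead_def G_def b_def)
  moreover have "r n < r (Suc n)" using r(1) by (simp add: strict_mono_def)
  ultimately show "\<exists>i j. i < j \<and> same_lead N (s i) (s j)" by blast
qed

text \<open>
  Choose finitely many pairs such that any pair is above one of them with respect to \<open>same_lead\<close>, and
  let \<open>P\<close> be generated by the values of \<open>N\<close> at their graphs. Every ideal of leading coefficients of \<open>N\<close>
  equals one at a chosen pair and is carried by pullback into the ideal of \<open>P\<close>.
\<close>

lemma fg_gsubmodule:
  assumes R: "left_noetherian R" and N: "is_gsubmodule g R M N"
  shows "fg_gmodule g R (gsubmodule_of M N)"
proof -
  have Nsub: "submodule (N H) R (obj M H)" if "H \<in> \<G>" for H
    using N that by (simp add: is_gsubmodule_def)
  have NcH: "N H \<subseteq> carrier (obj M H)" if "H \<in> \<G>" for H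
    by (rule lmodule.submodule_closed(1)[OF lmodule_obj[OF that] Nsub[OF that]])
  have Nmor: "mor M G H \<phi> ` N H \<subseteq> N G" if "G \<in> \<G>" "H \<in> \<G>" "minor_morphism G H \<phi>" for G H \<phi>
    using N that unfolding is_gsubmodule_def by blast
  obtain B where B: "finite B" "B \<subseteq> (SIGMA G:\<G>. gens G)"
    "\<forall>x\<in>(SIGMA G:\<G>. gens G). \<exists>y\<in>B. same_lead N y x"
    using almost_full_on_finite_basis[OF almost_full_same_lead[OF R N]] by (elim exE conjE) (rule that)
  obtain Gs where Gs: "set Gs = fst ` B" using finite_list[of "fst ` B"] B(1) by blast
  have GsG: "set Gs \<subseteq> \<G>" using Gs B(2) by auto
  have obj: "obj (gsubmodule_of M N) H = (obj M H)\<lparr>carrier := N H\<rparr>" for H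
    by (simp add: gsubmodule_of_def)
  have mor: "mor (gsubmodule_of M N) = mor M" by (simp add: gsubmodule_of_def)
  have "fg_module R (obj (gsubmodule_of M N) H)" if H: "H \<in> set Gs" for H
  proof -
    have HG: "H \<in> \<G>" using H GsG by blast
    interpret L: lmodule R "obj M H" by (rule lmodule_obj[OF HG])
    have "N H \<subseteq> lspan R (obj M H) (value_at H ` gens H)"
      using NcH[OF HG] lspan_gens[OF HG] by blast
    with L.noetherian_submodule_fg[OF R Nsub[OF HG], of "value_at H ` gens H"]
    obtain S where S: "finite S" "S \<subseteq> N H" "lspan R (obj M H) S = N H"
      using finite_gens[OF HG] value_in[OF HG] by blast
    with L.lspan_restrict_carrier[OF Nsub[OF HG] S(2)] show ?thesis
      unfolding fg_module_def obj by auto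
  qed
  moreover have "lspan R (obj (gsubmodule_of M N) G)
      (\<Union>H\<in>set Gs. \<Union>\<phi>\<in>{\<phi>. minor_morphism G H \<phi>}.
         mor (gsubmodule_of M N) G H \<phi> ` carrier (obj (gsubmodule_of M N) H)) =
      carrier (obj (gsubmodule_of M N) G)" if G: "G \<in> \<G>" for G
  proof -
    interpret L: lmodule R "obj M G" by (rule lmodule_obj[OF G])
    let ?Y = "\<Union>H\<in>set Gs. \<Union>\<phi>\<in>{\<phi>. minor_morphism G H \<phi>}. mor M G H \<phi> ` N H"
    let ?P = "lspan R (obj M G) ?Y"
    have Y: "?Y \<subseteq> N G" using Nmor[OF G] GsG by blast
    have P: "submodule ?P R (obj M G)" by (rule L.submodule_lspan) (use Y NcH[OF G] in blast)
    have PN: "?P \<subseteq> N G" by (rule L.lspan_minimal[OF Y Nsub[OF G]])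
    have "N G \<subseteq> ?P"
    proof (rule L.subset_by_leading[OF P Nsub[OF G] PN finite_gens[OF G] rank_at_inj[OF G]])
      show "value_at G ` gens G \<subseteq> carrier (obj M G)" using value_in[OF G] by blast
      show "N G \<subseteq> lspan R (obj M G) (value_at G ` gens G)"
        using NcH[OF G] lspan_gens[OF G] by blast
      fix b assume b: "b \<in> gens G"
      obtain H b0 where Hb: "(H, b0) \<in> B" "same_lead N (H, b0) (G, b)"
        using B(3) G b by (metis SigmaI surj_pair)
      then have H: "H \<in> \<G>" "b0 \<in> gens H" "H \<in> set Gs" using B(2) Gs by force+
      obtain f where f: "ordered_pullback c H G f" "b = pull G f b0" "lead N H b0 = lead N G b"
        using Hb(2) by (auto simp: same_lead_def)
      have "mor M G H f ` N H \<subseteq> ?P"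
        using H(3) f(1) subset_lspan[of ?Y R "obj M G"] by (fastforce simp: ordered_pullback_def)
      from mor_leading[OF H(1) G f(1) H(2) NcH[OF H(1)] this]
      show "leading R (obj M G) (N G) (value_at G b)
          (lspan R (obj M G) (value_at G ` {b'\<in>gens G. rank_at G b' < rank_at G b})) \<subseteq>
        leading R (obj M G) ?P (value_at G b)
          (lspan R (obj M G) (value_at G ` {b'\<in>gens G. rank_at G b' < rank_at G b}))"
        unfolding smaller_rank[OF G b, symmetric] using f(2,3) by (simp add: lead_def)
    qed
    with PN have "?P = N G" by blast
    then show ?thesis
      unfolding obj mor using L.lspan_restrict_carrier[OF Nsub[OF G] Y] by simp
  qed
  ultimately show ?thesis unfolding fg_gmodule_def using GsG by blast
qed

end

theorem theorem1p1:
  fixes g :: nat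
    and R :: "('r, 'e) ring_scheme"
    and M :: "('v::infinite, 'a::infinite, 'r, 'm) gmodule"
    and N :: "('v, 'a) ugraph \<Rightarrow> 'm set"
  assumes "left_noetherian R"
    and "is_gmodule g R M"
    and "fg_gmodule g R M"
    and "is_gsubmodule g R M N"
  shows "fg_gmodule g R (gsubmodule_of M N)"
proof -
  let ?\<G> = "graphs_genus_le g :: ('v, 'a) ugraph set"
  obtain Gs where Gs: "set Gs \<subseteq> ?\<G>" "\<forall>H\<in>set Gs. fg_module R (obj M H)"
    and span: "\<forall>G\<in>?\<G>. lspan R (obj M G)
      (\<Union>H\<in>set Gs. \<Union>\<phi>\<in>{\<phi>. minor_morphism G H \<phi>}. mor M G H \<phi> ` carrier (obj M H)) = carrier (obj M G)"
    using assms(3) unfolding fg_gmodule_def by blast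
  have lm: "left_module R (obj M G)" if "G \<in> ?\<G>" for G
    using assms(2) that by (simp add: is_gmodule_def)
  have lin: "linear_map R (obj M H) (obj M G) (mor M G H \<phi>)"
    if "G \<in> ?\<G>" "H \<in> ?\<G>" "minor_morphism G H \<phi>" for G H \<phi>
    using assms(2) that by (simp add: is_gmodule_def)
  have "\<exists>S. \<forall>H\<in>set Gs. S H \<subseteq> carrier (obj M H) \<and> finite (S H) \<and>
      lspan R (obj M H) (S H) = carrier (obj M H)"
    by (rule bchoice) (use Gs(2) in \<open>auto simp: fg_module_def\<close>)
  then obtain S where S: "\<forall>H\<in>set Gs. S H \<subseteq> carrier (obj M H) \<and> finite (S H) \<and>
      lspan R (obj M H) (S H) = carrier (obj M H)" by (elim exE) (rule that)
  have S_in: "m \<in> carrier (obj M H)" if "H \<in> set Gs" "m \<in> S H" for H m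
    using bspec[OF S that(1)] that(2) by blast
  define J where "J = (SIGMA H:set Gs. S H)"
  have J: "finite J" using S by (auto simp: J_def)
  have fin: "finite (\<Union>H\<in>set Gs. elts H)"
  proof (intro finite_UN_I finite_elts)
    show "is_graph H" if "H \<in> set Gs" for H
      using Gs(1) that by (auto simp: graphs_genus_le_def)
  qed simp
  obtain c :: "('v, 'a) elt \<Rightarrow> nat" where c: "inj_on c (\<Union>H\<in>set Gs. elts H)"
    using finite_imp_inj_to_nat_seg[OF fin] by blast
  obtain cj :: "('v, 'a) ugraph \<times> 'm \<Rightarrow> nat" where cj: "inj_on cj J"
    using finite_imp_inj_to_nat_seg[OF J] by blast
  interpret graph_module g R M J c cj
  proof unfold_locales
    show "is_gmodule g R M" by fact
    show "fst j \<in> ?\<G>" "snd j \<in> carrier (obj M (fst j))" if "j \<in> J" for j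
      using that Gs(1) S_in by (auto simp: J_def)
    show "inj_on c (elts (fst j))" if "j \<in> J" for j
      by (rule inj_on_subset[OF c]) (use that in \<open>auto simp: J_def\<close>)
    fix G assume G: "G \<in> ?\<G>"
    interpret L: lmodule R "obj M G" by (rule lmodule.intro[OF lm[OF G]])
    let ?E = "{mor M G (fst j) \<phi> (snd j) |j \<phi>. j \<in> J \<and> minor_morphism G (fst j) \<phi>}"
    have E: "?E \<subseteq> carrier (obj M G)"
    proof
      fix x assume "x \<in> ?E"
      then obtain j \<phi> where j: "j \<in> J" "minor_morphism G (fst j) \<phi>" "x = mor M G (fst j) \<phi> (snd j)"
        by blast
      then have "fst j \<in> ?\<G>" "snd j \<in> carrier (obj M (fst j))" using Gs(1) S_in by (auto simp: J_def)
      with lin[OF G _ j(2)] j(3) show "x \<in> carrier (obj M G)" by (auto simp: linear_map_def hom_def)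
    qed
    have "mor M G H \<phi> ` carrier (obj M H) \<subseteq> lspan R (obj M G) ?E"
      if H: "H \<in> set Gs" "minor_morphism G H \<phi>" for H \<phi>
    proof -
      have HG: "H \<in> ?\<G>" using H(1) Gs(1) by blast
      have SH: "S H \<subseteq> carrier (obj M H)" "lspan R (obj M H) (S H) = carrier (obj M H)"
        using S H(1) by simp_all
      have "mor M G H \<phi> ` carrier (obj M H) \<subseteq> lspan R (obj M G) (mor M G H \<phi> ` S H)"
        using image_lspan[OF lm[OF HG] lm[OF G] lin[OF G HG H(2)] SH(1)] by (simp add: SH(2))
      also have "\<dots> \<subseteq> lspan R (obj M G) ?E"
      proof (rule lspan_mono, rule image_subsetI)
        fix m assume "m \<in> S H"
        then have "(H, m) \<in> J" using H(1) by (simp add: J_def)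
        with H(2) show "mor M G H \<phi> m \<in> ?E"
          by (intro CollectI exI[of _ "(H, m)"] exI[of _ \<phi>]) simp
      qed
      finally show ?thesis .
    qed
    then have "(\<Union>H\<in>set Gs. \<Union>\<phi>\<in>{\<phi>. minor_morphism G H \<phi>}. mor M G H \<phi> ` carrier (obj M H))
        \<subseteq> lspan R (obj M G) ?E" by blast
    from L.lspan_minimal[OF this L.submodule_lspan[OF E]] bspec[OF span G]
    show "carrier (obj M G) \<subseteq> lspan R (obj M G) ?E" by simp
  qed (rule J cj)+
  show ?thesis by (rule fg_gsubmodule[OF assms(1,4)])
qed

end
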